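(* Let $(X_i,Y_i)$, $i\ge 1$, be i.i.d. copies of $(X,Y)$ with $Y=\beta_0^TX+\epsilon$, and suppose that assumptions (A1)-(A11) listed in the context hold. Let $\widehat\beta_n$ be the maximum likelihood estimator of $\beta_0$, i.e. the first component of a maximizer $(\widehat\beta_n,\widehat s_n)$ over $\mathbb R^d\times(0,\infty)$ of $$\ell_n(\beta,s)=-n\log s+\sum_{i=1}^n\log f\left(\frac{Y_i-\beta^TX_i}{s}\right),$$ and let $\widehat\beta_n^{\mathrm{OLS}}=\left(\sum_{i=1}^nX_iX_i^T\right)^{-1}\sum_{i=1}^nX_iY_i$ be the ordinary least squares estimator. Then $\widehat\beta_n$ is asymptotically at least as efficient as $\widehat\beta_n^{\mathrm{OLS}}$. More specifically, if $\eta$ denotes the asymptotic relative efficiency of $\widehat\beta_n$ with respect to $\widehat\beta_n^{\mathrm{OLS}}$ (defined in the context), then $$\eta=\left[\left(\int_{\mathbb R}t^2f(t)\,dt\right)\left(\int_{\mathbb R}\frac{(f'(t))^2}{f(t)}\,dt\right)\right]^{-1}\le1,$$ with equality $\eta=1$ if and only if $\epsilon\sim\mathcal N(0,\sigma^2)$, where $\sigma^2=\mathrm{var}(\epsilon)$.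
   Context: Setting: $d\ge1$ is an integer, $\beta_0\in\mathbb R^d$ and $s_0\in(0,\infty)$ are the true (unknown) regression vector and scale, and $\mathbb E_{(\beta_0,s_0)}$ denotes expectation under the true distribution of $(X,Y)$. Write $f_s(t)=s^{-1}f(t/s)$ for $s>0$. Convention: $\log 0=-\infty$. $\|\cdot\|$ is the Euclidean norm. Asymptotic relative efficiency: if $\sqrt n(\widehat\beta_n-\beta_0)$ and $\sqrt n(\widehat\beta_n^{\mathrm{OLS}}-\beta_0)$ converge in distribution to centered $d$-dimensional Gaussian vectors with covariance matrices $\Sigma_{\mathrm{MLE}}$ and $\Sigma_{\mathrm{OLS}}$ respectively, then $$\eta=\left(\frac{\det\Sigma_{\mathrm{MLE}}}{\det\Sigma_{\mathrm{OLS}}}\right)^{1/d};$$ $\eta\le 1$ means that the MLE is asymptotically at least as efficient as the OLSE. Assumptions: (A1) $X$ and $\epsilon$ are independent. (A2) The distribution of $X$ admits a density $f^X$ with respect to Lebesgue measure on $\mathbb R^d$. (A3) The distribution of $\epsilon$ admits the density $f^\epsilon(t)=s_0^{-1}f(t/s_0)$, where $f$ is a known even, bounded and continuous probability density on $\mathbb R$ with $\int_{\mathbb R}t^2f(t)\,dt<\infty$. (A4) There exist $\alpha>0$ and $C>0$ such that $f(t)\le C\exp(-|t|^\alpha)$ for all $t$. (A5) $\mathbb E_{(\beta_0,s_0)}\left|\log f\left(\frac{Y-\beta_0^TX}{s_0}\right)\right|<\infty$. (A6) $\mathbb E[\|X\|^{\max(2\alpha,2)}]<\infty$, with $\alpha$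 as in (A4). (A7) $f$ is non-increasing on $[0,\infty)$. (A8) $\mathbb E_{(\beta_0,s_0)}\left[\left(\log f\left(\frac{|Y|+R\|X\|}{a}\right)\right)^2\right]<\infty$ for any $R>0$, $a>0$. (A9) $f$ is twice continuously differentiable on the interior of its support. (A10) For all $\delta>0$ there exists $\eta'>0$ such that whenever $\|\beta^*-\beta_0\|+|s^*-s_0|\le\eta'$, it holds for all $1\le i,j\le d$ that $$\sup_{(x,y)}\left|\frac{\partial^2\log f_s(y-\beta^Tx)}{\partial\beta_i\,\partial\beta_j}\Big|_{(\beta,s)=(\beta_0,s_0)}-\frac{\partial^2\log f_s(y-\beta^Tx)}{\partial\beta_i\,\partial\beta_j}\Big|_{(\beta,s)=(\beta^*,s^* )}\right|<\delta,$$ where the supremum is over $(x,y)$ in the support of the distribution of $(X,Y)$. (A11) The matrix $\mathbb E[XX^T]$ is positive definite, and $\int t^2\frac{(f'(t))^2}{f(t)}\,dt\in(0,\infty)$. (Under these assumptions a maximizer of $\ell_n$ exists almost surely for all $n$ large enough; it need not be unique.) *)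

theory Defs
  imports "HOL-Probability.Probability"
begin

text \<open>The real function \<^const>\<open>ln\<close> has \<open>ln 0 = 0\<close>; here the logarithm of \<open>0\<close> must be \<open>-\<infinity>\<close>.\<close>

definition log_ext :: "real \<Rightarrow> ereal" where
  "log_ext x = (if 0 < x then ereal (ln x) else - \<infinity>)"

definition scaled_density :: "(real \<Rightarrow> real) \<Rightarrow> real \<Rightarrow> real \<Rightarrow> real" where
  "scaled_density f s t = f (t / s) / s"

text \<open>For bounded \<open>f\<close> no summand equals \<open>\<infinity>\<close>, so the sum never meets \<open>\<infinity> - \<infinity>\<close>.\<close>

definition log_lik ::
    "(real \<Rightarrow> real) \<Rightarrow> nat \<Rightarrow> (nat \<Rightarrow> real ^ 'n) \<Rightarrow> (nat \<Rightarrow> real) \<Rightarrow> real ^ 'n \<Rightarrow> real \<Rightarrow> ereal" where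
  "log_lik f n xs ys \<beta> s =
     ereal (- real n * ln s) + (\<Sum>i<n. log_ext (f ((ys i - \<beta> \<bullet> xs i) / s)))"

definition is_mle ::
    "(real \<Rightarrow> real) \<Rightarrow> nat \<Rightarrow> (nat \<Rightarrow> real ^ 'n) \<Rightarrow> (nat \<Rightarrow> real) \<Rightarrow> real ^ 'n \<Rightarrow> real \<Rightarrow> bool" where
  "is_mle f n xs ys \<beta> s \<longleftrightarrow>
     0 < s \<and> (\<forall>\<beta>' s'. 0 < s' \<longrightarrow> log_lik f n xs ys \<beta>' s' \<le> log_lik f n xs ys \<beta> s)"

definition outer_prod :: "real ^ 'n \<Rightarrow> real ^ 'n ^ 'n" where
  "outer_prod x = (\<chi> i j. x $ i * x $ j)"

definition ols :: "nat \<Rightarrow> (nat \<Rightarrow> real ^ 'n) \<Rightarrow> (nat \<Rightarrow> real) \<Rightarrow> real ^ 'n" where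
  "ols n xs ys = matrix_inv (\<Sum>i<n. outer_prod (xs i)) *v (\<Sum>i<n. ys i *\<^sub>R xs i)"

definition pos_def_matrix :: "real ^ 'n ^ 'n \<Rightarrow> bool" where
  "pos_def_matrix A \<longleftrightarrow> transpose A = A \<and> (\<forall>v. v \<noteq> 0 \<longrightarrow> 0 < v \<bullet> (A *v v))"

definition partial_deriv :: "'n \<Rightarrow> (real ^ 'n \<Rightarrow> real) \<Rightarrow> real ^ 'n \<Rightarrow> real" where
  "partial_deriv i g \<beta> = deriv (\<lambda>t. g (\<beta> + t *\<^sub>R axis i 1)) 0"

definition C2_on :: "real set \<Rightarrow> (real \<Rightarrow> real) \<Rightarrow> bool" where
  "C2_on S f \<longleftrightarrow>
     (\<forall>t\<in>S. f differentiable (at t) \<and> deriv f differentiable (at t)) \<and>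
     continuous_on S (deriv (deriv f))"

definition fun_support :: "(real \<Rightarrow> real) \<Rightarrow> real set" where
  "fun_support f = closure {t. f t \<noteq> 0}"

definition measure_support :: "'a::topological_space measure \<Rightarrow> 'a set" where
  "measure_support \<mu> = {z. \<forall>U. open U \<longrightarrow> z \<in> U \<longrightarrow> 0 < emeasure \<mu> U}"

text \<open>\<^const>\<open>prob_space.indep_var\<close> requires both variables to have the same value type.\<close>

definition indep_rvs :: "'a measure \<Rightarrow> ('a \<Rightarrow> 'b::topological_space) \<Rightarrow> ('a \<Rightarrow> 'c::topological_space) \<Rightarrow> bool" where
  "indep_rvs M X Y \<longleftrightarrow>
     X \<in> borel_measurable M \<and> Y \<in> borel_measurable M \<and>
     prob_space.indep_set M {X -` A \<inter> space M | A. A \<in> sets borel} {Y -` B \<inter> space M | B. B \<in> sets borel}"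

definition conv_in_distr ::
    "'a measure \<Rightarrow> (nat \<Rightarrow> 'a \<Rightarrow> real ^ 'n) \<Rightarrow> (real ^ 'n) measure \<Rightarrow> bool" where
  "conv_in_distr M Z \<mu> \<longleftrightarrow>
     (\<forall>n. Z n \<in> borel_measurable M) \<and>
     (\<forall>g :: real ^ 'n \<Rightarrow> real. continuous_on UNIV g \<longrightarrow> bounded (range g) \<longrightarrow>
        (\<lambda>n. LINT \<omega>|M. g (Z n \<omega>)) \<longlonglongrightarrow> (LINT x|\<mu>. g x))"

text \<open>A law on Euclidean space is Gaussian if each linear functional is univariate normal;
  Dirac laws are the normal laws of variance \<open>0\<close>.\<close>

definition gaussian_law :: "(real ^ 'n) measure \<Rightarrow> bool" where
  "gaussian_law \<mu> \<longleftrightarrow>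
     prob_space \<mu> \<and> sets \<mu> = sets borel \<and>
     (\<forall>u. \<exists>m. distr \<mu> borel (\<lambda>x. u \<bullet> x) = return borel m \<or>
        (\<exists>\<sigma>>0. distr \<mu> borel (\<lambda>x. u \<bullet> x) = density lborel (normal_density m \<sigma>)))"

definition centered_gaussian_law :: "(real ^ 'n) measure \<Rightarrow> real ^ 'n ^ 'n \<Rightarrow> bool" where
  "centered_gaussian_law \<mu> \<Sigma> \<longleftrightarrow>
     gaussian_law \<mu> \<and>
     (\<forall>i. (LINT x|\<mu>. x $ i) = 0) \<and>
     (\<forall>i j. (LINT x|\<mu>. x $ i * x $ j) = \<Sigma> $ i $ j)"

definition asymp_normal ::
    "'a measure \<Rightarrow> (nat \<Rightarrow> 'a \<Rightarrow> real ^ 'n) \<Rightarrow> real ^ 'n \<Rightarrow> real ^ 'n ^ 'n \<Rightarrow> bool" where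
  "asymp_normal M T \<beta> \<Sigma> \<longleftrightarrow>
     (\<exists>\<mu>. centered_gaussian_law \<mu> \<Sigma> \<and>
        conv_in_distr M (\<lambda>n \<omega>. sqrt (real n) *\<^sub>R (T n \<omega> - \<beta>)) \<mu>)"

text \<open>\<open>has_are M T U \<beta> \<eta>\<close>: both estimator sequences are asymptotically normal, and the asymptotic
  relative efficiency of \<open>T\<close> with respect to \<open>U\<close> is \<open>\<eta>\<close>. The condition on \<open>det \<Sigma>\<^sub>U\<close> excludes
  division by zero.\<close>

definition has_are ::
    "'a measure \<Rightarrow> (nat \<Rightarrow> 'a \<Rightarrow> real ^ 'n) \<Rightarrow> (nat \<Rightarrow> 'a \<Rightarrow> real ^ 'n) \<Rightarrow> real ^ 'n \<Rightarrow> real \<Rightarrow> bool" where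
  "has_are M T U \<beta> \<eta> \<longleftrightarrow>
     (\<exists>\<Sigma>\<^sub>T \<Sigma>\<^sub>U. asymp_normal M T \<beta> \<Sigma>\<^sub>T \<and> asymp_normal M U \<beta> \<Sigma>\<^sub>U \<and> det \<Sigma>\<^sub>U \<noteq> 0 \<and>
        \<eta> = (det \<Sigma>\<^sub>T / det \<Sigma>\<^sub>U) powr (1 / real CARD('n)))"

end

theory Submission
  imports Defs
begin

text \<open>
  The moment conditions force \<open>f > 0\<close>, and letting only the scale vary in (A10) makes
  \<open>(ln f)''\<close> bounded. In the coordinates \<open>\<theta> = (- \<beta> / s, 1 / s)\<close> the log-likelihood of one
  observation \<open>z = (x, y)\<close> is \<open>ln \<theta>\<^sub>2 + ln (f (\<theta> \<bullet> z))\<close>. A positive fraction of the observations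
  satisfies \<open>\<bar>\<theta> \<bullet> z\<bar> \<ge> c \<bar>\<theta>\<bar>\<close> uniformly in \<open>\<theta>\<close>, so the tail bound (A4) confines maximisers to
  a compact set, where a uniform law of large numbers and Gibbs' inequality give consistency.

  Expanding the score equation in \<open>\<beta>\<close> with the estimated scale kept fixed yields a linear system for
  \<open>\<surd>n (\<beta>\<^sub>n - \<beta>\<^sub>0)\<close> whose matrix converges to a multiple of \<open>E[X X\<^sup>T]\<close> and whose right hand side is, up to a
  null sequence, a normalised sum to which the central limit theorem applies. Least squares solves
  a system of the same shape. The two limit covariances are \<open>s\<^sub>0\<^sup>2 / I\<close> and \<open>s\<^sub>0\<^sup>2 m\<^sub>2\<close> times the inverse of
  \<open>E[X X\<^sup>T]\<close>, where \<open>m\<^sub>2 = \<integral> t\<^sup>2 f\<close> and \<open>I = \<integral> f'\<^sup>2 / f\<close>, and integration by parts gives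
  \<open>I - 1 / m\<^sub>2 = \<integral> (f' / f + t / m\<^sub>2)\<^sup>2 f\<close>, which vanishes only for the normal density.
\<close>

section \<open>Convergence in probability and the weak law\<close>

text \<open>Three obstacles shape the proof. Maximisers need not be unique, and being one is not
  known to be a measurable event; so consistency is proved at once for every parameter that does at
  least as well as \<open>\<theta>\<^sub>0\<close>, and limits in probability are taken along a
  filter that tolerates non-measurable sets. Freezing the estimated scale avoids it: the summands
  \<open>\<psi>' (v * e) *\<^sub>R x\<close> are centred for every \<open>v\<close> because
  \<open>\<psi>'\<close> is odd, so exchanging the true scale for a merely consistent one changes
  the normalised score by a null sequence only. Finally, convergence in distribution is stated with
  bounded continuous test functions on a Euclidean space, while the univariate central limit theorem
  sees projections only; trigonometric polynomials bridge the gap through Stone-Weierstrass. The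
  coordinates \<theta> are chosen because residuals become linear in them, so the behaviour at
  infinity reduces to directions on a compact sphere.\<close>

text \<open>The filter of the sets of pairs \<open>(n, \<omega>)\<close> whose \<open>n\<close>-th section has inner probability tending to
  \<open>1\<close>; a limit along it is a limit in probability, also for non-measurable sequences.\<close>

definition whp :: "'a measure \<Rightarrow> (nat \<times> 'a) filter" where
  "whp M = Abs_filter (\<lambda>P. \<exists>G. (\<forall>n. G n \<in> sets M) \<and> (\<lambda>n. measure M (G n)) \<longlonglongrightarrow> 1 \<and>
     (\<forall>n. \<forall>\<omega>\<in>G n. P (n, \<omega>)))"

context prob_space
begin

lemma prob_Int_tendsto_1:
  assumes "\<And>n::nat. G n \<in> events" "\<And>n. H n \<in> events"
    and "(\<lambda>n. prob (G n)) \<longlonglongrightarrow> 1" "(\<lambda>n. prob (H n)) \<longlonglongrightarrow> 1"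
  shows "(\<lambda>n. prob (G n \<inter> H n)) \<longlonglongrightarrow> 1"
proof (rule tendsto_sandwich)
  show "\<forall>\<^sub>F n in sequentially. prob (G n) + prob (H n) - 1 \<le> prob (G n \<inter> H n)"
  proof (rule always_eventually, rule allI)
    fix n
    have "prob (G n \<union> H n) \<le> 1" by simp
    moreover have "prob (G n \<union> H n) = prob (G n) + prob (H n) - prob (G n \<inter> H n)"
      using assms(1,2)[of n] by (intro measure_Un3) (simp_all add: fmeasurable_eq_sets)
    ultimately show "prob (G n) + prob (H n) - 1 \<le> prob (G n \<inter> H n)" by simp
  qed
  show "(\<lambda>n. prob (G n) + prob (H n) - 1) \<longlonglongrightarrow> 1"
    using tendsto_diff[OF tendsto_add[OF assms(3,4)] tendsto_const[of "1::real"]] by simp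
  show "(\<lambda>_. 1::real) \<longlonglongrightarrow> 1" by simp
qed simp

lemma eventually_whp:
  "eventually P (whp M) \<longleftrightarrow> (\<exists>G. (\<forall>n. G n \<in> events) \<and> (\<lambda>n. prob (G n)) \<longlonglongrightarrow> 1 \<and>
     (\<forall>n. \<forall>\<omega>\<in>G n. P (n, \<omega>)))"
  unfolding whp_def
proof (rule eventually_Abs_filter, standard)
  show "\<exists>G. (\<forall>n. G n \<in> events) \<and> (\<lambda>n. prob (G n)) \<longlonglongrightarrow> 1 \<and> (\<forall>n. \<forall>\<omega>\<in>G n. True)"
    by (rule exI[of _ "\<lambda>_. space M"]) (simp add: prob_space)
next
  fix P Q :: "nat \<times> 'a \<Rightarrow> bool"
  assume "\<exists>G. (\<forall>n. G n \<in> events) \<and> (\<lambda>n. prob (G n)) \<longlonglongrightarrow> 1 \<and> (\<forall>n. \<forall>\<omega>\<in>G n. P (n, \<omega>))"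
    and "\<exists>G. (\<forall>n. G n \<in> events) \<and> (\<lambda>n. prob (G n)) \<longlonglongrightarrow> 1 \<and> (\<forall>n. \<forall>\<omega>\<in>G n. Q (n, \<omega>))"
  then obtain G H where "\<forall>n. G n \<in> events" "(\<lambda>n. prob (G n)) \<longlonglongrightarrow> 1" "\<forall>n. \<forall>\<omega>\<in>G n. P (n, \<omega>)"
    and "\<forall>n. H n \<in> events" "(\<lambda>n. prob (H n)) \<longlonglongrightarrow> 1" "\<forall>n. \<forall>\<omega>\<in>H n. Q (n, \<omega>)"
    by blast
  then show "\<exists>G. (\<forall>n. G n \<in> events) \<and> (\<lambda>n. prob (G n)) \<longlonglongrightarrow> 1 \<and>
      (\<forall>n. \<forall>\<omega>\<in>G n. P (n, \<omega>) \<and> Q (n, \<omega>))"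
    by (intro exI[of _ "\<lambda>n. G n \<inter> H n"]) (auto intro!: prob_Int_tendsto_1)
next
  fix P Q :: "nat \<times> 'a \<Rightarrow> bool"
  assume "\<forall>x. P x \<longrightarrow> Q x"
    and "\<exists>G. (\<forall>n. G n \<in> events) \<and> (\<lambda>n. prob (G n)) \<longlonglongrightarrow> 1 \<and> (\<forall>n. \<forall>\<omega>\<in>G n. P (n, \<omega>))"
  then show "\<exists>G. (\<forall>n. G n \<in> events) \<and> (\<lambda>n. prob (G n)) \<longlonglongrightarrow> 1 \<and> (\<forall>n. \<forall>\<omega>\<in>G n. Q (n, \<omega>))"
    by blast
qed

text \<open>For measurable sections inner probability is probability, so limits of measurable
  sequences along \<open>whp M\<close> are ordinary limits in probability.\<close>

lemma eventually_whp_prob: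
  assumes "\<And>n. {\<omega>\<in>space M. P (n, \<omega>)} \<in> events"
  shows "eventually P (whp M) \<longleftrightarrow> (\<lambda>n. prob {\<omega>\<in>space M. P (n, \<omega>)}) \<longlonglongrightarrow> 1"
proof
  assume "eventually P (whp M)"
  then obtain G where G: "\<And>n. G n \<in> events" "(\<lambda>n. prob (G n)) \<longlonglongrightarrow> 1"
      "\<And>n \<omega>. \<omega> \<in> G n \<Longrightarrow> P (n, \<omega>)"
    unfolding eventually_whp by blast
  show "(\<lambda>n. prob {\<omega>\<in>space M. P (n, \<omega>)}) \<longlonglongrightarrow> 1"
  proof (rule tendsto_sandwich[OF _ _ G(2) tendsto_const])
    show "\<forall>\<^sub>F n in sequentially. prob (G n) \<le> prob {\<omega> \<in> space M. P (n, \<omega>)}"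
      using G(1,3) assms sets.sets_into_space
      by (intro always_eventually allI finite_measure_mono) fastforce+
  qed simp
next
  assume "(\<lambda>n. prob {\<omega>\<in>space M. P (n, \<omega>)}) \<longlonglongrightarrow> 1"
  then show "eventually P (whp M)"
    unfolding eventually_whp using assms by (intro exI[of _ "\<lambda>n. {\<omega>\<in>space M. P (n, \<omega>)}"]) auto
qed

lemma filterlim_fst_whp: "filterlim fst sequentially (whp M)"
  unfolding filterlim_iff
proof (intro allI impI)
  fix P :: "nat \<Rightarrow> bool" assume P: "eventually P sequentially"
  define G where "G n = (if P n then space M else {})" for n
  have "\<forall>\<^sub>F n in sequentially. prob (G n) = 1"
    using P by eventually_elim (simp add: G_def prob_space)
  then have "(\<lambda>n. prob (G n)) \<longlonglongrightarrow> 1" by (rule tendsto_eventually)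
  moreover have "\<forall>n. G n \<in> events" "\<forall>n. \<forall>\<omega>\<in>G n. P (fst (n, \<omega>))" by (auto simp: G_def)
  ultimately show "\<forall>\<^sub>F x in whp M. P (fst x)"
    unfolding eventually_whp by (intro exI[of _ G] conjI)
qed

text \<open>One event of full measure serves as witness for all indices.\<close>

lemma AE_imp_eventually_whp:
  assumes "AE \<omega> in M. \<forall>n. P (n, \<omega>)"
  shows "eventually P (whp M)"
proof -
  obtain N where N: "{\<omega>\<in>space M. \<not> (\<forall>n. P (n, \<omega>))} \<subseteq> N" "emeasure M N = 0" "N \<in> events"
    by (rule AE_E[OF assms])
  have "prob (space M - N) = 1"
    using N(2,3) by (simp add: prob_compl measure_eq_emeasure_eq_ennreal emeasure_eq_measure)
  with N show ?thesis
    unfolding eventually_whp by (intro exI[of _ "\<lambda>_. space M - N"]) auto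
qed

text \<open>Meant for \<open>Q\<close> = being a maximiser, which holds almost surely from a random
  index on and need not be measurable. The part \<open>B n\<close> of the good event on which
  \<open>P\<close> fails is measurable and almost surely left for ever, so dominated convergence
  sends its probability to 0.\<close>

lemma eventually_whp_if_AE_eventually:
  assumes ae: "AE \<omega> in M. \<forall>\<^sub>F n in sequentially. Q n \<omega>"
    and ev: "\<forall>\<^sub>F x in whp M. Q (fst x) (snd x) \<longrightarrow> P x"
    and meas: "\<And>n. {\<omega>\<in>space M. P (n, \<omega>)} \<in> events"
  shows "eventually P (whp M)"
proof -
  obtain G where G: "\<And>n. G n \<in> events" "(\<lambda>n. prob (G n)) \<longlonglongrightarrow> 1"
      "\<And>n \<omega>. \<omega> \<in> G n \<Longrightarrow> Q n \<omega> \<Longrightarrow> P (n, \<omega>)"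
    using ev unfolding eventually_whp by auto
  define B where "B n = G n - {\<omega>\<in>space M. P (n, \<omega>)}" for n
  have B_meas [measurable]: "B n \<in> events" for n
    unfolding B_def using G(1) meas by blast
  have "AE \<omega> in M. (\<lambda>n. indicator (B n) \<omega> :: real) \<longlonglongrightarrow> 0"
    using ae
  proof eventually_elim
    case (elim \<omega>)
    show ?case
      using elim by (intro tendsto_eventually)
        (auto elim!: eventually_mono simp: B_def indicator_def dest: G(3) sets.sets_into_space[OF G(1), THEN subsetD])
  qed
  then have "(\<lambda>n. \<integral>\<omega>. indicator (B n) \<omega> \<partial>M) \<longlonglongrightarrow> (\<integral>\<omega>. (0::real) \<partial>M)"
    by (intro integral_dominated_convergence[where w="\<lambda>_. 1"]) auto
  then have "(\<lambda>n. prob (B n)) \<longlonglongrightarrow> 0" by simp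
  then have "(\<lambda>n. prob (space M - B n)) \<longlonglongrightarrow> 1"
    using tendsto_diff[OF tendsto_const[of "1::real"]] by (subst prob_compl) fastforce+
  from prob_Int_tendsto_1[OF _ _ G(2) this]
  have "(\<lambda>n. prob (G n \<inter> (space M - B n))) \<longlonglongrightarrow> 1" using G(1) by simp
  then show ?thesis
    unfolding eventually_whp using G(1) B_meas
    by (intro exI[of _ "\<lambda>n. G n \<inter> (space M - B n)"] conjI allI sets.Int sets.compl_sets)
      (simp_all, auto simp: B_def)
qed

text \<open>Markov's inequality, in the form in which \<open>weak_law\<close> delivers its
  estimate.\<close>

lemma tendsto_whp_if_L1:
  fixes V :: "nat \<Rightarrow> 'a \<Rightarrow> real"
  assumes int: "\<And>n. integrable M (V n)" and lim: "(\<lambda>n. expectation (\<lambda>\<omega>. \<bar>V n \<omega> - c\<bar>)) \<longlonglongrightarrow> 0"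
  shows "((\<lambda>x. V (fst x) (snd x)) \<longlongrightarrow> c) (whp M)"
proof (rule tendstoI)
  fix e :: real assume e: "e > 0"
  have [measurable]: "V n \<in> borel_measurable M" for n using int by auto
  have bd: "1 - expectation (\<lambda>\<omega>. \<bar>V n \<omega> - c\<bar>) / e \<le> prob {\<omega>\<in>space M. \<bar>V n \<omega> - c\<bar> < e}" for n
  proof -
    have "prob {\<omega>\<in>space M. e \<le> \<bar>V n \<omega> - c\<bar>} \<le> expectation (\<lambda>\<omega>. \<bar>V n \<omega> - c\<bar>) / e"
      using int e by (intro integral_Markov_inequality_measure[where A="{}"]) auto
    moreover have "{\<omega>\<in>space M. \<bar>V n \<omega> - c\<bar> < e} = space M - {\<omega>\<in>space M. e \<le> \<bar>V n \<omega> - c\<bar>}"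
      by auto
    ultimately show ?thesis by (simp add: prob_compl)
  qed
  have "(\<lambda>n. prob {\<omega>\<in>space M. \<bar>V n \<omega> - c\<bar> < e}) \<longlonglongrightarrow> 1"
  proof (rule tendsto_sandwich[OF always_eventually[OF allI[OF bd]]])
    show "(\<lambda>n. 1 - expectation (\<lambda>\<omega>. \<bar>V n \<omega> - c\<bar>) / e) \<longlonglongrightarrow> 1"
      using tendsto_diff[OF tendsto_const[of "1::real"] tendsto_divide[OF lim tendsto_const[of e]]] e by simp
  qed auto
  then show "\<forall>\<^sub>F x in whp M. dist (V (fst x) (snd x)) c < e"
    by (subst eventually_whp_prob) (auto simp: dist_real_def)
qed

end

section \<open>Averages of independent identically distributed observations\<close>

locale iid_sample = prob_space M for M :: "'a measure" +
  fixes Z :: "nat \<Rightarrow> 'a \<Rightarrow> 'b::{second_countable_topology, topological_space}" and D :: "'b measure"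
  assumes indep: "indep_vars (\<lambda>_. borel) Z UNIV"
    and distr_Z: "\<And>i. distr M borel (Z i) = D"
begin

lemma Z_measurable [measurable]: "Z i \<in> borel_measurable M"
  using indep by (simp add: indep_vars_def)

lemma sets_D [measurable_cong, simp]: "sets D = sets borel"
  using distr_Z[of 0] by auto

lemma prob_space_D: "prob_space D"
  using prob_space_distr[OF Z_measurable[of 0]] distr_Z[of 0] by simp

lemma integral_Z:
  fixes h :: "'b \<Rightarrow> 'c::{banach, second_countable_topology}"
  assumes [measurable]: "h \<in> borel_measurable borel"
  shows "expectation (\<lambda>\<omega>. h (Z i \<omega>)) = (\<integral>z. h z \<partial>D)"
  using distr_Z[of i] by (metis assms integral_distr Z_measurable)

lemma integrable_Z:
  fixes h :: "'b \<Rightarrow> 'c::{banach, second_countable_topology}"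
  assumes "integrable D h"
  shows "integrable M (\<lambda>\<omega>. h (Z i \<omega>))"
proof -
  have "h \<in> borel_measurable borel"
    using assms borel_measurable_integrable measurable_cong_sets sets_D by blast
  with assms distr_Z[of i] show ?thesis
    by (metis Z_measurable integrable_distr_eq)
qed

lemma AE_Z:
  assumes "AE z in D. P z"
  shows "AE \<omega> in M. \<forall>i. P (Z i \<omega>)"
  unfolding AE_all_countable
proof
  fix i show "AE \<omega> in M. P (Z i \<omega>)"
    using assms unfolding distr_Z[of i, symmetric] by (rule AE_distrD[OF Z_measurable])
qed

lemma indep_compose:
  assumes [measurable]: "h \<in> measurable borel N"
  shows "indep_vars (\<lambda>_. N) (\<lambda>i \<omega>. h (Z i \<omega>)) UNIV"
  using indep_vars_compose2[OF indep, of "\<lambda>_. h"] assms by simp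

text \<open>The cross term of the induction vanishes by independence and centring. This second
  moment drives the weak law, the tightness in the central limit theorem and the increments of the
  score process.\<close>

lemma sum_square_expectation:
  fixes h :: "'b \<Rightarrow> real"
  assumes [measurable]: "h \<in> borel_measurable borel"
    and sq: "integrable D (\<lambda>z. (h z)\<^sup>2)" and zero: "(\<integral>z. h z \<partial>D) = 0"
  shows "integrable M (\<lambda>\<omega>. (\<Sum>i<n. h (Z i \<omega>))\<^sup>2)"
    and "expectation (\<lambda>\<omega>. (\<Sum>i<n. h (Z i \<omega>))\<^sup>2) = real n * (\<integral>z. (h z)\<^sup>2 \<partial>D)"
proof -
  interpret D: prob_space D by (rule prob_space_D)
  have int_h: "integrable D h"
    by (rule D.square_integrable_imp_integrable) (use sq in auto)
  have sqZ: "integrable M (\<lambda>\<omega>. (h (Z i \<omega>))\<^sup>2)" for i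
    using integrable_Z[OF sq] by simp
  have intZ: "integrable M (\<lambda>\<omega>. h (Z i \<omega>))" for i
    using integrable_Z[OF int_h] by simp
  have "integrable M (\<lambda>\<omega>. (\<Sum>i<n. h (Z i \<omega>))\<^sup>2) \<and>
    expectation (\<lambda>\<omega>. (\<Sum>i<n. h (Z i \<omega>))\<^sup>2) = real n * (\<integral>z. (h z)\<^sup>2 \<partial>D)"
  proof (induction n)
    case 0
    show ?case by simp
  next
    case (Suc n)
    let ?S = "\<lambda>\<omega>. \<Sum>i<n. h (Z i \<omega>)"
    have ind: "indep_var borel (\<lambda>\<omega>. h (Z n \<omega>)) borel ?S"
      by (rule indep_vars_sum) (auto intro!: indep_vars_subset[OF indep_compose])
    have intS: "integrable M ?S" using intZ by auto
    have prod: "integrable M (\<lambda>\<omega>. h (Z n \<omega>) * ?S \<omega>)"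
      by (rule indep_var_integrable[OF ind intZ intS])
    have prod0: "expectation (\<lambda>\<omega>. h (Z n \<omega>) * ?S \<omega>) = 0"
      by (subst indep_var_lebesgue_integral[OF ind intZ intS]) (simp add: integral_Z zero)
    have eq: "(\<Sum>i<Suc n. h (Z i \<omega>))\<^sup>2 = (?S \<omega>)\<^sup>2 + 2 * (h (Z n \<omega>) * ?S \<omega>) + (h (Z n \<omega>))\<^sup>2" for \<omega>
      by (simp add: power2_eq_square algebra_simps)
    have i2: "integrable M (\<lambda>\<omega>. 2 * (h (Z n \<omega>) * ?S \<omega>))" using prod by simp
    have "integrable M (\<lambda>\<omega>. (\<Sum>i<Suc n. h (Z i \<omega>))\<^sup>2)"
      unfolding eq using Suc.IH i2 sqZ by (intro Bochner_Integration.integrable_add) auto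
    moreover have "expectation (\<lambda>\<omega>. (\<Sum>i<Suc n. h (Z i \<omega>))\<^sup>2) = real (Suc n) * (\<integral>z. (h z)\<^sup>2 \<partial>D)"
    proof -
      have "expectation (\<lambda>\<omega>. (\<Sum>i<Suc n. h (Z i \<omega>))\<^sup>2) =
          expectation (\<lambda>\<omega>. (?S \<omega>)\<^sup>2) + expectation (\<lambda>\<omega>. 2 * (h (Z n \<omega>) * ?S \<omega>))
          + expectation (\<lambda>\<omega>. (h (Z n \<omega>))\<^sup>2)"
        unfolding eq using Suc.IH i2 sqZ
        by (subst Bochner_Integration.integral_add Bochner_Integration.integrable_add; simp)+
      also have "\<dots> = real n * (\<integral>z. (h z)\<^sup>2 \<partial>D) + (\<integral>z. (h z)\<^sup>2 \<partial>D)"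
        using Suc.IH prod0 integral_Z[of "\<lambda>z. (h z)\<^sup>2"] by simp
      finally show ?thesis by (simp add: algebra_simps)
    qed
    ultimately show ?case by blast
  qed
  then show "integrable M (\<lambda>\<omega>. (\<Sum>i<n. h (Z i \<omega>))\<^sup>2)"
    and "expectation (\<lambda>\<omega>. (\<Sum>i<n. h (Z i \<omega>))\<^sup>2) = real n * (\<integral>z. (h z)\<^sup>2 \<partial>D)" by auto
qed

text \<open>The empty average is 0 by division by zero, hence the guard \<open>n > 0\<close> in
  \<open>avg_const\<close>.\<close>

definition avg :: "('b \<Rightarrow> real) \<Rightarrow> nat \<Rightarrow> 'a \<Rightarrow> real" where
  "avg h n \<omega> = (\<Sum>i<n. h (Z i \<omega>)) / real n"

lemma avg_measurable [measurable]:
  assumes [measurable]: "h \<in> borel_measurable borel"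
  shows "avg h n \<in> borel_measurable M"
  unfolding avg_def by measurable

lemma avg_diff: "avg (\<lambda>z. g z - h z) n \<omega> = avg g n \<omega> - avg h n \<omega>"
  by (simp add: avg_def sum_subtractf diff_divide_distrib)

lemma avg_add: "avg (\<lambda>z. g z + h z) n \<omega> = avg g n \<omega> + avg h n \<omega>"
  by (simp add: avg_def sum.distrib add_divide_distrib)

lemma avg_cmult: "avg (\<lambda>z. c * h z) n \<omega> = c * avg h n \<omega>"
  by (simp add: avg_def sum_distrib_left[symmetric])

lemma avg_const: "n > 0 \<Longrightarrow> avg (\<lambda>z. c) n \<omega> = c"
  by (simp add: avg_def)

lemma avg_mono: "(\<And>i. i < n \<Longrightarrow> g (Z i \<omega>) \<le> h (Z i \<omega>)) \<Longrightarrow> avg g n \<omega> \<le> avg h n \<omega>"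
  unfolding avg_def by (intro divide_right_mono sum_mono) auto

text \<open>Only a first moment is available, so \<open>h\<close> is truncated at level
  \<open>m\<close>: the truncated part has variance at most \<open>m\<^sup>2\<close> and obeys an L2
  bound, while the part cut off is small in L1, uniformly in \<open>n\<close> because all laws
  agree.\<close>

lemma weak_law:
  fixes h :: "'b \<Rightarrow> real"
  assumes int: "integrable D h"
  shows "((\<lambda>x. avg h (fst x) (snd x)) \<longlongrightarrow> (\<integral>z. h z \<partial>D)) (whp M)"
proof (rule tendsto_whp_if_L1)
  interpret D: prob_space D by (rule prob_space_D)
  have [measurable]: "h \<in> borel_measurable borel"
    using int borel_measurable_integrable measurable_cong_sets sets_D by blast
  have intZ: "integrable M (\<lambda>\<omega>. h (Z i \<omega>))" for i
    using integrable_Z[OF int] by simp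
  then show int_avg: "integrable M (avg h n)" for n
    unfolding avg_def by auto
  define \<mu> where "\<mu> = (\<integral>z. h z \<partial>D)"
  define g where "g m z = (if \<bar>h z\<bar> \<le> real m then h z else 0)" for m z
  have g_meas [measurable]: "g m \<in> borel_measurable borel" for m
    unfolding g_def by measurable
  have g_le: "\<bar>g m z\<bar> \<le> \<bar>h z\<bar>" "\<bar>g m z\<bar> \<le> real m" for m z
    by (auto simp: g_def)
  have int_g: "integrable D (g m)" for m
    by (rule Bochner_Integration.integrable_bound[OF int]) (use g_le in auto)
  define t where "t m = (\<integral>z. \<bar>h z - g m z\<bar> \<partial>D)" for m
  have "t \<longlonglongrightarrow> (\<integral>z. 0 \<partial>D)"
    unfolding t_def
  proof (rule integral_dominated_convergence[where w="\<lambda>z. \<bar>h z\<bar>"])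
    show "AE z in D. (\<lambda>m. \<bar>h z - g m z\<bar>) \<longlonglongrightarrow> 0"
    proof (rule AE_I2, rule tendsto_eventually)
      fix z
      obtain N where "\<bar>h z\<bar> \<le> real N" using real_arch_simple by blast
      then show "\<forall>\<^sub>F m in sequentially. \<bar>h z - g m z\<bar> = 0"
        by (intro eventually_sequentiallyI[of N]) (auto simp: g_def)
    qed
  qed (use int in \<open>auto simp: g_def\<close>)
  then have t0: "t \<longlonglongrightarrow> 0" by simp
  \<comment> \<open>\<open>t m\<close> enters twice, through the average of the part cut off and
    through the shift of the mean; the last term bounds the standard deviation of an average of
    \<open>n\<close> terms of size at most \<open>m\<close>.\<close>
  have bound: "expectation (\<lambda>\<omega>. \<bar>avg h n \<omega> - \<mu>\<bar>) \<le> 2 * t m + real m / sqrt (real n)"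
    if n: "n > 0" for n m
  proof -
    let ?v = "\<integral>z. g m z \<partial>D"
    define c where "c z = g m z - ?v" for z
    have c_meas [measurable]: "c \<in> borel_measurable borel" unfolding c_def by measurable
    have [simp]: "integrable M (avg (g m) n)"
      unfolding avg_def using integrable_Z[OF int_g] by auto
    have int_gsq: "integrable D (\<lambda>z. (g m z)\<^sup>2)"
      by (rule D.integrable_const_bound[of _ "(real m)\<^sup>2"])
        (use g_le in \<open>auto simp: abs_le_square_iff[symmetric]\<close>)
    have c_sq: "integrable D (\<lambda>z. (c z)\<^sup>2)"
      using int_gsq int_g by (auto simp: power2_diff c_def)
    have c0: "(\<integral>z. c z \<partial>D) = 0" using int_g D.prob_space by (simp add: c_def)
    have "D.variance (g m) = D.expectation (\<lambda>z. (g m z)\<^sup>2) - ?v\<^sup>2"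
      by (rule D.variance_eq[OF int_g int_gsq])
    also have "\<dots> \<le> D.expectation (\<lambda>z. (g m z)\<^sup>2)" by simp
    also have "\<dots> \<le> D.expectation (\<lambda>z. (real m)\<^sup>2)"
      using g_le by (intro integral_mono int_gsq) (auto simp: abs_le_square_iff[symmetric])
    finally have var: "(\<integral>z. (c z)\<^sup>2 \<partial>D) \<le> (real m)\<^sup>2" using D.prob_space by (simp add: c_def)
    have S2: "integrable M (\<lambda>\<omega>. (avg c n \<omega>)\<^sup>2)"
      using sum_square_expectation(1)[OF c_meas c_sq c0, of n] by (simp add: avg_def power_divide)
    have "(expectation (\<lambda>\<omega>. \<bar>avg c n \<omega>\<bar>))\<^sup>2 \<le> expectation (\<lambda>\<omega>. (avg c n \<omega>)\<^sup>2)"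
    proof -
      have i: "integrable M (\<lambda>\<omega>. \<bar>avg c n \<omega>\<bar>)"
        by (rule integrable_abs, rule square_integrable_imp_integrable[OF _ S2]) simp
      have "0 \<le> variance (\<lambda>\<omega>. \<bar>avg c n \<omega>\<bar>)" by simp
      also have "\<dots> = expectation (\<lambda>\<omega>. \<bar>avg c n \<omega>\<bar>\<^sup>2) - (expectation (\<lambda>\<omega>. \<bar>avg c n \<omega>\<bar>))\<^sup>2"
        by (rule variance_eq[OF i]) (use S2 in simp)
      finally show ?thesis by simp
    qed
    also have "\<dots> = (\<integral>z. (c z)\<^sup>2 \<partial>D) / real n"
      using sum_square_expectation(2)[OF c_meas c_sq c0, of n] n
      by (simp add: avg_def power_divide power2_eq_square)
    also have "\<dots> \<le> (real m)\<^sup>2 / real n"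
      using var by (simp add: divide_right_mono)
    finally have "(expectation (\<lambda>\<omega>. \<bar>avg c n \<omega>\<bar>))\<^sup>2 \<le> (real m / sqrt (real n))\<^sup>2"
      by (simp add: power_divide)
    then have A: "expectation (\<lambda>\<omega>. \<bar>avg c n \<omega>\<bar>) \<le> real m / sqrt (real n)"
      by (rule power2_le_imp_le) simp
    have int_hg: "integrable D (\<lambda>z. \<bar>h z - g m z\<bar>)" using int int_g by auto
    have intA: "integrable M (avg (\<lambda>z. \<bar>h z - g m z\<bar>) n)"
      unfolding avg_def using integrable_Z[OF int_hg] by auto
    have intc: "integrable M (avg c n)"
      unfolding c_def[abs_def] by (simp add: avg_diff[abs_def] avg_const n)
    have B: "expectation (avg (\<lambda>z. \<bar>h z - g m z\<bar>) n) = t m"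
      unfolding avg_def using integrable_Z[OF int_hg] n
      by (subst integral_divide_zero, subst Bochner_Integration.integral_sum)
         (auto simp: integral_Z[of "\<lambda>z. \<bar>h z - g m z\<bar>"] t_def)
    have C: "\<bar>\<mu> - ?v\<bar> \<le> t m"
    proof -
      have "\<mu> - ?v = (\<integral>z. h z - g m z \<partial>D)" unfolding \<mu>_def using int int_g by simp
      then show ?thesis using integral_abs_bound[of D "\<lambda>z. h z - g m z"] by (simp add: t_def)
    qed
    have "\<bar>avg h n \<omega> - \<mu>\<bar> \<le> avg (\<lambda>z. \<bar>h z - g m z\<bar>) n \<omega> + \<bar>avg c n \<omega>\<bar> + t m" for \<omega>
    proof -
      have "avg h n \<omega> - \<mu> = avg (\<lambda>z. h z - g m z) n \<omega> + avg c n \<omega> + (?v - \<mu>)"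
        using n by (simp add: c_def[abs_def] avg_diff avg_const)
      moreover have "\<bar>avg (\<lambda>z. h z - g m z) n \<omega>\<bar> \<le> avg (\<lambda>z. \<bar>h z - g m z\<bar>) n \<omega>"
        unfolding avg_def by (simp add: divide_right_mono sum_abs)
      ultimately show ?thesis using C by linarith
    qed
    then have "expectation (\<lambda>\<omega>. \<bar>avg h n \<omega> - \<mu>\<bar>) \<le>
        expectation (\<lambda>\<omega>. avg (\<lambda>z. \<bar>h z - g m z\<bar>) n \<omega> + \<bar>avg c n \<omega>\<bar> + t m)"
      using int_avg[of n] intA intc by (intro integral_mono) auto
    also have "\<dots> = t m + expectation (\<lambda>\<omega>. \<bar>avg c n \<omega>\<bar>) + t m"
      using intA B intc by (simp add: prob_space)
    finally show ?thesis using A by simp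
  qed
  have "(\<lambda>n. expectation (\<lambda>\<omega>. \<bar>avg h n \<omega> - \<mu>\<bar>)) \<longlonglongrightarrow> 0"
  proof (rule LIMSEQ_I)
    fix e :: real assume e: "e > 0"
    \<comment> \<open>A quarter, since \<open>t m\<close> counts twice; with \<open>m\<close> fixed,
      \<open>real m / sqrt (real n)\<close> still tends to 0.\<close>
    obtain m where m: "t m < e / 4"
      using order_tendstoD(2)[OF t0, of "e/4"] e by (auto simp: eventually_sequentially)
    have "(\<lambda>n. real m / sqrt (real n)) \<longlonglongrightarrow> 0"
      by real_asymp
    then obtain N where N: "\<And>n. n \<ge> N \<Longrightarrow> real m / sqrt (real n) < e / 2"
      using order_tendstoD(2)[of "\<lambda>n. real m / sqrt (real n)" 0 sequentially "e/2"] e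
      unfolding eventually_sequentially by (metis half_gt_zero)
    show "\<exists>no. \<forall>n\<ge>no. norm (expectation (\<lambda>\<omega>. \<bar>avg h n \<omega> - \<mu>\<bar>) - 0) < e"
    proof (intro exI[of _ "Suc N"] allI impI)
      fix n assume "n \<ge> Suc N"
      then have "n > 0" "n \<ge> N" by auto
      then have "expectation (\<lambda>\<omega>. \<bar>avg h n \<omega> - \<mu>\<bar>) < e"
        using bound[of n m] N[of n] m by linarith
      moreover have "expectation (\<lambda>\<omega>. \<bar>avg h n \<omega> - \<mu>\<bar>) \<ge> 0"
        by simp
      ultimately show "norm (expectation (\<lambda>\<omega>. \<bar>avg h n \<omega> - \<mu>\<bar>) - 0) < e" by simp
    qed
  qed
  then show "(\<lambda>n. expectation (\<lambda>\<omega>. \<bar>avg h n \<omega> - (\<integral>z. h z \<partial>D)\<bar>)) \<longlonglongrightarrow> 0"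
    by (simp add: \<mu>_def)
qed

text \<open>On the ball around \<open>v\<close> the minorant \<open>h v z - r v * L z\<close> serves
  all \<open>v'\<close> at once, so a finite subcover reduces uniformity to finitely many weak laws.
  Applied to directions on the unit sphere and to parameters away from the truth.\<close>

lemma uniform_avg_pos:
  fixes h :: "'p::metric_space \<Rightarrow> 'b \<Rightarrow> real"
  assumes T: "compact T" "T \<noteq> {}"
    and int: "\<And>v. v \<in> T \<Longrightarrow> integrable D (h v)" and intL: "integrable D L"
    and L_nonneg: "\<And>z. 0 \<le> L z"
    and lip: "\<And>v v' z. v \<in> T \<Longrightarrow> v' \<in> T \<Longrightarrow> \<bar>h v z - h v' z\<bar> \<le> dist v v' * L z"
    and pos: "\<And>v. v \<in> T \<Longrightarrow> 0 < (\<integral>z. h v z \<partial>D)"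
  shows "\<exists>c>0. \<forall>\<^sub>F x in whp M. \<forall>v\<in>T. c < avg (h v) (fst x) (snd x)"
proof -
  interpret D: prob_space D by (rule prob_space_D)
  define l where "l = (\<integral>z. L z \<partial>D)"
  have l: "l \<ge> 0" unfolding l_def using L_nonneg by simp
  \<comment> \<open>Small enough that the minorant keeps more than half of the mean of
    \<open>h v\<close>; \<open>l + 1\<close> avoids a division by \<open>l = 0\<close>.\<close>
  define r where "r v = (\<integral>z. h v z \<partial>D) / (2 * (l + 1))" for v
  define c where "c v = (\<integral>z. h v z \<partial>D) / 2" for v
  have r: "r v > 0" if "v \<in> T" for v using pos[OF that] l by (simp add: r_def)
  have c: "c v > 0" if "v \<in> T" for v using pos[OF that] by (simp add: c_def)
  have cl: "(\<integral>z. h v z - r v * L z \<partial>D) > c v" if "v \<in> T" for v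
  proof -
    have "r v * l < c v"
      using l pos[OF that] by (simp add: r_def c_def field_simps)
    then show ?thesis using int[OF that] intL by (simp add: l_def c_def)
  qed
  have "T \<subseteq> (\<Union>v\<in>T. ball v (r v))" using r by auto
  then obtain F where F: "F \<subseteq> T" "finite F" "T \<subseteq> (\<Union>v\<in>F. ball v (r v))"
    using compactE_image[OF T(1), of T "\<lambda>v. ball v (r v)"] by auto
  then have "F \<noteq> {}" using T(2) by auto
  have "\<forall>\<^sub>F x in whp M. \<forall>v\<in>F. c v < avg (\<lambda>z. h v z - r v * L z) (fst x) (snd x)"
  proof (rule eventually_ball_finite[OF F(2)], rule)
    fix v assume "v \<in> F"
    then have v: "v \<in> T" using F(1) by auto
    show "\<forall>\<^sub>F x in whp M. c v < avg (\<lambda>z. h v z - r v * L z) (fst x) (snd x)"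
      by (rule order_tendstoD(1)[OF weak_law cl[OF v]]) (use int[OF v] intL in simp)
  qed
  then have "\<forall>\<^sub>F x in whp M. \<forall>v\<in>T. Min (c ` F) < avg (h v) (fst x) (snd x)"
  proof eventually_elim
    case (elim x)
    show ?case
    proof
      fix v' assume v': "v' \<in> T"
      then obtain v where v: "v \<in> F" "dist v v' < r v" using F(3) by auto
      have "Min (c ` F) \<le> c v" using F v by simp
      also have "\<dots> < avg (\<lambda>z. h v z - r v * L z) (fst x) (snd x)" using elim v by blast
      also have "\<dots> \<le> avg (h v') (fst x) (snd x)"
      proof (rule avg_mono)
        fix i
        have "h v (Z i (snd x)) - h v' (Z i (snd x)) \<le> dist v v' * L (Z i (snd x))"
          using lip[of v v' "Z i (snd x)"] v v' F by auto
        also have "\<dots> \<le> r v * L (Z i (snd x))"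
          using v L_nonneg by (intro mult_right_mono) auto
        finally show "h v (Z i (snd x)) - r v * L (Z i (snd x)) \<le> h v' (Z i (snd x))" by simp
      qed
      finally show "Min (c ` F) < avg (h v') (fst x) (snd x)" .
    qed
  qed
  moreover have "Min (c ` F) > 0" using F c \<open>F \<noteq> {}\<close> by auto
  ultimately show ?thesis by blast
qed

end

section \<open>Weak convergence on Euclidean space\<close>

inductive trig_poly :: "('a::real_inner \<Rightarrow> real) \<Rightarrow> bool" where
  cos: "trig_poly (\<lambda>x. cos (t \<bullet> x))"
| sin: "trig_poly (\<lambda>x. sin (t \<bullet> x))"
| add: "trig_poly f \<Longrightarrow> trig_poly g \<Longrightarrow> trig_poly (\<lambda>x. f x + g x)"
| cmult: "trig_poly f \<Longrightarrow> trig_poly (\<lambda>x. c * f x)"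

lemma trig_poly_const: "trig_poly (\<lambda>x. c)"
  using trig_poly.cmult[OF trig_poly.cos[of 0], of c] by simp

lemma trig_poly_diff:
  assumes "trig_poly f" "trig_poly g" shows "trig_poly (\<lambda>x. f x - g x)"
  using trig_poly.add[OF assms(1) trig_poly.cmult[OF assms(2), of "-1"]] by simp

lemma trig_poly_mult_cos: "trig_poly f \<Longrightarrow> trig_poly (\<lambda>x. f x * cos (t \<bullet> x))"
proof (induction rule: trig_poly.induct)
  case (cos s)
  have "trig_poly (\<lambda>x. (1/2) * (cos ((s - t) \<bullet> x) + cos ((s + t) \<bullet> x)))"
    by (intro trig_poly.intros)
  then show ?case by (simp add: cos_times_cos inner_left_distrib inner_diff_left)
next
  case (sin s)
  have "trig_poly (\<lambda>x. (1/2) * (sin ((s + t) \<bullet> x) + sin ((s - t) \<bullet> x)))"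
    by (intro trig_poly.intros)
  then show ?case by (simp add: sin_times_cos inner_left_distrib inner_diff_left)
next
  case (add f g)
  from trig_poly.add[OF add.IH] show ?case by (simp add: algebra_simps)
next
  case (cmult f c)
  from trig_poly.cmult[OF cmult.IH, of c] show ?case by (simp add: algebra_simps)
qed

lemma trig_poly_mult_sin: "trig_poly f \<Longrightarrow> trig_poly (\<lambda>x. f x * sin (t \<bullet> x))"
proof (induction rule: trig_poly.induct)
  case (cos s)
  have "trig_poly (\<lambda>x. (1/2) * (sin ((s + t) \<bullet> x) - sin ((s - t) \<bullet> x)))"
    by (intro trig_poly.cmult trig_poly_diff trig_poly.intros)
  then show ?case by (simp add: cos_times_sin inner_left_distrib inner_diff_left)
next
  case (sin s)
  have "trig_poly (\<lambda>x. (1/2) * (cos ((s - t) \<bullet> x) - cos ((s + t) \<bullet> x)))"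
    by (intro trig_poly.cmult trig_poly_diff trig_poly.intros)
  then show ?case by (simp add: sin_times_sin inner_left_distrib inner_diff_left)
next
  case (add f g)
  from trig_poly.add[OF add.IH] show ?case by (simp add: algebra_simps)
next
  case (cmult f c)
  from trig_poly.cmult[OF cmult.IH, of c] show ?case by (simp add: algebra_simps)
qed

text \<open>Products are not constructors of \<open>trig_poly\<close>: linear closure lets a limit
  of integrals pass from \<open>cos\<close> and \<open>sin\<close> to the whole class by induction,
  and the product-to-sum formulas then supply the algebra that Stone-Weierstrass requires.\<close>

lemma trig_poly_mult:
  assumes "trig_poly g" "trig_poly f" shows "trig_poly (\<lambda>x. f x * g x)"
  using assms
proof (induction rule: trig_poly.induct)
  case (cos t) then show ?case by (rule trig_poly_mult_cos)
next
  case (sin t) then show ?case by (rule trig_poly_mult_sin)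
next
  case (add g h)
  from trig_poly.add[OF add.IH(1)[OF add.prems] add.IH(2)[OF add.prems]] show ?case
    by (simp add: algebra_simps)
next
  case (cmult g c)
  from trig_poly.cmult[OF cmult.IH[OF cmult.prems], of c] show ?case by (simp add: algebra_simps)
qed

lemma trig_poly_continuous: "trig_poly f \<Longrightarrow> continuous_on S f"
  by (induction rule: trig_poly.induct) (auto intro!: continuous_intros)

lemma trig_poly_bounded: "trig_poly f \<Longrightarrow> \<exists>B. \<forall>x. \<bar>f x\<bar> \<le> B"
proof (induction rule: trig_poly.induct)
  case (add f g)
  then obtain A B where A: "\<And>x. \<bar>f x\<bar> \<le> A" and B: "\<And>x. \<bar>g x\<bar> \<le> B" by blast
  have "\<bar>f x + g x\<bar> \<le> A + B" for x
    using A[of x] B[of x] by linarith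
  then show ?case by blast
next
  case (cmult f c)
  then obtain A where "\<And>x. \<bar>f x\<bar> \<le> A" by blast
  then have "\<bar>c * f x\<bar> \<le> \<bar>c\<bar> * A" for x
    by (simp add: abs_mult mult_left_mono)
  then show ?case by blast
qed (auto intro: abs_cos_le_one abs_sin_le_one)

lemma trig_poly_compose:
  fixes q :: "real \<Rightarrow> real"
  assumes "real_polynomial_function q" "trig_poly p"
  shows "trig_poly (\<lambda>x. q (p x))"
  using assms
proof (induction rule: real_polynomial_function.induct)
  case (linear f)
  have "f y = f 1 * y" for y
    using linear_scale[OF bounded_linear.linear[OF linear(1)], of y 1] by simp
  then have "(\<lambda>x. f (p x)) = (\<lambda>x. f 1 * p x)" by blast
  then show ?case using trig_poly.cmult[OF \<open>trig_poly p\<close>, of "f 1"] by simp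
next
  case (const c) show ?case by (rule trig_poly_const)
next
  case (add f g) then show ?case by (intro trig_poly.add)
next
  case (mult f g) then show ?case by (intro trig_poly_mult)
qed

lemma trig_poly_separates:
  assumes "x \<noteq> y"
  shows "\<exists>f. trig_poly f \<and> f x \<noteq> f y"
proof (rule ccontr)
  \<comment> \<open>Scaled so that \<open>t \<bullet> (x - y) = 1\<close>, which is not a period of
    the cosine.\<close>
  define t where "t = (1 / ((x - y) \<bullet> (x - y))) *\<^sub>R (x - y)"
  assume "\<not> (\<exists>f. trig_poly f \<and> f x \<noteq> f y)"
  then have "cos (t \<bullet> x) = cos (t \<bullet> y)" "sin (t \<bullet> x) = sin (t \<bullet> y)"
    using trig_poly.cos[of t] trig_poly.sin[of t] by blast+
  then have "cos (t \<bullet> x - t \<bullet> y) = 1"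
    by (simp add: cos_diff sin_cos_squared_add2 flip: power2_eq_square)
  moreover have "t \<bullet> (x - y) = 1"
    using assms by (simp add: t_def)
  then have "t \<bullet> x - t \<bullet> y = 1" by (simp add: inner_diff_right)
  ultimately show False
    using cos_monotone_0_pi[of 0 1] pi_gt3 by simp
qed

text \<open>A continuous, 1-Lipschitz stand-in for the indicator of large norms, so that tightness
  can be expressed by a test function admissible for weak convergence.\<close>

definition outside_ball :: "real \<Rightarrow> 'a::real_normed_vector \<Rightarrow> real" where
  "outside_ball R x = max 0 (min 1 (norm x - R))"

lemma outside_ball_bounds: "0 \<le> outside_ball R x" "outside_ball R x \<le> 1"
  by (auto simp: outside_ball_def)

lemma outside_ball_eq_1: "R + 1 \<le> norm x \<Longrightarrow> outside_ball R x = 1"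
  by (auto simp: outside_ball_def)

lemma outside_ball_antimono: "R \<le> R' \<Longrightarrow> outside_ball R' x \<le> outside_ball R x"
  by (auto simp: outside_ball_def)

lemma outside_ball_diff: "\<bar>outside_ball R x - outside_ball R y\<bar> \<le> norm (x - y)"
  using norm_triangle_ineq3[of x y] unfolding outside_ball_def by linarith

lemma continuous_on_outside_ball [continuous_intros]: "continuous_on S (outside_ball R)"
  unfolding outside_ball_def[abs_def] by (intro continuous_intros)

lemma outside_ball_measurable [measurable]: "outside_ball R \<in> borel_measurable borel"
  by (intro borel_measurable_continuous_onI continuous_intros)

lemma prob_tight:
  fixes \<mu> :: "'a::real_normed_vector measure"
  assumes "prob_space \<mu>" and [measurable_cong, simp]: "sets \<mu> = sets borel" and "0 < e"
  shows "\<exists>R. \<forall>R'\<ge>R. (\<integral>x. outside_ball R' x \<partial>\<mu>) < e"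
proof -
  interpret prob_space \<mu> by fact
  have "((\<lambda>R. \<integral>x. outside_ball R x \<partial>\<mu>) \<longlongrightarrow> (\<integral>x. 0 \<partial>\<mu>)) at_top"
  proof (rule integral_dominated_convergence_at_top[where w="\<lambda>_. 1"])
    show "AE x in \<mu>. ((\<lambda>R. outside_ball R x) \<longlongrightarrow> 0) at_top"
    proof (intro AE_I2 tendsto_eventually)
      fix x show "\<forall>\<^sub>F R in at_top. outside_ball R x = 0"
        using eventually_ge_at_top[of "norm x"] by eventually_elim (simp add: outside_ball_def)
    qed
    show "\<forall>\<^sub>F R in at_top. AE x in \<mu>. norm (outside_ball R x) \<le> 1"
      by (intro always_eventually) (auto simp: outside_ball_def)
  qed auto
  then have "\<forall>\<^sub>F R in at_top. (\<integral>x. outside_ball R x \<partial>\<mu>) < e"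
    using \<open>0 < e\<close> by (intro order_tendstoD(2)) auto
  then show ?thesis by (auto simp: eventually_at_top_linorder)
qed

text \<open>On a large ball a bounded continuous function is close to a trigonometric polynomial \<open>p\<close>;
  composing \<open>p\<close> with a polynomial that approximates truncation keeps it bounded off the ball,
  where tightness takes over.\<close>

lemma tendsto_integral_if_trig:
  fixes \<nu> :: "nat \<Rightarrow> 'a::euclidean_space measure"
  assumes prob: "\<And>n. prob_space (\<nu> n)" "prob_space \<mu>"
    and sets_nu [measurable_cong, simp]: "\<And>n. sets (\<nu> n) = sets borel"
    and sets_mu [measurable_cong, simp]: "sets \<mu> = sets borel"
    and cos: "\<And>t. (\<lambda>n. \<integral>x. cos (t \<bullet> x) \<partial>\<nu> n) \<longlonglongrightarrow> (\<integral>x. cos (t \<bullet> x) \<partial>\<mu>)"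
    and sin: "\<And>t. (\<lambda>n. \<integral>x. sin (t \<bullet> x) \<partial>\<nu> n) \<longlonglongrightarrow> (\<integral>x. sin (t \<bullet> x) \<partial>\<mu>)"
    and tight: "\<And>e. 0 < e \<Longrightarrow> \<exists>R. \<forall>\<^sub>F n in sequentially. (\<integral>x. outside_ball R x \<partial>\<nu> n) < e"
    and g: "continuous_on UNIV g" "bounded (range g)"
  shows "(\<lambda>n. \<integral>x. g x \<partial>\<nu> n) \<longlonglongrightarrow> (\<integral>x. g x \<partial>\<mu> :: real)"
proof -
  have int_cont: "integrable m h"
    if "prob_space m" "sets m = sets borel" "continuous_on UNIV h" "\<And>x. \<bar>h x\<bar> \<le> B"
    for m :: "'a measure" and h :: "'a \<Rightarrow> real" and B
  proof -
    interpret prob_space m by fact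
    have "h \<in> borel_measurable m"
      using borel_measurable_continuous_onI[OF that(3)] measurable_cong_sets[OF that(2) refl] by blast
    then show ?thesis using that(4) by (intro integrable_const_bound[of _ B]) auto
  qed
  have trig_int: "integrable m p"
    if "prob_space m" "sets m = sets borel" "trig_poly p" for m :: "'a measure" and p
    using trig_poly_bounded[OF that(3)] int_cont[OF that(1,2) trig_poly_continuous[OF that(3)]] by blast
  have trig: "(\<lambda>n. \<integral>x. p x \<partial>\<nu> n) \<longlonglongrightarrow> (\<integral>x. p x \<partial>\<mu>)" if "trig_poly p" for p
    using that
  proof (induction rule: trig_poly.induct)
    case (add f g)
    then show ?case
      by (simp add: trig_int prob tendsto_add)
  qed (auto intro: cos sin tendsto_mult)
  obtain G where G: "\<And>x. \<bar>g x\<bar> \<le> G"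
    using g(2) by (auto simp: bounded_iff)
  have G0: "0 \<le> G" using G[of 0] by linarith
  show ?thesis
  proof (rule LIMSEQ_I)
    fix e0 :: real assume "e0 > 0"
    \<comment> \<open>Comparing \<open>r\<close> with \<open>g\<close> costs
      \<open>e * (2 + 2 * G + 1)\<close> under \<open>\<nu> n\<close> and again under \<mu>; the
      convergence for \<open>r\<close> costs one more \<open>e\<close>.\<close>
    define c\<^sub>0 where "c\<^sub>0 = 2 * (2 + 2 * G + 1) + 1"
    define e where "e = min 1 (e0 / c\<^sub>0)"
    have c0: "c\<^sub>0 > 0" using G0 by (simp add: c\<^sub>0_def)
    have e: "0 < e" "e \<le> 1" using \<open>e0 > 0\<close> c0 by (auto simp: e_def)
    have "e \<le> e0 / c\<^sub>0" by (simp add: e_def)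
    with c0 have "e * c\<^sub>0 \<le> e0" by (simp add: pos_le_divide_eq)
    then have ee: "e * (2 * (2 + 2 * G + 1) + 1) \<le> e0" unfolding c\<^sub>0_def .
    obtain R1 where R1: "\<forall>\<^sub>F n in sequentially. (\<integral>x. outside_ball R1 x \<partial>\<nu> n) < e"
      using tight[OF e(1)] by blast
    obtain R2 where R2: "\<And>R. R \<ge> R2 \<Longrightarrow> (\<integral>x. outside_ball R x \<partial>\<mu>) < e"
      using prob_tight[OF prob(2) sets_mu e(1)] by blast
    define R where "R = max R1 R2"
    have int_out: "integrable m (outside_ball R)"
      if "prob_space m" "sets m = sets borel" for m :: "'a measure" and R
      by (intro int_cont[OF that, of _ 1] continuous_intros) (auto simp: outside_ball_def)
    have Rn: "\<forall>\<^sub>F n in sequentially. (\<integral>x. outside_ball R x \<partial>\<nu> n) < e"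
      using R1
    proof eventually_elim
      case (elim n)
      have "(\<integral>x. outside_ball R x \<partial>\<nu> n) \<le> (\<integral>x. outside_ball R1 x \<partial>\<nu> n)"
        by (intro integral_mono int_out prob sets_nu outside_ball_antimono) (simp add: R_def)
      with elim show ?case by simp
    qed
    have Rmu: "(\<integral>x. outside_ball R x \<partial>\<mu>) < e" using R2 by (simp add: R_def)
    \<comment> \<open>Radius \<open>R + 1\<close>, because \<open>outside_ball R\<close> reaches 1
      only there and pays for the error beyond.\<close>
    have "\<exists>p. trig_poly p \<and> (\<forall>x\<in>cball 0 (R + 1). \<bar>g x - p x\<bar> < e)"
    proof (rule Stone_Weierstrass_HOL)
      show "continuous_on (cball 0 (R + 1)) g" using continuous_on_subset[OF g(1)] by simp
      show "\<exists>f. trig_poly f \<and> f x \<noteq> f y"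
        if "x \<in> cball 0 (R + 1) \<and> y \<in> cball 0 (R + 1) \<and> x \<noteq> y" for x y :: 'a
        using trig_poly_separates[of x y] that by blast
    qed (simp_all add: trig_poly_const trig_poly_continuous trig_poly.add trig_poly_mult e(1))
    then obtain p where p: "trig_poly p" "\<And>x. x \<in> cball 0 (R + 1) \<Longrightarrow> \<bar>g x - p x\<bar> < e"
      by blast
    obtain B where B: "\<And>x. \<bar>p x\<bar> \<le> B" using trig_poly_bounded[OF p(1)] by blast
    \<comment> \<open>Truncation fixes the values of \<open>g\<close> and is 1-Lipschitz, so
      \<open>c (p x)\<close> is as close to \<open>g x\<close> as \<open>p x\<close> was; a
      polynomial has to imitate it only on \<open>{-B..B}\<close>, which contains the range of
      \<open>p\<close>.\<close>
    define c where "c y = max (- G) (min G y)" for y :: real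
    obtain q where q: "real_polynomial_function q" "\<And>y. y \<in> {-B..B} \<Longrightarrow> \<bar>c y - q y\<bar> < e"
    proof (rule Stone_Weierstrass_real_polynomial_function[OF _ _ e(1)])
      show "continuous_on {-B..B} c" unfolding c_def[abs_def] by (intro continuous_intros)
    qed auto
    define r where "r x = q (p x)" for x
    have r: "trig_poly r" unfolding r_def[abs_def] by (rule trig_poly_compose[OF q(1) p(1)])
    have rc: "\<bar>c (p x) - r x\<bar> < e" for x
      unfolding r_def using B[of x] by (intro q(2)) (auto simp: abs_le_iff)
    have diff: "\<bar>r x - g x\<bar> \<le> 2 * e + (2 * G + 1) * outside_ball R x" for x
    proof (cases "norm x \<le> R + 1")
      case True
      then have "\<bar>g x - p x\<bar> < e" using p(2)[of x] by (simp add: dist_norm)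
      then have "\<bar>c (p x) - g x\<bar> < e"
        using G[of x] unfolding c_def by linarith
      with rc[of x] have "\<bar>r x - g x\<bar> \<le> 2 * e" by linarith
      moreover have "0 \<le> (2 * G + 1) * outside_ball R x"
        using G0 by (simp add: outside_ball_bounds)
      ultimately show ?thesis by linarith
    next
      case False
      have "\<bar>c (p x)\<bar> \<le> G" using G0 by (auto simp: c_def)
      then have "\<bar>r x - g x\<bar> \<le> 2 * e + (2 * G + 1)" using rc[of x] G[of x] e by linarith
      then show ?thesis using False by (simp add: outside_ball_eq_1)
    qed
    have close: "\<bar>(\<integral>x. r x \<partial>m) - (\<integral>x. g x \<partial>m)\<bar> \<le> e * (2 + 2 * G + 1)"
      if m: "prob_space m" "sets m = sets borel" "(\<integral>x. outside_ball R x \<partial>m) < e" for m :: "'a measure"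
    proof -
      interpret m: prob_space m by fact
      have ir: "integrable m r" by (rule trig_int[OF m(1,2) r])
      have ig: "integrable m g" by (rule int_cont[OF m(1,2) g(1) G])
      have "\<bar>(\<integral>x. r x \<partial>m) - (\<integral>x. g x \<partial>m)\<bar> = \<bar>\<integral>x. r x - g x \<partial>m\<bar>" using ir ig by simp
      also have "\<dots> \<le> (\<integral>x. \<bar>r x - g x\<bar> \<partial>m)" by (rule integral_abs_bound)
      also have "\<dots> \<le> (\<integral>x. 2 * e + (2 * G + 1) * outside_ball R x \<partial>m)"
        using ir ig int_out[OF m(1,2)] diff by (intro integral_mono) auto
      also have "\<dots> = 2 * e + (2 * G + 1) * (\<integral>x. outside_ball R x \<partial>m)"
        using int_out[OF m(1,2)] m.prob_space by simp
      also have "\<dots> \<le> 2 * e + (2 * G + 1) * e"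
        using m(3) G0 by (intro add_left_mono mult_left_mono) auto
      finally show ?thesis by (simp add: algebra_simps)
    qed
    have "\<forall>\<^sub>F n in sequentially. \<bar>(\<integral>x. r x \<partial>\<nu> n) - (\<integral>x. r x \<partial>\<mu>)\<bar> < e"
      using tendstoD[OF trig[OF r] e(1)] by (simp add: dist_real_def)
    then have "\<forall>\<^sub>F n in sequentially. norm ((\<integral>x. g x \<partial>\<nu> n) - (\<integral>x. g x \<partial>\<mu>)) < e0"
      using Rn
    proof eventually_elim
      case (elim n)
      have "\<bar>(\<integral>x. g x \<partial>\<nu> n) - (\<integral>x. g x \<partial>\<mu>)\<bar> < e * (2 * (2 + 2 * G + 1) + 1)"
        using close[OF prob(1) sets_nu elim(2)] close[OF prob(2) sets_mu Rmu] elim(1)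
        by (simp add: algebra_simps)
      with ee show ?case by simp
    qed
    then show "\<exists>no. \<forall>n\<ge>no. norm ((\<integral>x. g x \<partial>\<nu> n) - (\<integral>x. g x \<partial>\<mu>)) < e0"
      by (simp add: eventually_sequentially)
  qed
qed

lemma (in prob_space) conv_in_distr_if_trig:
  fixes V :: "nat \<Rightarrow> 'a \<Rightarrow> real ^ 'n"
  assumes [measurable]: "\<And>n. V n \<in> borel_measurable M"
    and mu: "prob_space \<mu>" "sets \<mu> = sets borel"
    and cos: "\<And>t. (\<lambda>n. expectation (\<lambda>\<omega>. cos (t \<bullet> V n \<omega>))) \<longlonglongrightarrow> (\<integral>x. cos (t \<bullet> x) \<partial>\<mu>)"
    and sin: "\<And>t. (\<lambda>n. expectation (\<lambda>\<omega>. sin (t \<bullet> V n \<omega>))) \<longlonglongrightarrow> (\<integral>x. sin (t \<bullet> x) \<partial>\<mu>)"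
    and tight: "\<And>e. 0 < e \<Longrightarrow>
      \<exists>R. \<forall>\<^sub>F n in sequentially. expectation (\<lambda>\<omega>. outside_ball R (V n \<omega>)) < e"
  shows "conv_in_distr M V \<mu>"
  unfolding conv_in_distr_def
proof (intro conjI allI impI)
  fix g :: "real ^ 'n \<Rightarrow> real" assume g: "continuous_on UNIV g" "bounded (range g)"
  have [measurable]: "g \<in> borel_measurable borel" by (rule borel_measurable_continuous_onI[OF g(1)])
  have "(\<lambda>n. \<integral>x. g x \<partial>distr M borel (V n)) \<longlonglongrightarrow> (\<integral>x. g x \<partial>\<mu>)"
    by (rule tendsto_integral_if_trig)
      (use mu g cos sin tight in \<open>auto simp: integral_distr intro: prob_space_distr\<close>)
  then show "(\<lambda>n. expectation (\<lambda>\<omega>. g (V n \<omega>))) \<longlonglongrightarrow> (\<integral>x. g x \<partial>\<mu>)"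
    by (simp add: integral_distr)
qed fact

section \<open>Slutsky's lemma\<close>

lemma abs_sin_diff_le: "\<bar>sin a - sin b\<bar> \<le> \<bar>a - b\<bar>" for a b :: real
proof -
  have "\<bar>sin a - sin b\<bar> = 2 * (\<bar>sin ((a - b) / 2)\<bar> * \<bar>cos ((a + b) / 2)\<bar>)"
    by (simp add: sin_diff_sin abs_mult)
  also have "\<dots> \<le> 2 * (\<bar>(a - b) / 2\<bar> * 1)"
    by (intro mult_left_mono mult_mono abs_sin_x_le_abs_x abs_cos_le_one) auto
  finally show ?thesis by simp
qed

lemma abs_cos_diff_le: "\<bar>cos a - cos b\<bar> \<le> \<bar>a - b\<bar>" for a b :: real
  using abs_sin_diff_le[of "pi / 2 - a" "pi / 2 - b"] by (simp add: cos_sin_eq abs_minus_commute)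

text \<open>The test functions that decide convergence, \<open>cos\<close>, \<open>sin\<close> and
  \<open>outside_ball R\<close>, are Lipschitz and bounded by 1; for these, passing from
  \<open>V n\<close> to \<open>T n\<close> costs at most a multiple of the mean truncated
  distance.\<close>

lemma (in prob_space) slutsky:
  fixes V T :: "nat \<Rightarrow> 'a \<Rightarrow> real ^ 'n"
  assumes conv: "conv_in_distr M V \<mu>" and mu: "prob_space \<mu>" "sets \<mu> = sets borel"
    and T_meas [measurable]: "\<And>n. T n \<in> borel_measurable M"
    and null: "((\<lambda>x. T (fst x) (snd x) - V (fst x) (snd x)) \<longlongrightarrow> 0) (whp M)"
  shows "conv_in_distr M T \<mu>"
proof -
  have [measurable]: "V n \<in> borel_measurable M" for n using conv by (simp add: conv_in_distr_def)
  \<comment> \<open>Truncation at 1 makes the mean finite, and \<open>m n\<close> tends to 0 because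
    the difference does so in probability.\<close>
  define m where "m n = expectation (\<lambda>\<omega>. min 1 (norm (T n \<omega> - V n \<omega>)))" for n
  have "m \<longlonglongrightarrow> 0"
  proof (rule LIMSEQ_I)
    fix e :: real assume e: "e > 0"
    have "\<forall>\<^sub>F x in whp M. norm (T (fst x) (snd x) - V (fst x) (snd x)) < e / 2"
      using tendstoD[OF null, of "e/2"] e by simp
    then have "(\<lambda>n. prob {\<omega>\<in>space M. norm (T n \<omega> - V n \<omega>) < e / 2}) \<longlonglongrightarrow> 1"
      by (subst (asm) eventually_whp_prob) auto
    then have ev: "\<forall>\<^sub>F n in sequentially. prob {\<omega>\<in>space M. norm (T n \<omega> - V n \<omega>) < e / 2} > 1 - e / 2"
      using e by (intro order_tendstoD(1)) auto
    have "\<forall>\<^sub>F n in sequentially. norm (m n - 0) < e"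
      using ev
    proof eventually_elim
      case (elim n)
      define A where "A = {\<omega>\<in>space M. norm (T n \<omega> - V n \<omega>) < e / 2}"
      have A [measurable]: "A \<in> events" unfolding A_def by measurable
      have "m n \<le> expectation (\<lambda>\<omega>. e / 2 + (1 - indicator A \<omega>))"
        unfolding m_def
      proof (rule integral_mono)
        show "integrable M (\<lambda>\<omega>. min 1 (norm (T n \<omega> - V n \<omega>)))"
          by (intro integrable_const_bound[of _ 1]) auto
        show "integrable M (\<lambda>\<omega>. e / 2 + (1 - indicator A \<omega>))"
          by (intro Bochner_Integration.integrable_add Bochner_Integration.integrable_diff
            integrable_const integrable_real_indicator A) (simp add: less_top[symmetric])
      qed (use e in \<open>auto simp: indicator_def min_def A_def\<close>)
      also have "\<dots> = e / 2 + (1 - prob A)" using A by (simp add: prob_space less_top[symmetric])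
      finally have "m n < e" using elim unfolding A_def by linarith
      moreover have "0 \<le> m n" unfolding m_def by simp
      ultimately show ?case by simp
    qed
    then show "\<exists>no. \<forall>n\<ge>no. norm (m n - 0) < e" by (simp add: eventually_sequentially)
  qed
  have lip: "(\<lambda>n. expectation (\<lambda>\<omega>. h (T n \<omega>))) \<longlonglongrightarrow> (\<integral>x. h x \<partial>\<mu>)"
    if h: "continuous_on UNIV h" "\<And>x. \<bar>h x\<bar> \<le> 1" and L: "\<And>x y. \<bar>h x - h y\<bar> \<le> L * norm (x - y)"
      and L0: "0 \<le> L" for h :: "real ^ 'n \<Rightarrow> real" and L
  proof -
    have [measurable]: "h \<in> borel_measurable borel" by (rule borel_measurable_continuous_onI[OF h(1)])
    have bh: "bounded (range h)" using h(2) by (auto simp: bounded_iff)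
    have iT: "integrable M (\<lambda>\<omega>. h (T n \<omega>))" and iV: "integrable M (\<lambda>\<omega>. h (V n \<omega>))" for n
      using h(2) by (auto intro!: integrable_const_bound[of _ 1])
    have "\<bar>expectation (\<lambda>\<omega>. h (T n \<omega>)) - expectation (\<lambda>\<omega>. h (V n \<omega>))\<bar> \<le> (2 + L) * m n" for n
    proof -
      have "\<bar>expectation (\<lambda>\<omega>. h (T n \<omega>)) - expectation (\<lambda>\<omega>. h (V n \<omega>))\<bar>
          = \<bar>expectation (\<lambda>\<omega>. h (T n \<omega>) - h (V n \<omega>))\<bar>" using iT iV by simp
      also have "\<dots> \<le> expectation (\<lambda>\<omega>. \<bar>h (T n \<omega>) - h (V n \<omega>)\<bar>)" by (rule integral_abs_bound)
      also have "\<dots> \<le> expectation (\<lambda>\<omega>. (2 + L) * min 1 (norm (T n \<omega> - V n \<omega>)))"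
      proof (rule integral_mono)
        show "integrable M (\<lambda>\<omega>. (2 + L) * min 1 (norm (T n \<omega> - V n \<omega>)))"
          using L0 by (intro integrable_mult_right integrable_const_bound[of _ 1]) auto
        fix \<omega>
        have "\<bar>h (T n \<omega>) - h (V n \<omega>)\<bar> \<le> 2"
          using h(2)[of "T n \<omega>"] h(2)[of "V n \<omega>"] by linarith
        moreover have "\<bar>h (T n \<omega>) - h (V n \<omega>)\<bar> \<le> (2 + L) * norm (T n \<omega> - V n \<omega>)"
          using L[of "T n \<omega>" "V n \<omega>"] by (simp add: algebra_simps) (smt (verit) norm_ge_zero)
        ultimately show "\<bar>h (T n \<omega>) - h (V n \<omega>)\<bar> \<le> (2 + L) * min 1 (norm (T n \<omega> - V n \<omega>))"
          using L0 by (auto simp: min_def)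
      qed (use iT iV in auto)
      finally show ?thesis by (simp add: m_def)
    qed
    then have "\<forall>\<^sub>F n in sequentially.
        norm (expectation (\<lambda>\<omega>. h (T n \<omega>)) - expectation (\<lambda>\<omega>. h (V n \<omega>))) \<le> (2 + L) * m n"
      unfolding real_norm_def by (intro always_eventually allI)
    then have dn: "(\<lambda>n. expectation (\<lambda>\<omega>. h (T n \<omega>)) - expectation (\<lambda>\<omega>. h (V n \<omega>))) \<longlonglongrightarrow> 0"
      by (rule Lim_null_comparison) (rule tendsto_mult_right_zero[OF \<open>m \<longlonglongrightarrow> 0\<close>])
    have "(\<lambda>n. expectation (\<lambda>\<omega>. h (V n \<omega>))) \<longlonglongrightarrow> (\<integral>x. h x \<partial>\<mu>)"
      using conv h(1) bh by (simp add: conv_in_distr_def)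
    from tendsto_add[OF dn this] show ?thesis by simp
  qed
  show ?thesis
  proof (rule conv_in_distr_if_trig[OF T_meas mu])
    fix t :: "real ^ 'n"
    have "\<bar>t \<bullet> x - t \<bullet> y\<bar> \<le> norm t * norm (x - y)" for x y
      using Cauchy_Schwarz_ineq2[of t "x - y"] by (simp add: inner_diff_right)
    moreover have "\<bar>cos a - cos b\<bar> \<le> \<bar>a - b\<bar>" "\<bar>sin a - sin b\<bar> \<le> \<bar>a - b\<bar>" for a b :: real
      by (rule abs_cos_diff_le abs_sin_diff_le)+
    ultimately have "\<bar>cos (t \<bullet> x) - cos (t \<bullet> y)\<bar> \<le> norm t * norm (x - y)"
      "\<bar>sin (t \<bullet> x) - sin (t \<bullet> y)\<bar> \<le> norm t * norm (x - y)" for x y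
      by (meson order_trans)+
    then show "(\<lambda>n. expectation (\<lambda>\<omega>. cos (t \<bullet> T n \<omega>))) \<longlonglongrightarrow> (\<integral>x. cos (t \<bullet> x) \<partial>\<mu>)"
      "(\<lambda>n. expectation (\<lambda>\<omega>. sin (t \<bullet> T n \<omega>))) \<longlonglongrightarrow> (\<integral>x. sin (t \<bullet> x) \<partial>\<mu>)"
      by (auto intro!: lip[OF _ _ _ norm_ge_zero[of t]] continuous_intros)
  next
    fix e :: real assume "e > 0"
    then obtain R where R: "(\<integral>x. outside_ball R x \<partial>\<mu>) < e" using prob_tight[OF mu] by blast
    have "(\<lambda>n. expectation (\<lambda>\<omega>. outside_ball R (T n \<omega>))) \<longlonglongrightarrow> (\<integral>x. outside_ball R x \<partial>\<mu>)"
      using outside_ball_diff[of R]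
      by (intro lip[OF _ _ _ zero_le_one] continuous_intros) (auto simp: outside_ball_def)
    then show "\<exists>R. \<forall>\<^sub>F n in sequentially. expectation (\<lambda>\<omega>. outside_ball R (T n \<omega>)) < e"
      using order_tendstoD(2) R by blast
  qed
qed

section \<open>The multivariate central limit theorem\<close>

text \<open>One step of Gaussian elimination per index: subtracting a rank one matrix clears one row
  and keeps the form positive semidefinite.\<close>

lemma psd_sum_rank_one:
  fixes A :: "real ^ 'n ^ 'n"
  assumes "finite J" "transpose A = A" "\<And>v. 0 \<le> v \<bullet> (A *v v)"
    and "\<And>i j. i \<notin> J \<Longrightarrow> A $ i $ j = 0"
  shows "\<exists>v :: 'n \<Rightarrow> real ^ 'n. \<forall>i j. A $ i $ j = (\<Sum>k\<in>J. v k $ i * v k $ j)"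
  using assms
proof (induction J arbitrary: A rule: finite_induct)
  case empty
  then show ?case by simp
next
  case (insert k J)
  have sym: "A $ i $ j = A $ j $ i" for i j
    using insert.prems(1) by (metis transpose_def vec_lambda_beta)
  have quad: "(axis k a + axis j b) \<bullet> (A *v (axis k a + axis j b)) =
      a\<^sup>2 * A $ k $ k + 2 * a * b * A $ k $ j + b\<^sup>2 * A $ j $ j" for j a b
    using sym[of j k]
    by (simp add: matrix_vector_right_distrib inner_add_left inner_axis' matrix_vector_mul_component
      inner_axis inner_add_right power2_eq_square algebra_simps)
  have Akk: "0 \<le> A $ k $ k"
    using insert.prems(2)[of "axis k 1 + axis k 0"] unfolding quad by simp
  show ?case
  proof (cases "A $ k $ k = 0")
    case True
    have "A $ k $ j = 0" for j
    proof (rule ccontr)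
      assume *: "A $ k $ j \<noteq> 0"
      \<comment> \<open>With \<open>A $ k $ k = 0\<close> the form at
        \<open>axis k a + axis j 1\<close> is affine in \<open>a\<close>, and this choice makes it
        -1.\<close>
      define a where "a = - (A $ j $ j + 1) / (2 * A $ k $ j)"
      have "a\<^sup>2 * A $ k $ k + 2 * a * 1 * A $ k $ j + 1\<^sup>2 * A $ j $ j = -1"
        using * True by (simp add: a_def field_simps)
      moreover have "0 \<le> a\<^sup>2 * A $ k $ k + 2 * a * 1 * A $ k $ j + 1\<^sup>2 * A $ j $ j"
        unfolding quad[symmetric] by (rule insert.prems(2))
      ultimately show False by simp
    qed
    then have "\<And>i j. i \<notin> J \<Longrightarrow> A $ i $ j = 0" using insert.prems(3) by (metis insertE)
    then obtain v :: "'n \<Rightarrow> real ^ 'n" where v: "\<And>i j. A $ i $ j = (\<Sum>k\<in>J. v k $ i * v k $ j)"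
      using insert.IH[OF insert.prems(1,2)] by blast
    define v' where "v' = v(k := 0)"
    have "A $ i $ j = (\<Sum>l\<in>insert k J. v' l $ i * v' l $ j)" for i j
      using insert.hyps unfolding v v'_def by (auto intro!: sum.cong)
    then show ?thesis by blast
  next
    case False
    with Akk have pos: "0 < A $ k $ k" by simp
    \<comment> \<open>The normalised \<open>k\<close>-th row: \<open>w $ i * w $ j\<close> agrees
      with \<open>A\<close> in row and column \<open>k\<close>, so \<open>B\<close> vanishes
      there.\<close>
    define w where "w = (1 / sqrt (A $ k $ k)) *\<^sub>R A $ k"
    define B where "B = (\<chi> i j. A $ i $ j - w $ i * w $ j)"
    have ww: "w $ i * w $ j = A $ k $ i * A $ k $ j / A $ k $ k" for i j
      using pos by (simp add: w_def field_simps)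
    have B: "B $ i $ j = A $ i $ j - A $ k $ i * A $ k $ j / A $ k $ k" for i j
      by (simp add: B_def ww)
    have "transpose B = B"
      by (simp add: vec_eq_iff transpose_def B) (metis sym mult.commute)
    moreover have "0 \<le> v \<bullet> (B *v v)" for v
    proof -
      \<comment> \<open>Completing the square in coordinate \<open>k\<close>: the form of
        \<open>B\<close> at \<open>v\<close> is the form of \<open>A\<close> at
        \<open>v - axis k c\<close>.\<close>
      define c where "c = (A $ k \<bullet> v) / A $ k $ k"
      have "v \<bullet> (B *v v) = v \<bullet> (A *v v) - (w \<bullet> v)\<^sup>2"
        by (simp add: B_def matrix_vector_mult_def inner_vec_def power2_eq_square algebra_simps
          sum_subtractf sum_distrib_left sum_distrib_right)
      moreover have "(w \<bullet> v)\<^sup>2 = c\<^sup>2 * A $ k $ k"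
        using pos by (simp add: w_def c_def power_divide power_mult_distrib field_simps power2_eq_square)
      moreover have "(v - axis k c) \<bullet> (A *v (v - axis k c)) = v \<bullet> (A *v v) - c\<^sup>2 * A $ k $ k"
      proof -
        have "v \<bullet> (A *v axis k c) = c * (A $ k \<bullet> v)"
          by (simp add: matrix_vector_mult_def inner_vec_def axis_def sum_distrib_left mult_ac if_distrib
            sum.If_cases sym[of _ k] cong: if_cong)
        moreover have "axis k c \<bullet> (A *v v) = c * (A $ k \<bullet> v)"
          by (simp add: inner_axis' matrix_vector_mul_component)
        moreover have "axis k c \<bullet> (A *v axis k c) = c\<^sup>2 * A $ k $ k"
          by (simp add: inner_axis' matrix_vector_mul_component inner_axis power2_eq_square)
        moreover have "A $ k \<bullet> v = c * A $ k $ k" using pos by (simp add: c_def)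
        ultimately show ?thesis
          by (simp add: matrix_vector_mult_diff_distrib inner_diff_left inner_diff_right power2_eq_square)
      qed
      ultimately show ?thesis using insert.prems(2)[of "v - axis k c"] by simp
    qed
    moreover have "B $ i $ j = 0" if "i \<notin> J" for i j
    proof (cases "i = k")
      case True then show ?thesis using pos by (simp add: B)
    next
      case False
      then have "A $ i $ j = 0" "A $ i $ k = 0" using that insert.prems(3) by auto
      then show ?thesis using sym[of i k] by (simp add: B)
    qed
    ultimately obtain v :: "'n \<Rightarrow> real ^ 'n" where v: "\<And>i j. B $ i $ j = (\<Sum>k\<in>J. v k $ i * v k $ j)"
      using insert.IH[of B] by blast
    define v' where "v' = v(k := w)"
    have "A $ i $ j = (\<Sum>l\<in>insert k J. v' l $ i * v' l $ j)" for i j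
    proof -
      have "A $ i $ j = w $ i * w $ j + B $ i $ j" by (simp add: B_def)
      also have "\<dots> = (\<Sum>l\<in>insert k J. v' l $ i * v' l $ j)"
        using insert.hyps unfolding v v'_def by (auto intro!: sum.cong)
      finally show ?thesis .
    qed
    then show ?thesis by blast
  qed
qed

section \<open>Gaussian laws with a prescribed covariance matrix\<close>

lemma borel_measurable_vec_component [measurable]:
  fixes h :: "'a \<Rightarrow> real ^ 'n"
  assumes [measurable]: "h \<in> borel_measurable M"
  shows "(\<lambda>x. h x $ i) \<in> borel_measurable M"
proof -
  have "(\<lambda>x. h x \<bullet> axis i 1) \<in> borel_measurable M" by measurable
  then show ?thesis by (simp add: inner_axis)
qed

lemma quadratic_form_eq_sum:
  fixes A :: "real ^ 'n ^ 'n"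
  shows "u \<bullet> (A *v u) = (\<Sum>i\<in>UNIV. \<Sum>j\<in>UNIV. u $ i * u $ j * A $ i $ j)"
  by (simp add: inner_vec_def matrix_vector_mult_def sum_distrib_left mult_ac)

text \<open>The law of a combination of the rank one vectors of \<Sigma> with independent standard
  normal coefficients. Projections along \<open>u \<noteq> 0\<close> have positive variance, hence a
  density.\<close>

lemma gaussian_exists:
  fixes \<Sigma> :: "real ^ 'n ^ 'n"
  assumes "pos_def_matrix \<Sigma>"
  shows "\<exists>\<mu> :: (real ^ 'n) measure. prob_space \<mu> \<and> sets \<mu> = sets borel \<and>
    (\<forall>u. u \<noteq> 0 \<longrightarrow> distributed \<mu> lborel (\<lambda>x. u \<bullet> x) (normal_density 0 (sqrt (u \<bullet> (\<Sigma> *v u)))))"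
proof -
  have sym: "transpose \<Sigma> = \<Sigma>" and pos: "\<And>u. u \<noteq> 0 \<Longrightarrow> 0 < u \<bullet> (\<Sigma> *v u)"
    using assms by (auto simp: pos_def_matrix_def)
  have nonneg: "0 \<le> u \<bullet> (\<Sigma> *v u)" for u using pos[of u] by (cases "u = 0") auto
  obtain v :: "'n \<Rightarrow> real ^ 'n" where v: "\<And>i j. \<Sigma> $ i $ j = (\<Sum>k\<in>UNIV. v k $ i * v k $ j)"
    using psd_sum_rank_one[of UNIV, OF _ sym nonneg] by auto
  let ?N = "density lborel std_normal_density"
  interpret N: prob_space ?N by (rule prob_space_normal_density) simp
  interpret P: product_prob_space "\<lambda>_::'n. ?N" UNIV ..
  define P where "P = PiM (UNIV :: 'n set) (\<lambda>_. ?N)"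
  interpret P: prob_space P unfolding P_def by (rule P.prob_space_axioms)
  have coord [measurable]: "(\<lambda>\<omega>. \<omega> k) \<in> borel_measurable P" for k
    unfolding P_def by measurable
  have distr_coord: "distr P borel (\<lambda>\<omega>. \<omega> k) = ?N" for k
    using distr_PiM_component[of UNIV "\<lambda>_. ?N" k] N.prob_space_axioms
    unfolding P_def by (simp cong: distr_cong)
  have normal: "distributed P lborel (\<lambda>\<omega>. \<omega> k) std_normal_density" for k
    unfolding distributed_def using distr_coord[of k] by (auto cong: distr_cong)
  have indep: "P.indep_vars (\<lambda>_. borel) (\<lambda>k \<omega>. \<omega> k) UNIV"
  proof (subst P.indep_vars_iff_distr_eq_PiM')
    have "distr P (\<Pi>\<^sub>M i\<in>UNIV. borel) (\<lambda>\<omega>. \<lambda>k\<in>UNIV. \<omega> k) = distr P P (\<lambda>\<omega>. \<omega>)"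
      unfolding P_def by (intro distr_cong sets_PiM_cong) auto
    also have "\<dots> = PiM UNIV (\<lambda>k. distr P borel (\<lambda>\<omega>. \<omega> k))"
      unfolding distr_coord by (simp add: P_def distr_id)
    finally show "distr P (\<Pi>\<^sub>M i\<in>UNIV. borel) (\<lambda>\<omega>. \<lambda>k\<in>UNIV. \<omega> k) = PiM UNIV (\<lambda>k. distr P borel (\<lambda>\<omega>. \<omega> k))" .
  qed auto
  define G where "G \<omega> = (\<Sum>k\<in>UNIV. \<omega> k *\<^sub>R v k)" for \<omega> :: "'n \<Rightarrow> real"
  have G [measurable]: "G \<in> borel_measurable P" unfolding G_def by measurable
  define \<mu> where "\<mu> = distr P borel G"
  have "prob_space \<mu>" unfolding \<mu>_def by (rule P.prob_space_distr[OF G])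
  moreover have "sets \<mu> = sets borel" by (simp add: \<mu>_def)
  moreover have "distributed \<mu> lborel (\<lambda>x. u \<bullet> x) (normal_density 0 (sqrt (u \<bullet> (\<Sigma> *v u))))"
    if u: "u \<noteq> 0" for u
  proof -
    \<comment> \<open>Zero coefficients are left out because a normal density needs a positive
      standard deviation; positive definiteness leaves at least one index.\<close>
    define K where "K = {k. u \<bullet> v k \<noteq> 0}"
    have quad: "u \<bullet> (\<Sigma> *v u) = (\<Sum>k\<in>K. (\<bar>u \<bullet> v k\<bar> * 1)\<^sup>2)"
    proof -
      have "u \<bullet> (\<Sigma> *v u) = (\<Sum>i\<in>UNIV. \<Sum>j\<in>UNIV. \<Sum>k\<in>UNIV. (u $ i * v k $ i) * (u $ j * v k $ j))"
        unfolding quadratic_form_eq_sum v by (simp add: sum_distrib_left mult_ac)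
      also have "\<dots> = (\<Sum>k\<in>UNIV. \<Sum>i\<in>UNIV. \<Sum>j\<in>UNIV. (u $ i * v k $ i) * (u $ j * v k $ j))"
        by (subst sum.swap, subst (2) sum.swap) (rule refl)
      also have "\<dots> = (\<Sum>k\<in>UNIV. (u \<bullet> v k)\<^sup>2)"
        by (simp add: power2_eq_square inner_vec_def sum_product)
      also have "\<dots> = (\<Sum>k\<in>K. (\<bar>u \<bullet> v k\<bar> * 1)\<^sup>2)"
        unfolding K_def by (intro sum.mono_neutral_cong_right) auto
      finally show ?thesis .
    qed
    then have "K \<noteq> {}" using pos[OF u] by auto
    have "distributed P lborel (\<lambda>\<omega>. 0 + (u \<bullet> v k) * \<omega> k) (normal_density (0 + (u \<bullet> v k) * 0) (\<bar>u \<bullet> v k\<bar> * 1))"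
      if "k \<in> K" for k
      using that by (intro P.normal_density_affine normal) (auto simp: K_def)
    moreover have "P.indep_vars (\<lambda>_. borel) (\<lambda>k \<omega>. 0 + (u \<bullet> v k) * \<omega> k) K"
      by (rule P.indep_vars_compose2[OF P.indep_vars_subset[OF indep]]) auto
    ultimately have "distributed P lborel (\<lambda>\<omega>. \<Sum>k\<in>K. 0 + (u \<bullet> v k) * \<omega> k)
        (normal_density (\<Sum>k\<in>K. 0 + (u \<bullet> v k) * 0) (sqrt (\<Sum>k\<in>K. (\<bar>u \<bullet> v k\<bar> * 1)\<^sup>2)))"
      using \<open>K \<noteq> {}\<close> by (intro P.sum_indep_normal) (auto simp: K_def)
    moreover have "(\<Sum>k\<in>K. 0 + (u \<bullet> v k) * \<omega> k) = u \<bullet> G \<omega>" for \<omega>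
      unfolding G_def inner_sum_right K_def by (intro sum.mono_neutral_cong_left) auto
    ultimately have "distributed P lborel (\<lambda>\<omega>. u \<bullet> G \<omega>) (normal_density 0 (sqrt (u \<bullet> (\<Sigma> *v u))))"
      unfolding quad by simp
    then show ?thesis
      unfolding distributed_def \<mu>_def by (auto simp: distr_distr comp_def)
  qed
  ultimately show ?thesis by blast
qed

lemma centered_gaussian_lawI:
  fixes \<Sigma> :: "real ^ 'n ^ 'n"
  assumes \<Sigma>: "pos_def_matrix \<Sigma>" and mu: "prob_space \<mu>" "sets \<mu> = sets borel"
    and normal: "\<And>u. u \<noteq> 0 \<Longrightarrow> distributed \<mu> lborel (\<lambda>x. u \<bullet> x) (normal_density 0 (sqrt (u \<bullet> (\<Sigma> *v u))))"
  shows "centered_gaussian_law \<mu> \<Sigma>"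
proof -
  interpret prob_space \<mu> by fact
  note mu(2) [measurable_cong, simp]
  have pos: "\<And>u. u \<noteq> 0 \<Longrightarrow> 0 < u \<bullet> (\<Sigma> *v u)" and sym: "transpose \<Sigma> = \<Sigma>"
    using \<Sigma> by (auto simp: pos_def_matrix_def)
  have symm: "\<Sigma> $ i $ j = \<Sigma> $ j $ i" for i j
    using arg_cong[OF sym, of "\<lambda>A. A $ i $ j"] by (simp add: transpose_def)
  have mean: "expectation (\<lambda>x. u \<bullet> x) = 0" if "u \<noteq> 0" for u
    using normal_distributed_expectation[OF _ normal[OF that]] pos[OF that] by simp
  have sq: "expectation (\<lambda>x. (u \<bullet> x)\<^sup>2) = u \<bullet> (\<Sigma> *v u)" if "u \<noteq> 0" for u
    using normal_distributed_variance[OF _ normal[OF that]] pos[OF that] mean[OF that] by simp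
  \<comment> \<open>A non-integrable function has integral 0 by convention, but this integral is
    positive.\<close>
  have int: "integrable \<mu> (\<lambda>x. (u \<bullet> x)\<^sup>2)" if "u \<noteq> 0" for u
    using sq[OF that] pos[OF that] not_integrable_integral_eq by fastforce
  have ax: "axis i (1::real) \<noteq> 0" "axis i (1::real) + axis j 1 \<noteq> 0" for i j :: 'n
    by (auto simp: vec_eq_iff axis_def dest: spec[of _ i])
  have gauss: "\<exists>m. distr \<mu> borel (\<lambda>x. u \<bullet> x) = return borel m \<or>
        (\<exists>\<sigma>>0. distr \<mu> borel (\<lambda>x. u \<bullet> x) = density lborel (normal_density m \<sigma>))" for u
  proof (cases "u = 0")
    case True
    have "distr \<mu> borel (\<lambda>x. 0::real) = return borel 0"
      by (rule distr_const) auto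
    with True show ?thesis by auto
  next
    case False
    have "distr \<mu> borel (\<lambda>x. u \<bullet> x) = density lborel (normal_density 0 (sqrt (u \<bullet> (\<Sigma> *v u))))"
      using normal[OF False] unfolding distributed_def by (simp cong: distr_cong)
    then show ?thesis using pos[OF False] by (intro exI[of _ 0] disjI2 exI[of _ "sqrt (u \<bullet> (\<Sigma> *v u))"]) simp
  qed
  have "expectation (\<lambda>x. x $ i) = 0" for i
    using mean[OF ax(1)[of i]] by (simp add: inner_axis')
  moreover have "expectation (\<lambda>x. x $ i * x $ j) = \<Sigma> $ i $ j" for i j
  proof -
    let ?a = "axis i (1::real)" and ?b = "axis j (1::real)"
    \<comment> \<open>Polarisation recovers covariances from the variances of projections.\<close>
    have "expectation (\<lambda>x. x $ i * x $ j) =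
        expectation (\<lambda>x. (((?a + ?b) \<bullet> x)\<^sup>2 - (?a \<bullet> x)\<^sup>2 - (?b \<bullet> x)\<^sup>2) / 2)"
      by (intro Bochner_Integration.integral_cong)
        (auto simp: inner_add_left inner_axis' power2_eq_square algebra_simps)
    also have "\<dots> = ((?a + ?b) \<bullet> (\<Sigma> *v (?a + ?b)) - ?a \<bullet> (\<Sigma> *v ?a) - ?b \<bullet> (\<Sigma> *v ?b)) / 2"
      using int[OF ax(1)[of i]] int[OF ax(1)[of j]] int[OF ax(2)[of i j]]
        sq[OF ax(1)[of i]] sq[OF ax(1)[of j]] sq[OF ax(2)[of i j]] by simp
    also have "\<dots> = \<Sigma> $ i $ j"
      using symm[of i j]
      by (simp add: matrix_vector_right_distrib inner_add_left inner_axis' matrix_vector_mul_component inner_axis)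
    finally show ?thesis .
  qed
  ultimately show ?thesis
    unfolding centered_gaussian_law_def gaussian_law_def using mu gauss by auto
qed

text \<open>Cramer-Wold: cosines and sines of \<open>t \<bullet> V n \<omega>\<close> see only a
  univariate normalised sum, whose variance is positive for \<open>t \<noteq> 0\<close> by positive
  definiteness. Tightness comes from second moments bounded in \<open>n\<close>.\<close>

lemma (in iid_sample) multivariate_clt:
  fixes h :: "'b \<Rightarrow> real ^ 'n" and \<Sigma> :: "real ^ 'n ^ 'n"
  assumes h [measurable]: "h \<in> borel_measurable borel"
    and sq: "\<And>i. integrable D (\<lambda>z. (h z $ i)\<^sup>2)" and mean: "\<And>i. (\<integral>z. h z $ i \<partial>D) = 0"
    and cov: "\<And>i j. (\<integral>z. h z $ i * h z $ j \<partial>D) = \<Sigma> $ i $ j"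
    and \<Sigma>: "pos_def_matrix \<Sigma>"
  shows "\<exists>\<mu>. centered_gaussian_law \<mu> \<Sigma> \<and>
    conv_in_distr M (\<lambda>n \<omega>. (1 / sqrt (real n)) *\<^sub>R (\<Sum>i<n. h (Z i \<omega>))) \<mu>"
proof -
  interpret D: prob_space D by (rule prob_space_D)
  obtain \<mu> :: "(real ^ 'n) measure" where mu: "prob_space \<mu>" "sets \<mu> = sets borel"
    and normal: "\<And>u. u \<noteq> 0 \<Longrightarrow> distributed \<mu> lborel (\<lambda>x. u \<bullet> x) (normal_density 0 (sqrt (u \<bullet> (\<Sigma> *v u))))"
    using gaussian_exists[OF \<Sigma>] by blast
  interpret mu: prob_space \<mu> by fact
  note mu(2) [measurable_cong, simp]
  have pos: "\<And>u. u \<noteq> 0 \<Longrightarrow> 0 < u \<bullet> (\<Sigma> *v u)" using \<Sigma> by (auto simp: pos_def_matrix_def)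
  define V where "V n \<omega> = (1 / sqrt (real n)) *\<^sub>R (\<Sum>i<n. h (Z i \<omega>))" for n \<omega>
  have V [measurable]: "V n \<in> borel_measurable M" for n unfolding V_def by measurable
  have int_prod: "integrable D (\<lambda>z. h z $ i * h z $ j)" for i j
  proof (rule Bochner_Integration.integrable_bound)
    show "integrable D (\<lambda>z. (h z $ i)\<^sup>2 + (h z $ j)\<^sup>2)" using sq by simp
    show "AE z in D. norm (h z $ i * h z $ j) \<le> norm ((h z $ i)\<^sup>2 + (h z $ j)\<^sup>2)"
    proof (rule AE_I2)
      fix z
      have "2 * \<bar>h z $ i * h z $ j\<bar> \<le> (h z $ i)\<^sup>2 + (h z $ j)\<^sup>2"
        using sum_squares_bound[of "\<bar>h z $ i\<bar>" "\<bar>h z $ j\<bar>"] by (simp add: abs_mult)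
      then show "norm (h z $ i * h z $ j) \<le> norm ((h z $ i)\<^sup>2 + (h z $ j)\<^sup>2)"
        by simp
    qed
  qed measurable
  have int_h: "integrable D (\<lambda>z. h z $ i)" for i
    by (rule D.square_integrable_imp_integrable) (use sq in auto)
  have lin: "(\<integral>z. u \<bullet> h z \<partial>D) = 0" for u
    unfolding inner_vec_def using int_h mean by simp
  have expand: "(u \<bullet> h z)\<^sup>2 = (\<Sum>i\<in>UNIV. \<Sum>j\<in>UNIV. u $ i * u $ j * (h z $ i * h z $ j))" for u z
    by (simp add: power2_eq_square inner_vec_def sum_product mult_ac)
  have usq: "integrable D (\<lambda>z. (u \<bullet> h z)\<^sup>2)" for u
    unfolding expand using int_prod by simp
  have uvar: "(\<integral>z. (u \<bullet> h z)\<^sup>2 \<partial>D) = u \<bullet> (\<Sigma> *v u)" for u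
    unfolding expand quadratic_form_eq_sum using int_prod cov by simp
  have trig: "(\<lambda>n. expectation (\<lambda>\<omega>. \<phi> (t \<bullet> V n \<omega>))) \<longlonglongrightarrow> (\<integral>x. \<phi> (t \<bullet> x) \<partial>\<mu>)"
    if phi: "\<And>x. isCont \<phi> x" "\<And>x. \<bar>\<phi> x\<bar> \<le> 1" for \<phi> :: "real \<Rightarrow> real" and t
  proof (cases "t = 0")
    case True
    then show ?thesis by (simp add: prob_space mu.prob_space)
  next
    case False
    define s where "s = sqrt (t \<bullet> (\<Sigma> *v t))"
    have s: "s > 0" and s2: "s\<^sup>2 = t \<bullet> (\<Sigma> *v t)" using pos[OF False] by (auto simp: s_def)
    have [measurable]: "\<phi> \<in> borel_measurable borel"
      using phi(1) by (intro borel_measurable_continuous_onI continuous_at_imp_continuous_on) auto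
    \<comment> \<open>Standardised for the univariate theorem; the factor \<open>s\<close> is put
      back inside the test function.\<close>
    define S where "S n \<omega> = (\<Sum>i<n. t \<bullet> h (Z i \<omega>)) / sqrt (n * s\<^sup>2)" for n \<omega>
    have [measurable]: "S n \<in> borel_measurable M" for n unfolding S_def by measurable
    have wc: "weak_conv_m (\<lambda>n. distr M borel (S n)) std_normal_distribution"
      unfolding S_def
    proof (rule central_limit_theorem_zero_mean)
      show "indep_vars (\<lambda>i. borel) (\<lambda>i \<omega>. t \<bullet> h (Z i \<omega>)) UNIV"
        by (rule indep_compose) measurable
      show m: "expectation (\<lambda>\<omega>. t \<bullet> h (Z n \<omega>)) = 0" for n
        using integral_Z[of "\<lambda>z. t \<bullet> h z" n] lin by simp
      show "integrable M (\<lambda>\<omega>. (t \<bullet> h (Z n \<omega>))\<^sup>2)" for n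
        using integrable_Z[OF usq] by simp
      show "variance (\<lambda>\<omega>. t \<bullet> h (Z n \<omega>)) = s\<^sup>2" for n
        using integral_Z[of "\<lambda>z. (t \<bullet> h z)\<^sup>2" n] by (simp add: m uvar s2)
      show "distr M borel (\<lambda>\<omega>. t \<bullet> h (Z n \<omega>)) = distr D borel (\<lambda>z. t \<bullet> h z)" for n
        unfolding distr_Z[of n, symmetric] by (simp add: distr_distr comp_def)
    qed (rule s)
    have "real_distribution (distr M borel (S n))" for n
      by (rule real_distribution_distr) simp
    moreover have "isCont (\<lambda>y. \<phi> (s * y)) x" for x
      using isCont_o2[of x "\<lambda>y. s * y" \<phi>] phi(1) by simp
    moreover have "norm (\<phi> (s * y)) \<le> 1" for y using phi(2) by simp
    ultimately have "(\<lambda>n. \<integral>y. \<phi> (s * y) \<partial>distr M borel (S n)) \<longlonglongrightarrow> (\<integral>y. \<phi> (s * y) \<partial>std_normal_distribution)"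
      by (rule weak_conv_imp_integral_bdd_continuous_conv[OF _ real_dist_normal_dist wc])
    moreover have "(\<integral>y. \<phi> (s * y) \<partial>distr M borel (S n)) = expectation (\<lambda>\<omega>. \<phi> (t \<bullet> V n \<omega>))" for n
    proof -
      have "s * S n \<omega> = t \<bullet> V n \<omega>" for \<omega>
        using s by (simp add: S_def V_def inner_sum_right real_sqrt_mult)
      then show ?thesis by (simp add: integral_distr)
    qed
    moreover have "(\<integral>y. \<phi> (s * y) \<partial>std_normal_distribution) = (\<integral>x. \<phi> (t \<bullet> x) \<partial>\<mu>)"
    proof -
      have "distributed \<mu> lborel (\<lambda>x. (t \<bullet> x - 0) / s) std_normal_density"
        using normal[OF False] mu.normal_standard_normal_convert[OF s, of "\<lambda>x. t \<bullet> x" 0]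
        by (simp add: s_def)
      then have "distr \<mu> lborel (\<lambda>x. (t \<bullet> x) / s) = std_normal_distribution"
        by (simp add: distributed_def)
      then have "(\<integral>y. \<phi> (s * y) \<partial>std_normal_distribution) = (\<integral>y. \<phi> (s * y) \<partial>distr \<mu> lborel (\<lambda>x. (t \<bullet> x) / s))"
        by simp
      also have "\<dots> = (\<integral>x. \<phi> (t \<bullet> x) \<partial>\<mu>)"
        using s by (subst integral_distr) auto
      finally show ?thesis .
    qed
    ultimately show ?thesis by simp
  qed
  have "conv_in_distr M V \<mu>"
  proof (rule conv_in_distr_if_trig[OF V mu])
    show "(\<lambda>n. expectation (\<lambda>\<omega>. cos (t \<bullet> V n \<omega>))) \<longlonglongrightarrow> (\<integral>x. cos (t \<bullet> x) \<partial>\<mu>)"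
      "(\<lambda>n. expectation (\<lambda>\<omega>. sin (t \<bullet> V n \<omega>))) \<longlonglongrightarrow> (\<integral>x. sin (t \<bullet> x) \<partial>\<mu>)" for t
      by (auto intro!: trig)
  next
    fix e :: real assume e: "e > 0"
    define K where "K = (\<Sum>k\<in>UNIV. \<integral>z. (h z $ k)\<^sup>2 \<partial>D)"
    have K: "K \<ge> 0" unfolding K_def by (intro sum_nonneg) simp
    \<comment> \<open>This gives \<open>K / R < e\<close>, and \<open>1 \<le> R\<close> gives
      \<open>outside_ball R x \<le> (norm x)\<^sup>2 / R\<close>.\<close>
    define R where "R = K / e + 1"
    have R: "R \<ge> 1" using K e by (simp add: R_def)
    have "expectation (\<lambda>\<omega>. outside_ball R (V n \<omega>)) < e" for n
    proof -
      have comp: "(V n \<omega> $ k)\<^sup>2 = (\<Sum>i<n. h (Z i \<omega>) $ k)\<^sup>2 / real n" for k \<omega>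
        by (simp add: V_def power_divide)
      have iV: "integrable M (\<lambda>\<omega>. (V n \<omega> $ k)\<^sup>2)" for k
        unfolding comp using sum_square_expectation(1)[OF _ sq mean] by simp
      have eV: "expectation (\<lambda>\<omega>. (V n \<omega> $ k)\<^sup>2) \<le> (\<integral>z. (h z $ k)\<^sup>2 \<partial>D)" for k
        unfolding comp using sum_square_expectation(2)[OF _ sq mean, of k n] by simp
      have n2: "(norm (V n \<omega>))\<^sup>2 = (\<Sum>k\<in>UNIV. (V n \<omega> $ k)\<^sup>2)" for \<omega>
        unfolding power2_norm_eq_inner inner_vec_def by (simp add: power2_eq_square)
      have "expectation (\<lambda>\<omega>. outside_ball R (V n \<omega>)) \<le> expectation (\<lambda>\<omega>. (norm (V n \<omega>))\<^sup>2 / R)"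
      proof (rule integral_mono)
        show "integrable M (\<lambda>\<omega>. outside_ball R (V n \<omega>))"
          by (intro integrable_const_bound[of _ 1]) (auto simp: outside_ball_def)
        show "integrable M (\<lambda>\<omega>. (norm (V n \<omega>))\<^sup>2 / R)"
          unfolding n2 using iV by simp
        show "outside_ball R (V n \<omega>) \<le> (norm (V n \<omega>))\<^sup>2 / R" for \<omega>
        proof (cases "norm (V n \<omega>) \<le> R")
          case True
          then show ?thesis using R by (simp add: outside_ball_def)
        next
          case False
          then have "R * 1 \<le> norm (V n \<omega>) * norm (V n \<omega>)" using R by (intro mult_mono) auto
          then have "1 \<le> (norm (V n \<omega>))\<^sup>2 / R" using R by (simp add: power2_eq_square)
          then show ?thesis using outside_ball_bounds(2)[of R "V n \<omega>"] by linarith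
        qed
      qed
      also have "\<dots> = (\<Sum>k\<in>UNIV. expectation (\<lambda>\<omega>. (V n \<omega> $ k)\<^sup>2)) / R"
        unfolding n2 using iV by simp
      also have "\<dots> \<le> K / R"
        unfolding K_def using R eV by (intro divide_right_mono sum_mono) auto
      also have "\<dots> < e"
        using K e R by (simp add: R_def field_simps)
      finally show ?thesis .
    qed
    then show "\<exists>R. \<forall>\<^sub>F n in sequentially. expectation (\<lambda>\<omega>. outside_ball R (V n \<omega>)) < e"
      by (intro exI[of _ R] always_eventually) auto
  qed
  then show ?thesis
    using centered_gaussian_lawI[OF \<Sigma> mu normal] unfolding V_def[abs_def] by blast
qed

section \<open>The error density\<close>

text \<open>Integrability of \<open>g\<close> lets the limit be taken along the intervals from
  \<open>- n\<close> to \<open>n\<close>, where the fundamental theorem applies; boundary values at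
  integers therefore decide.\<close>

lemma integral_derivative_eq_0:
  fixes G g :: "real \<Rightarrow> real"
  assumes deriv: "\<And>x. (G has_real_derivative g x) (at x)" and cont: "\<And>x. isCont g x"
    and int: "integrable lborel g"
    and lim: "(\<lambda>n. G (real n)) \<longlonglongrightarrow> 0" "(\<lambda>n. G (- real n)) \<longlonglongrightarrow> 0"
  shows "(\<integral>x. g x \<partial>lborel) = 0"
proof (rule LIMSEQ_unique)
  have [measurable]: "g \<in> borel_measurable borel" using int by simp
  show "(\<lambda>n. \<integral>x. indicator {- real n..real n} x *\<^sub>R g x \<partial>lborel) \<longlonglongrightarrow> (\<integral>x. g x \<partial>lborel)"
  proof (rule integral_dominated_convergence[where w="\<lambda>x. \<bar>g x\<bar>"])
    show "AE x in lborel. (\<lambda>n. indicator {- real n..real n} x *\<^sub>R g x) \<longlonglongrightarrow> g x"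
    proof (intro AE_I2 tendsto_eventually)
      fix x :: real
      obtain N where "\<bar>x\<bar> \<le> real N" using real_arch_simple by blast
      then show "\<forall>\<^sub>F n in sequentially. indicator {- real n..real n} x *\<^sub>R g x = g x"
        by (intro eventually_sequentiallyI[of N]) (auto simp: indicator_def abs_le_iff)
    qed
  qed (use int in \<open>auto simp: indicator_def\<close>)
  have "(\<integral>x. indicator {- real n..real n} x *\<^sub>R g x \<partial>lborel) = G (real n) - G (- real n)" for n
    using integral_FTC_Icc_real[of "- real n" "real n" G g] deriv cont
    by (simp add: mult.commute)
  then show "(\<lambda>n. \<integral>x. indicator {- real n..real n} x *\<^sub>R g x \<partial>lborel) \<longlonglongrightarrow> 0"
    using tendsto_diff[OF lim] by simp
qed

lemma continuous_AE_eq_0_imp_eq_0: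
  fixes g :: "real \<Rightarrow> real"
  assumes "continuous_on UNIV g" "AE t in lborel. g t = 0"
  shows "g t = 0"
proof -
  have "closed {t. g t = 0}" using assms(1) by (intro closed_Collect_eq) auto
  moreover have "AE t in lebesgue. t \<in> {t. g t = 0}"
    using assms(2) by (intro AE_completion) simp
  ultimately show ?thesis using mem_closed_if_AE_lebesgue by blast
qed

lemma integral_odd_eq_0:
  fixes g :: "real \<Rightarrow> real"
  assumes "\<And>x. g (- x) = - g x"
  shows "(\<integral>x. g x \<partial>lborel) = 0"
  using lborel_integral_real_affine[of "-1" g 0] assms by simp

text \<open>Moving outwards by the factor \<open>c\<close> divides \<open>g\<close> by
  \<open>c\<^sup>2 > 1\<close> up to an error governed by \<open>d\<close>, so a bound on
  \<open>{-1..1}\<close> propagates to all powers of \<open>c\<close>; a bound survives the step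
  once it is at least \<open>d / (c\<^sup>2 - 1)\<close>.\<close>

lemma bounded_if_almost_homogeneous:
  fixes g :: "real \<Rightarrow> real"
  assumes cont: "continuous_on UNIV g" and c: "1 < c"
    and d: "\<And>t. \<bar>g t - c\<^sup>2 * g (c * t)\<bar> \<le> d"
  shows "\<exists>K. \<forall>t. \<bar>g t\<bar> \<le> K"
proof -
  have "bounded (g ` {-1..1})"
    by (intro compact_imp_bounded compact_continuous_image continuous_on_subset[OF cont]) auto
  then obtain B where B: "\<And>t. \<bar>t\<bar> \<le> 1 \<Longrightarrow> \<bar>g t\<bar> \<le> B"
    by (fastforce simp: bounded_iff)
  have c2: "1 < c\<^sup>2" using c by (simp add: one_less_power)
  define K where "K = max B (d / (c\<^sup>2 - 1))"
  have "d / (c\<^sup>2 - 1) \<le> K" by (simp add: K_def)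
  then have K: "K + d \<le> c\<^sup>2 * K" using c2 by (simp add: pos_divide_le_eq algebra_simps)
  have "\<bar>t\<bar> \<le> c ^ n \<Longrightarrow> \<bar>g t\<bar> \<le> K" for t n
  proof (induction n arbitrary: t)
    case 0
    then show ?case using B[of t] by (simp add: K_def)
  next
    case (Suc n)
    have "\<bar>t / c\<bar> \<le> c ^ n" using Suc.prems c by (simp add: abs_divide pos_divide_le_eq mult.commute)
    then have "\<bar>g (t / c)\<bar> \<le> K" by (rule Suc.IH)
    moreover have "\<bar>g (t / c) - c\<^sup>2 * g t\<bar> \<le> d" using d[of "t / c"] c by simp
    ultimately have "\<bar>c\<^sup>2 * g t\<bar> \<le> c\<^sup>2 * K" using K by linarith
    moreover have "0 < c\<^sup>2" using c2 by linarith
    ultimately show ?case by (simp add: abs_mult)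
  qed
  moreover have "\<exists>n. \<bar>t\<bar> \<le> c ^ n" for t
    using real_arch_pow[OF c, of "\<bar>t\<bar>"] by (meson less_imp_le)
  ultimately show ?thesis by blast
qed

section \<open>Score and Fisher information of the error density\<close>

locale error_density =
  fixes f \<psi>' \<psi>'' :: "real \<Rightarrow> real" and K \<alpha> C :: real
  assumes f_pos: "0 < f t"
    and deriv_ln_f: "((\<lambda>t. ln (f t)) has_real_derivative \<psi>' t) (at t)"
    and deriv_score: "(\<psi>' has_real_derivative \<psi>'' t) (at t)"
    and cont_score_deriv: "continuous_on UNIV \<psi>''"
    and score_deriv_bound: "\<bar>\<psi>'' t\<bar> \<le> K"
    and f_even: "f (- t) = f t"
    and f_antimono: "antimono_on {0..} f"
    and f_prob: "(\<integral>\<^sup>+ t. f t \<partial>lborel) = 1"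
    and int_sq: "integrable lborel (\<lambda>t. t\<^sup>2 * f t)"
    and tail_exponent: "0 < \<alpha>" and f_tail: "f t \<le> C * exp (- (\<bar>t\<bar> powr \<alpha>))"
begin

lemma K_nonneg: "0 \<le> K" using score_deriv_bound[of 0] by linarith

lemma deriv_f: "(f has_real_derivative \<psi>' t * f t) (at t)"
proof -
  have "((\<lambda>t. exp (ln (f t))) has_real_derivative exp (ln (f t)) * \<psi>' t) (at t)"
    by (rule DERIV_fun_exp[OF deriv_ln_f])
  then show ?thesis using f_pos by (simp add: mult.commute)
qed

lemma isCont_f: "isCont f t" by (rule DERIV_isCont[OF deriv_f])

lemma isCont_score: "isCont \<psi>' t" by (rule DERIV_isCont[OF deriv_score])

lemma isCont_score_deriv: "isCont \<psi>'' t"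
  using cont_score_deriv by (simp add: continuous_on_eq_continuous_at)

lemma f_measurable [measurable]: "f \<in> borel_measurable borel"
  by (intro borel_measurable_continuous_onI continuous_at_imp_continuous_on) (simp add: isCont_f)

lemma score_measurable [measurable]: "\<psi>' \<in> borel_measurable borel"
  by (intro borel_measurable_continuous_onI continuous_at_imp_continuous_on) (simp add: isCont_score)

lemma score_deriv_measurable [measurable]: "\<psi>'' \<in> borel_measurable borel"
  by (intro borel_measurable_continuous_onI cont_score_deriv)

lemma score_odd: "\<psi>' (- t) = - \<psi>' t"
proof -
  have "((\<lambda>t. ln (f (- t))) has_real_derivative \<psi>' (- t) * (- 1)) (at t)"
    by (rule DERIV_chain2[OF deriv_ln_f]) (auto intro!: derivative_eq_intros)
  then have "((\<lambda>t. ln (f t)) has_real_derivative - \<psi>' (- t)) (at t)" by (simp add: f_even)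
  then show ?thesis using DERIV_unique[OF _ deriv_ln_f[of t]] by fastforce
qed

lemma score_deriv_even: "\<psi>'' (- t) = \<psi>'' t"
proof -
  have "((\<lambda>t. \<psi>' (- t)) has_real_derivative \<psi>'' (- t) * (- 1)) (at t)"
    by (rule DERIV_chain2[OF deriv_score]) (auto intro!: derivative_eq_intros)
  then have "((\<lambda>t. - \<psi>' t) has_real_derivative - \<psi>'' (- t)) (at t)" by (simp add: score_odd)
  from DERIV_minus[OF this] have "(\<psi>' has_real_derivative \<psi>'' (- t)) (at t)" by simp
  then show ?thesis by (rule DERIV_unique[OF _ deriv_score])
qed

lemma score_lipschitz: "\<bar>\<psi>' a - \<psi>' b\<bar> \<le> K * \<bar>a - b\<bar>"
  using field_differentiable_bound[of UNIV \<psi>' \<psi>'' K a b] deriv_score score_deriv_bound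
  by (auto intro: has_field_derivative_at_within)

text \<open>Oddness gives \<open>\<psi>' 0 = 0\<close>, so the Lipschitz bound becomes linear
  growth; squared scores are then dominated by a multiple of \<open>t\<^sup>2\<close>, which has a
  finite mean.\<close>

lemma score_bound: "\<bar>\<psi>' t\<bar> \<le> K * \<bar>t\<bar>"
  using score_lipschitz[of t 0] score_odd[of 0] by simp

lemma ln_f_lipschitz:
  assumes "\<bar>a\<bar> \<le> R" "\<bar>b\<bar> \<le> R"
  shows "\<bar>ln (f a) - ln (f b)\<bar> \<le> K * R * \<bar>a - b\<bar>"
proof -
  have "norm (ln (f a) - ln (f b)) \<le> K * R * norm (a - b)"
  proof (rule field_differentiable_bound[of "{-R..R}"])
    show "((\<lambda>t. ln (f t)) has_real_derivative \<psi>' t) (at t within {-R..R})" for t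
      by (rule has_field_derivative_at_within[OF deriv_ln_f])
    show "norm (\<psi>' t) \<le> K * R" if "t \<in> {-R..R}" for t
    proof -
      have "K * \<bar>t\<bar> \<le> K * R" using that K_nonneg by (intro mult_left_mono) auto
      then show ?thesis using score_bound[of t] by simp
    qed
  qed (use assms in auto)
  then show ?thesis by simp
qed

lemma f_le_f0: "f t \<le> f 0"
proof -
  have "f \<bar>t\<bar> \<le> f 0" using f_antimono by (auto simp: monotone_on_def)
  then show ?thesis using f_even[of t] by (cases "t \<ge> 0") auto
qed

definition F :: "real measure" where "F = density lborel f"

lemma sets_F [measurable_cong, simp]: "sets F = sets borel" by (simp add: F_def)

lemma space_F [simp]: "space F = UNIV" by (simp add: F_def)

lemma prob_space_F: "prob_space F"
  using f_prob by (intro prob_spaceI) (simp add: F_def emeasure_density)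

sublocale F: prob_space F by (rule prob_space_F)

lemma integrable_F_iff: "h \<in> borel_measurable borel \<Longrightarrow>
    integrable F h \<longleftrightarrow> integrable lborel (\<lambda>t. f t * h t)" for h :: "real \<Rightarrow> real"
  unfolding F_def using f_pos by (subst integrable_density) (auto simp: less_imp_le)

lemma integral_F: "h \<in> borel_measurable borel \<Longrightarrow>
    (\<integral>t. h t \<partial>F) = (\<integral>t. f t * h t \<partial>lborel)" for h :: "real \<Rightarrow> real"
  unfolding F_def using f_pos by (subst integral_density) (auto simp: less_imp_le)

lemma AE_F_iff: "(AE t in F. P t) \<longleftrightarrow> (AE t in lborel. P t)"
  unfolding F_def using f_pos by (subst AE_density) auto

lemma int_F_sq: "integrable F (\<lambda>t. t\<^sup>2)"
  using int_sq by (simp add: integrable_F_iff mult.commute)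

lemma int_F_id: "integrable F (\<lambda>t. t)"
  by (rule F.square_integrable_imp_integrable[OF _ int_F_sq]) simp

lemma int_F_quadratic_growth:
  assumes [measurable]: "h \<in> borel_measurable borel" and "\<And>t. \<bar>h t\<bar> \<le> A + B * t\<^sup>2"
  shows "integrable F h"
proof (rule Bochner_Integration.integrable_bound)
  show "integrable F (\<lambda>t. A + B * t\<^sup>2)" using int_F_sq by simp
  show "AE t in F. norm (h t) \<le> norm (A + B * t\<^sup>2)"
  proof (rule AE_I2)
    fix t
    show "norm (h t) \<le> norm (A + B * t\<^sup>2)" using assms(2)[of t] by simp
  qed
qed simp

definition m\<^sub>2 :: real where "m\<^sub>2 = (\<integral>t. t\<^sup>2 \<partial>F)"

text \<open>Fisher information of the location family: \<open>\<psi>' t * f t\<close> is the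
  derivative of \<open>f\<close>, so this is the integral of the squared derivative over
  \<open>f\<close>.\<close>

definition info :: real where "info = (\<integral>t. (\<psi>' t)\<^sup>2 \<partial>F)"

lemma score_sq_bound: "(\<psi>' t)\<^sup>2 \<le> K\<^sup>2 * t\<^sup>2"
  using score_bound[of t] power_mono[of "\<bar>\<psi>' t\<bar>" "K * \<bar>t\<bar>" 2] by (simp add: power_mult_distrib)

lemma int_score_sq: "integrable F (\<lambda>t. (\<psi>' t)\<^sup>2)"
proof (rule int_F_quadratic_growth)
  show "\<bar>(\<psi>' t)\<^sup>2\<bar> \<le> 0 + K\<^sup>2 * t\<^sup>2" for t using score_sq_bound[of t] by simp
qed measurable

lemma int_score_deriv: "integrable F \<psi>''"
proof (rule int_F_quadratic_growth)
  show "\<bar>\<psi>'' t\<bar> \<le> K + 0 * t\<^sup>2" for t using score_deriv_bound[of t] by simp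
qed measurable

lemma int_id_score: "integrable F (\<lambda>t. t * \<psi>' t)"
proof (rule int_F_quadratic_growth)
  show "\<bar>t * \<psi>' t\<bar> \<le> 0 + K * t\<^sup>2" for t
  proof -
    have "\<bar>t * \<psi>' t\<bar> = \<bar>t\<bar> * \<bar>\<psi>' t\<bar>" by (rule abs_mult)
    also have "\<dots> \<le> \<bar>t\<bar> * (K * \<bar>t\<bar>)" using score_bound by (intro mult_left_mono) auto
    also have "\<dots> = K * (\<bar>t\<bar> * \<bar>t\<bar>)" by (simp only: mult_ac)
    also have "\<dots> = 0 + K * t\<^sup>2" by (simp add: power2_eq_square)
    finally show ?thesis .
  qed
qed measurable

lemma integral_F_odd:
  fixes h :: "real \<Rightarrow> real"
  assumes [measurable]: "h \<in> borel_measurable borel" and "\<And>t. h (- t) = - h t"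
  shows "(\<integral>t. h t \<partial>F) = 0"
  unfolding integral_F[OF assms(1)] by (rule integral_odd_eq_0) (simp add: assms(2) f_even)

text \<open>Controls the boundary terms of both integrations by parts: \<open>t * f t\<close>
  itself, and \<open>f t * \<psi>' t\<close>, which is at most \<open>K\<close> times it in absolute
  value for \<open>0 \<le> t\<close>.\<close>

lemma tendsto_f_times: "(\<lambda>n. real n * f (real n)) \<longlonglongrightarrow> 0"
proof (rule tendsto_sandwich[of "\<lambda>_. 0" _ _ "\<lambda>n. C * (real n * exp (- (real n powr \<alpha>)))"])
  have a: "0 < \<alpha>" by (rule tail_exponent)
  show "(\<lambda>n. C * (real n * exp (- (real n powr \<alpha>)))) \<longlonglongrightarrow> 0"
    using a by real_asymp
  show "\<forall>\<^sub>F n in sequentially. real n * f (real n) \<le> C * (real n * exp (- (real n powr \<alpha>)))"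
  proof (intro always_eventually allI)
    fix n :: nat
    show "real n * f (real n) \<le> C * (real n * exp (- (real n powr \<alpha>)))"
      using mult_left_mono[OF f_tail[of "real n"], of "real n"] by (simp add: mult_ac)
  qed
  show "\<forall>\<^sub>F n in sequentially. 0 \<le> real n * f (real n)"
    using f_pos by (intro always_eventually allI mult_nonneg_nonneg) (auto intro: less_imp_le)
qed simp

text \<open>Information identity: the integrand
  \<open>f x * (\<psi>'' x + (\<psi>' x)\<^sup>2)\<close> is the second derivative of
  \<open>f\<close>, so its integral is a boundary term of \<open>f t * \<psi>' t\<close>, which
  vanishes.\<close>

lemma integral_score_deriv: "(\<integral>t. \<psi>'' t \<partial>F) = - info"
proof -
  have int: "integrable F (\<lambda>t. \<psi>'' t + (\<psi>' t)\<^sup>2)" using int_score_deriv int_score_sq by simp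
  have "(\<integral>t. f t * (\<psi>'' t + (\<psi>' t)\<^sup>2) \<partial>lborel) = 0"
  proof (rule integral_derivative_eq_0[where G="\<lambda>t. f t * \<psi>' t"])
    show "((\<lambda>t. f t * \<psi>' t) has_real_derivative f x * (\<psi>'' x + (\<psi>' x)\<^sup>2)) (at x)" for x
      by (auto intro!: derivative_eq_intros deriv_f deriv_score simp: algebra_simps power2_eq_square)
    show "isCont (\<lambda>x. f x * (\<psi>'' x + (\<psi>' x)\<^sup>2)) x" for x
      by (intro continuous_intros isCont_f isCont_score isCont_score_deriv)
    show "integrable lborel (\<lambda>x. f x * (\<psi>'' x + (\<psi>' x)\<^sup>2))"
      using int by (simp add: integrable_F_iff)
    have lim: "(\<lambda>n. f (real n) * \<psi>' (real n)) \<longlonglongrightarrow> 0"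
    proof (rule Lim_null_comparison)
      show "(\<lambda>n. K * (real n * f (real n))) \<longlonglongrightarrow> 0"
        by (rule tendsto_mult_right_zero[OF tendsto_f_times])
      show "\<forall>\<^sub>F n in sequentially. norm (f (real n) * \<psi>' (real n)) \<le> K * (real n * f (real n))"
      proof (intro always_eventually allI)
        fix n :: nat
        show "norm (f (real n) * \<psi>' (real n)) \<le> K * (real n * f (real n))"
          using mult_left_mono[OF score_bound[of "real n"], of "f (real n)"] f_pos[of "real n"]
          by (simp add: abs_mult mult_ac)
      qed
    qed
    then show "(\<lambda>n. f (real n) * \<psi>' (real n)) \<longlonglongrightarrow> 0" .
    show "(\<lambda>n. f (- real n) * \<psi>' (- real n)) \<longlonglongrightarrow> 0"
      using tendsto_minus[OF lim] by (simp add: f_even score_odd)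
  qed
  then have "(\<integral>t. \<psi>'' t + (\<psi>' t)\<^sup>2 \<partial>F) = 0" by (subst integral_F) simp_all
  then show ?thesis using int_score_deriv int_score_sq by (simp add: info_def)
qed

text \<open>Integration by parts: \<open>f t * (1 + t * \<psi>' t)\<close> is the derivative of
  \<open>t * f t\<close>.\<close>

lemma integral_id_score: "(\<integral>t. t * \<psi>' t \<partial>F) = - 1"
proof -
  have int: "integrable F (\<lambda>t. 1 + t * \<psi>' t)" using int_id_score by simp
  have "(\<integral>t. f t * (1 + t * \<psi>' t) \<partial>lborel) = 0"
  proof (rule integral_derivative_eq_0[where G="\<lambda>t. t * f t"])
    show "((\<lambda>t. t * f t) has_real_derivative f x * (1 + x * \<psi>' x)) (at x)" for x
      by (auto intro!: derivative_eq_intros deriv_f simp: algebra_simps)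
    show "isCont (\<lambda>x. f x * (1 + x * \<psi>' x)) x" for x
      by (intro continuous_intros isCont_f isCont_score)
    show "integrable lborel (\<lambda>x. f x * (1 + x * \<psi>' x))"
      using int by (simp add: integrable_F_iff)
    show "(\<lambda>n. real n * f (real n)) \<longlonglongrightarrow> 0" by (rule tendsto_f_times)
    show "(\<lambda>n. - real n * f (- real n)) \<longlonglongrightarrow> 0"
      using tendsto_minus[OF tendsto_f_times] by (simp add: f_even)
  qed
  then have "(\<integral>t. 1 + t * \<psi>' t \<partial>F) = 0" by (subst integral_F) simp_all
  then show ?thesis using int_id_score F.prob_space by simp
qed

lemma m2_pos: "0 < m\<^sub>2"
proof (rule ccontr)
  assume "\<not> 0 < m\<^sub>2"
  moreover have "0 \<le> m\<^sub>2" unfolding m\<^sub>2_def by simp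
  ultimately have "m\<^sub>2 = 0" by simp
  then have "(\<integral>t. t\<^sup>2 \<partial>F) = 0" unfolding m\<^sub>2_def .
  then have "AE t in F. t\<^sup>2 = 0"
    using integral_nonneg_eq_0_iff_AE[OF int_F_sq] by simp
  then have "AE t in lborel. t = (0::real)" by (simp add: AE_F_iff)
  moreover have "AE t in lborel. t \<noteq> (0::real)" by (rule AE_lborel_singleton)
  ultimately have "AE t in lborel :: real measure. False" by eventually_elim simp
  then show False using F.AE_False AE_F_iff[of "\<lambda>_. False"] by simp
qed

text \<open>Makes the defect in the Cauchy-Schwarz inequality between \<open>t\<close> and
  \<open>\<psi>' t\<close> explicit, so that the bound on \<open>m\<^sub>2 * info\<close> and its
  equality case come from one identity.\<close>

lemma integral_score_plus_linear: "(\<integral>t. (\<psi>' t + t / m\<^sub>2)\<^sup>2 \<partial>F) = info - 1 / m\<^sub>2"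
proof -
  have "(\<integral>t. (\<psi>' t + t / m\<^sub>2)\<^sup>2 \<partial>F) = (\<integral>t. (\<psi>' t)\<^sup>2 + (2 / m\<^sub>2) * (t * \<psi>' t) + (1 / m\<^sub>2\<^sup>2) * t\<^sup>2 \<partial>F)"
    by (intro Bochner_Integration.integral_cong) (auto simp: power2_sum power_divide)
  also have "\<dots> = info + (2 / m\<^sub>2) * (- 1) + (1 / m\<^sub>2\<^sup>2) * m\<^sub>2"
    using int_score_sq int_id_score int_F_sq
    by (simp add: info_def integral_id_score m\<^sub>2_def[symmetric])
  also have "\<dots> = info - 1 / m\<^sub>2" using m2_pos by (simp add: power2_eq_square field_simps)
  finally show ?thesis .
qed

lemma info_bound: "1 \<le> m\<^sub>2 * info"
proof -
  have "0 \<le> info - 1 / m\<^sub>2" unfolding integral_score_plus_linear[symmetric] by simp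
  then show ?thesis using m2_pos by (simp add: field_simps)
qed

lemma info_pos: "0 < info"
  using info_bound m2_pos zero_less_mult_pos[of m\<^sub>2 info] by linarith

lemma info_eq_imp_normal:
  assumes "m\<^sub>2 * info = 1"
  shows "f t = normal_density 0 (sqrt m\<^sub>2) t"
proof -
  have "info = 1 / m\<^sub>2" using assms m2_pos by (simp add: field_simps)
  then have "(\<integral>t. (\<psi>' t + t / m\<^sub>2)\<^sup>2 \<partial>F) = 0" by (simp add: integral_score_plus_linear)
  moreover have int: "integrable F (\<lambda>t. (\<psi>' t + t / m\<^sub>2)\<^sup>2)"
  proof -
    have "integrable F (\<lambda>t. (\<psi>' t)\<^sup>2 + (2 / m\<^sub>2) * (t * \<psi>' t) + (1 / m\<^sub>2\<^sup>2) * t\<^sup>2)"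
      using int_score_sq int_id_score int_F_sq by simp
    then show ?thesis by (simp add: power2_sum power_divide algebra_simps)
  qed
  ultimately have "AE t in F. (\<psi>' t + t / m\<^sub>2)\<^sup>2 = 0"
    using integral_nonneg_eq_0_iff_AE[OF int] by simp
  then have "AE t in lborel. \<psi>' t + t / m\<^sub>2 = 0" by (simp add: AE_F_iff)
  moreover have "continuous_on UNIV (\<lambda>t. \<psi>' t + t / m\<^sub>2)"
    by (intro continuous_at_imp_continuous_on ballI continuous_intros isCont_score) (use m2_pos in auto)
  ultimately have "\<psi>' t + t / m\<^sub>2 = 0" for t by (intro continuous_AE_eq_0_imp_eq_0)
  then have score: "\<psi>' t = - t / m\<^sub>2" for t by (simp add: add_eq_0_iff2)
  have "((\<lambda>t. ln (f t) + t\<^sup>2 / (2 * m\<^sub>2)) has_real_derivative 0) (at t)" for t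
  proof -
    have "((\<lambda>t. t\<^sup>2 / (2 * m\<^sub>2)) has_real_derivative t / m\<^sub>2) (at t)"
      using m2_pos by (auto intro!: derivative_eq_intros simp: field_simps)
    from DERIV_add[OF deriv_ln_f this] show ?thesis by (simp add: score)
  qed
  then have const: "ln (f t) + t\<^sup>2 / (2 * m\<^sub>2) = ln (f 0)" for t
    using DERIV_isconst_all[of "\<lambda>t. ln (f t) + t\<^sup>2 / (2 * m\<^sub>2)" t 0] by simp
  have f_eq: "f t = f 0 * exp (- t\<^sup>2 / (2 * m\<^sub>2))" for t
  proof -
    have "f t = exp (ln (f t))" using f_pos by simp
    also have "ln (f t) = ln (f 0) + - t\<^sup>2 / (2 * m\<^sub>2)" using const[of t] by simp
    also have "exp \<dots> = exp (ln (f 0)) * exp (- t\<^sup>2 / (2 * m\<^sub>2))" by (rule exp_add)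
    finally show ?thesis using f_pos by simp
  qed
  \<comment> \<open>The constant ratio of \<open>f\<close> to the normal density of variance
    \<open>m\<^sub>2\<close>; it is 1 because both integrate to 1.\<close>
  define c where "c = f 0 * sqrt (2 * pi * m\<^sub>2)"
  have fc: "f t = c * normal_density 0 (sqrt m\<^sub>2) t" for t
    using m2_pos by (subst f_eq) (simp add: c_def normal_density_def)
  have "1 = (\<integral>t. f t \<partial>lborel)"
    using integral_F[of "\<lambda>_. 1"] F.prob_space by simp
  also have "\<dots> = c" using m2_pos by (simp add: fc)
  finally show ?thesis using fc by simp
qed

lemma normal_imp_info_eq:
  assumes "0 < \<sigma>" and normal: "\<And>t. f t = normal_density 0 \<sigma> t"
  shows "m\<^sub>2 * info = 1"
proof -
  have score: "\<psi>' t = - t / \<sigma>\<^sup>2" for t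
  proof (rule DERIV_unique[OF deriv_ln_f])
    have "(\<lambda>t. ln (f t)) = (\<lambda>t. - t\<^sup>2 / (2 * \<sigma>\<^sup>2) - ln (sqrt (2 * pi * \<sigma>\<^sup>2)))"
      using \<open>0 < \<sigma>\<close> by (auto simp: normal normal_density_def ln_mult ln_div)
    then show "((\<lambda>t. ln (f t)) has_real_derivative - t / \<sigma>\<^sup>2) (at t)"
      using \<open>0 < \<sigma>\<close> by (auto intro!: derivative_eq_intros simp: field_simps)
  qed
  \<comment> \<open>With a linear score the integration by parts identity yields
    \<open>m\<^sub>2 = \<sigma>\<^sup>2\<close> directly.\<close>
  have "- 1 = (\<integral>t. t * \<psi>' t \<partial>F)" by (simp add: integral_id_score)
  also have "\<dots> = (\<integral>t. (- 1 / \<sigma>\<^sup>2) * t\<^sup>2 \<partial>F)"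
    unfolding score by (intro Bochner_Integration.integral_cong) (auto simp: power2_eq_square)
  also have "\<dots> = - m\<^sub>2 / \<sigma>\<^sup>2" by (simp add: m\<^sub>2_def)
  finally have m: "m\<^sub>2 = \<sigma>\<^sup>2" using \<open>0 < \<sigma>\<close> by (simp add: field_simps)
  have "info = (\<integral>t. (1 / (\<sigma>\<^sup>2)\<^sup>2) * t\<^sup>2 \<partial>F)"
    unfolding info_def score by (intro Bochner_Integration.integral_cong) (auto simp: power_divide)
  also have "\<dots> = m\<^sub>2 / (\<sigma>\<^sup>2)\<^sup>2" by (simp add: m\<^sub>2_def)
  finally show ?thesis using m \<open>0 < \<sigma>\<close> by (simp add: power2_eq_square)
qed

text \<open>The quotient is the likelihood ratio of one observation with its covariate held fixed,
  and the substitution \<open>l * e + c\<close> gives it mean 1. The integral is the extended one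
  because integrability of the ratio is deduced from it later.\<close>

lemma nn_integral_affine_ratio:
  assumes "0 < l"
  shows "(\<integral>\<^sup>+ e. ennreal (l * f (l * e + c) / f e) \<partial>F) = 1"
proof -
  have "(\<integral>\<^sup>+ e. ennreal (l * f (l * e + c) / f e) \<partial>F)
      = (\<integral>\<^sup>+ e. ennreal (f e) * ennreal (l * f (l * e + c) / f e) \<partial>lborel)"
    unfolding F_def by (subst nn_integral_density) auto
  also have "\<dots> = (\<integral>\<^sup>+ e. ennreal l * ennreal (f (c + l * e)) \<partial>lborel)"
    using f_pos assms
    by (intro nn_integral_cong) (auto simp: ennreal_mult[symmetric] less_imp_le add.commute less_imp_neq[OF f_pos, symmetric])
  also have "\<dots> = (\<integral>\<^sup>+ e. f e \<partial>lborel)"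
    using nn_integral_real_affine[of f l c] assms by (simp add: nn_integral_cmult)
  finally show ?thesis by (simp add: f_prob)
qed

text \<open>Evaluating at the point sent to 0 and at 0 itself compares with the maximum
  \<open>f 0\<close> and forces \<open>l = 1\<close>. Then \<open>c\<close> is a period of
  \<open>f\<close>, and a nonzero period contradicts the tail bound.\<close>

lemma affine_eq_imp_trivial:
  assumes "0 < l" and eq: "\<And>e. l * f (l * e + c) = f e"
  shows "l = 1 \<and> c = 0"
proof -
  have "l * f 0 = f (- c / l)" using eq[of "- c / l"] assms(1) by simp
  also have "\<dots> \<le> f 0" by (rule f_le_f0)
  finally have "l \<le> 1" using f_pos[of 0] by simp
  moreover have "f 0 \<le> l * f 0"
    using eq[of 0] f_le_f0[of c] assms(1) by (simp flip: eq[of 0])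
  then have "1 \<le> l" using f_pos[of 0] by simp
  ultimately have l: "l = 1" by simp
  then have shift: "f (e + c) = f e" for e using eq[of e] by simp
  have "f (real n * c) = f 0" for n
  proof (induction n)
    case (Suc n)
    then show ?case using shift[of "real n * c"] by (simp add: algebra_simps)
  qed simp
  moreover have "c = 0"
  proof (rule ccontr)
    assume c: "c \<noteq> 0"
    have a: "0 < \<alpha>" by (rule tail_exponent)
    have b: "0 < \<bar>c\<bar>" using c by simp
    have "(\<lambda>n. C * exp (- ((real n * \<bar>c\<bar>) powr \<alpha>))) \<longlonglongrightarrow> 0"
      using a b by real_asymp
    then have "\<forall>\<^sub>F n in sequentially. C * exp (- ((real n * \<bar>c\<bar>) powr \<alpha>)) < f 0"
      using f_pos[of 0] by (intro order_tendstoD(2)) auto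
    then obtain n where "C * exp (- ((real n * \<bar>c\<bar>) powr \<alpha>)) < f 0"
      by (auto simp: eventually_sequentially)
    moreover have "f (real n * c) \<le> C * exp (- ((real n * \<bar>c\<bar>) powr \<alpha>))"
      using f_tail[of "real n * c"] by (simp add: abs_mult)
    ultimately show False using \<open>\<And>n. f (real n * c) = f 0\<close> by (metis not_le)
  qed
  ultimately show ?thesis using l by simp
qed

end

section \<open>Consistency\<close>

lemma (in pair_sigma_finite) integral_prod_mult:
  fixes a :: "'a \<Rightarrow> real" and b :: "'b \<Rightarrow> real"
  assumes a: "integrable M1 a" and b: "integrable M2 b"
  shows "integrable (M1 \<Otimes>\<^sub>M M2) (\<lambda>p. a (fst p) * b (snd p))"
    and "(\<integral>p. a (fst p) * b (snd p) \<partial>(M1 \<Otimes>\<^sub>M M2)) = (\<integral>x. a x \<partial>M1) * (\<integral>y. b y \<partial>M2)"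
proof -
  have [measurable]: "a \<in> borel_measurable M1" "b \<in> borel_measurable M2" using a b by auto
  show int: "integrable (M1 \<Otimes>\<^sub>M M2) (\<lambda>p. a (fst p) * b (snd p))"
  proof (rule Fubini_integrable)
    show "integrable M1 (\<lambda>x. \<integral>y. norm (a (fst (x, y)) * b (snd (x, y))) \<partial>M2)"
      using a by (simp add: abs_mult)
    show "AE x in M1. integrable M2 (\<lambda>y. a (fst (x, y)) * b (snd (x, y)))"
      using b by simp
  qed measurable
  show "(\<integral>p. a (fst p) * b (snd p) \<partial>(M1 \<Otimes>\<^sub>M M2)) = (\<integral>x. a x \<partial>M1) * (\<integral>y. b y \<partial>M2)"
    using integral_fst'[OF int] by simp
qed

lemma ln_eq_minus_one_iff: "0 < x \<Longrightarrow> ln x = x - 1 \<longleftrightarrow> x = 1" for x :: real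
  using ln_eq_minus_one[of x] by auto

section \<open>The law of a single observation\<close>

locale regression = error_density f \<psi>' \<psi>'' K \<alpha> C + iid_sample M Z D
  for f \<psi>' \<psi>'' :: "real \<Rightarrow> real" and K \<alpha> C :: real
    and M :: "'a measure" and Z :: "nat \<Rightarrow> 'a \<Rightarrow> (real ^ 'n) \<times> real"
    and D :: "((real ^ 'n) \<times> real) measure" +
  fixes P\<^sub>X :: "(real ^ 'n) measure" and \<beta>\<^sub>0 :: "real ^ 'n" and s\<^sub>0 :: real and Q :: "real ^ 'n ^ 'n"
  assumes prob_PX: "prob_space P\<^sub>X" and sets_PX [measurable_cong, simp]: "sets P\<^sub>X = sets borel"
    and s0_pos: "0 < s\<^sub>0"
    and D_eq: "D = distr (P\<^sub>X \<Otimes>\<^sub>M F) borel (\<lambda>p. (fst p, \<beta>\<^sub>0 \<bullet> fst p + s\<^sub>0 * snd p))"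
    and int_X_sq: "integrable P\<^sub>X (\<lambda>x. (norm x)\<^sup>2)"
    and Q_def: "Q $ i $ j = (\<integral>x. x $ i * x $ j \<partial>P\<^sub>X)"
    and Q_pos_def: "pos_def_matrix Q"
begin

sublocale PX: prob_space P\<^sub>X by (rule prob_PX)

sublocale XF: pair_prob_space P\<^sub>X F ..

sublocale D: prob_space D by (rule prob_space_D)

abbreviation obs :: "(real ^ 'n) \<times> real \<Rightarrow> (real ^ 'n) \<times> real" where
  "obs p \<equiv> (fst p, \<beta>\<^sub>0 \<bullet> fst p + s\<^sub>0 * snd p)"

lemma obs_measurable [measurable]: "obs \<in> borel_measurable (P\<^sub>X \<Otimes>\<^sub>M F)"
  by measurable

lemma integrable_D_iff: "h \<in> borel_measurable borel \<Longrightarrow>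
    integrable D h \<longleftrightarrow> integrable (P\<^sub>X \<Otimes>\<^sub>M F) (\<lambda>p. h (obs p))" for h :: "_ \<Rightarrow> real"
  unfolding D_eq by (rule integrable_distr_eq) measurable

lemma integral_D: "h \<in> borel_measurable borel \<Longrightarrow>
    (\<integral>z. h z \<partial>D) = (\<integral>p. h (obs p) \<partial>(P\<^sub>X \<Otimes>\<^sub>M F))" for h :: "_ \<Rightarrow> real"
  unfolding D_eq by (rule integral_distr) measurable

lemma int_PX_quadratic_growth:
  fixes h :: "real ^ 'n \<Rightarrow> real"
  assumes [measurable]: "h \<in> borel_measurable borel" and bound: "\<And>x. \<bar>h x\<bar> \<le> A + B * (norm x)\<^sup>2"
  shows "integrable P\<^sub>X h"
proof (rule Bochner_Integration.integrable_bound)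
  show "integrable P\<^sub>X (\<lambda>x. A + B * (norm x)\<^sup>2)" using int_X_sq by simp
  show "AE x in P\<^sub>X. norm (h x) \<le> norm (A + B * (norm x)\<^sup>2)"
  proof (rule AE_I2)
    fix x show "norm (h x) \<le> norm (A + B * (norm x)\<^sup>2)" using bound[of x] by simp
  qed
qed measurable

lemma int_PX_prod: "integrable P\<^sub>X (\<lambda>x. x $ i * x $ j)"
proof (rule int_PX_quadratic_growth)
  show "\<bar>x $ i * x $ j\<bar> \<le> 0 + 1 * (norm x)\<^sup>2" for x :: "real ^ 'n"
    unfolding abs_mult power2_eq_square using component_le_norm_cart[of x]
    by (simp add: mult_mono)
qed measurable

lemma int_PX_component: "integrable P\<^sub>X (\<lambda>x. x $ i)"
  by (rule PX.square_integrable_imp_integrable) (use int_PX_prod[of i i] in \<open>simp_all add: power2_eq_square\<close>)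

lemma inner_PX:
  shows "integrable P\<^sub>X (\<lambda>x. (u \<bullet> x)\<^sup>2)" and "(\<integral>x. (u \<bullet> x)\<^sup>2 \<partial>P\<^sub>X) = u \<bullet> (Q *v u)"
    and "integrable P\<^sub>X (\<lambda>x. u \<bullet> x)"
proof -
  have expand: "(u \<bullet> x)\<^sup>2 = (\<Sum>i\<in>UNIV. \<Sum>j\<in>UNIV. u $ i * u $ j * (x $ i * x $ j))" for x
    by (simp add: power2_eq_square inner_vec_def sum_product mult_ac)
  show "integrable P\<^sub>X (\<lambda>x. (u \<bullet> x)\<^sup>2)" unfolding expand using int_PX_prod by simp
  show "(\<integral>x. (u \<bullet> x)\<^sup>2 \<partial>P\<^sub>X) = u \<bullet> (Q *v u)"
    unfolding expand quadratic_form_eq_sum Q_def using int_PX_prod by simp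
  show "integrable P\<^sub>X (\<lambda>x. u \<bullet> x)" unfolding inner_vec_def using int_PX_component by simp
qed

lemma AE_PX_inner_eq_0_imp:
  assumes "AE x in P\<^sub>X. u \<bullet> x = 0"
  shows "u = 0"
proof (rule ccontr)
  assume "u \<noteq> 0"
  then have "0 < (\<integral>x. (u \<bullet> x)\<^sup>2 \<partial>P\<^sub>X)"
    using Q_pos_def unfolding inner_PX(2) by (simp add: pos_def_matrix_def)
  moreover have "(\<integral>x. (u \<bullet> x)\<^sup>2 \<partial>P\<^sub>X) = (\<integral>x. 0 \<partial>P\<^sub>X)"
    using assms by (intro integral_cong_AE) auto
  ultimately show False by simp
qed

lemma int_obs_sq: "integrable D (\<lambda>z. (norm z)\<^sup>2)"
proof -
  have eq: "(norm (obs p))\<^sup>2 = (norm (fst p))\<^sup>2 * 1 + (\<beta>\<^sub>0 \<bullet> fst p)\<^sup>2 * 1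
      + 2 * s\<^sub>0 * ((\<beta>\<^sub>0 \<bullet> fst p) * snd p) + s\<^sub>0\<^sup>2 * (1 * (snd p)\<^sup>2)" for p
  proof -
    have "(norm (obs p))\<^sup>2 = (norm (fst p))\<^sup>2 + (\<beta>\<^sub>0 \<bullet> fst p + s\<^sub>0 * snd p)\<^sup>2"
      by (simp add: norm_Pair)
    then show ?thesis by (simp add: power2_sum power_mult_distrib)
  qed
  note prod = XF.integral_prod_mult(1)
  have "integrable (P\<^sub>X \<Otimes>\<^sub>M F) (\<lambda>p. (norm (obs p))\<^sup>2)"
    unfolding eq
    using prod[OF int_X_sq, of "\<lambda>_. 1"] prod[OF inner_PX(1)[of \<beta>\<^sub>0], of "\<lambda>_. 1"]
      prod[OF inner_PX(3)[of \<beta>\<^sub>0] int_F_id] prod[OF _ int_F_sq, of "\<lambda>_. 1"]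
    by simp
  then show ?thesis by (subst integrable_D_iff) simp_all
qed

lemma int_D_quadratic_growth:
  fixes h :: "(real ^ 'n) \<times> real \<Rightarrow> real"
  assumes [measurable]: "h \<in> borel_measurable borel" and bound: "\<And>z. \<bar>h z\<bar> \<le> A + B * (norm z)\<^sup>2"
  shows "integrable D h"
proof (rule Bochner_Integration.integrable_bound)
  show "integrable D (\<lambda>z. A + B * (norm z)\<^sup>2)" using int_obs_sq by simp
  show "AE z in D. norm (h z) \<le> norm (A + B * (norm z)\<^sup>2)"
  proof (rule AE_I2)
    fix z show "norm (h z) \<le> norm (A + B * (norm z)\<^sup>2)" using bound[of z] by simp
  qed
qed measurable

text \<open>With \<open>\<theta> = (- \<beta> / s, 1 / s)\<close> the standardised residual is the inner product \<open>\<theta> \<bullet> z\<close>.\<close>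

definition theta :: "real ^ 'n \<Rightarrow> real \<Rightarrow> (real ^ 'n) \<times> real" where
  "theta \<beta> s = (- (1 / s) *\<^sub>R \<beta>, 1 / s)"

abbreviation "\<theta>\<^sub>0 \<equiv> theta \<beta>\<^sub>0 s\<^sub>0"

lemma inner_theta: "theta \<beta> s \<bullet> z = (snd z - \<beta> \<bullet> fst z) / s"
  by (cases z) (simp add: theta_def diff_divide_distrib)

lemma inner_theta0_obs: "\<theta>\<^sub>0 \<bullet> obs p = snd p"
  using s0_pos by (simp add: inner_theta)

definition loglik1 :: "(real ^ 'n) \<times> real \<Rightarrow> (real ^ 'n) \<times> real \<Rightarrow> real" where
  "loglik1 \<theta> z = ln (snd \<theta>) + ln (f (\<theta> \<bullet> z))"

lemma loglik1_measurable [measurable]: "loglik1 \<theta> \<in> borel_measurable borel"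
  unfolding loglik1_def by measurable

lemma ln_f_growth: "\<bar>ln (f t)\<bar> \<le> \<bar>ln (f 0)\<bar> + K * t\<^sup>2"
  using ln_f_lipschitz[of t "\<bar>t\<bar>" 0] by (simp add: power2_eq_square mult.assoc)

lemma loglik1_growth: "\<bar>loglik1 \<theta> z\<bar> \<le> (\<bar>ln (snd \<theta>)\<bar> + \<bar>ln (f 0)\<bar>) + K * (norm \<theta>)\<^sup>2 * (norm z)\<^sup>2"
proof -
  have "(\<theta> \<bullet> z)\<^sup>2 \<le> (norm \<theta>)\<^sup>2 * (norm z)\<^sup>2"
    using Cauchy_Schwarz_ineq[of \<theta> z] by (simp add: power2_norm_eq_inner)
  then have "K * (\<theta> \<bullet> z)\<^sup>2 \<le> K * (norm \<theta>)\<^sup>2 * (norm z)\<^sup>2"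
    using K_nonneg by (simp add: mult.assoc mult_left_mono)
  then show ?thesis using ln_f_growth[of "\<theta> \<bullet> z"] unfolding loglik1_def by linarith
qed

lemma int_loglik1: "integrable D (loglik1 \<theta>)"
  by (rule int_D_quadratic_growth[OF loglik1_measurable loglik1_growth])

text \<open>Gibbs' inequality for the likelihood ratio \<open>r\<close> of mean 1: without a
  positive gap, the nonnegative \<open>r p - 1 - ln (r p)\<close> would have mean 0, so
  \<open>r\<close> would be 1 almost everywhere. Continuity turns this into an identity for all
  errors, and \<open>affine_eq_imp_trivial\<close> applies at almost every covariate.\<close>

lemma loglik1_identifies:
  assumes w: "0 < snd \<theta>" and ne: "\<theta> \<noteq> \<theta>\<^sub>0"
  shows "0 < (\<integral>z. loglik1 \<theta>\<^sub>0 z - loglik1 \<theta> z \<partial>D)"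
proof (rule ccontr)
  assume neg: "\<not> 0 < (\<integral>z. loglik1 \<theta>\<^sub>0 z - loglik1 \<theta> z \<partial>D)"
  \<comment> \<open>Coordinates relative to the truth: under \<theta> an observation with error
    \<open>e\<close> and covariate \<open>x\<close> has residual
    \<open>l * e + u \<bullet> x\<close>, and \<theta> is the true parameter exactly if
    \<open>l = 1\<close> and \<open>u = 0\<close>.\<close>
  define l where "l = snd \<theta> * s\<^sub>0"
  define u where "u = fst \<theta> + snd \<theta> *\<^sub>R \<beta>\<^sub>0"
  have l: "0 < l" using w s0_pos by (simp add: l_def)
  define r where "r p = l * f (l * snd p + u \<bullet> fst p) / f (snd p)" for p
  have r_pos: "0 < r p" for p using l f_pos by (simp add: r_def)
  have [measurable]: "r \<in> borel_measurable (P\<^sub>X \<Otimes>\<^sub>M F)" unfolding r_def by measurable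
  have inner: "\<theta> \<bullet> obs p = l * snd p + u \<bullet> fst p" for p
    by (cases \<theta>) (simp add: l_def u_def inner_add_left algebra_simps)
  have ln_r: "ln (r p) = loglik1 \<theta> (obs p) - loglik1 \<theta>\<^sub>0 (obs p)" for p
    unfolding loglik1_def inner inner_theta0_obs r_def l_def
    using w s0_pos f_pos
    by (simp add: ln_mult ln_div theta_def less_imp_neq[OF f_pos, symmetric])
  let ?P = "P\<^sub>X \<Otimes>\<^sub>M F"
  have nn_r: "(\<integral>\<^sup>+p. ennreal (r p) \<partial>?P) = 1"
  proof -
    have "(\<integral>\<^sup>+p. ennreal (r p) \<partial>?P) = (\<integral>\<^sup>+x. \<integral>\<^sup>+e. ennreal (r (x, e)) \<partial>F \<partial>P\<^sub>X)"
      by (subst F.nn_integral_fst[symmetric]) auto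
    also have "\<dots> = (\<integral>\<^sup>+x. 1 \<partial>P\<^sub>X)"
      unfolding r_def by (simp add: nn_integral_affine_ratio[OF l])
    finally show ?thesis by (simp add: PX.emeasure_space_1)
  qed
  have int_r: "integrable ?P r"
    using r_pos nn_r by (intro integrableI_nonneg) (auto simp: less_imp_le)
  have int_r1: "(\<integral>p. r p \<partial>?P) = 1"
    using r_pos by (subst integral_eq_nn_integral) (auto simp: less_imp_le nn_r)
  have int_ln: "integrable ?P (\<lambda>p. ln (r p))"
    unfolding ln_r using int_loglik1[of \<theta>] int_loglik1[of \<theta>\<^sub>0]
    by (auto simp: integrable_D_iff[OF loglik1_measurable])
  have "(\<integral>z. loglik1 \<theta>\<^sub>0 z - loglik1 \<theta> z \<partial>D) = - (\<integral>p. ln (r p) \<partial>?P)"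
    unfolding ln_r by (subst integral_D) (auto simp flip: Bochner_Integration.integral_minus)
  then have "0 \<le> (\<integral>p. ln (r p) \<partial>?P)" using neg by simp
  have int_gap: "integrable ?P (\<lambda>p. r p - 1 - ln (r p))" using int_r int_ln by simp
  have gap_nonneg: "0 \<le> r p - 1 - ln (r p)" for p using ln_le_minus_one[OF r_pos[of p]] by simp
  have "(\<integral>p. r p - 1 - ln (r p) \<partial>?P) = - (\<integral>p. ln (r p) \<partial>?P)"
    using int_r int_ln int_r1 XF.prob_space by simp
  moreover have "0 \<le> (\<integral>p. r p - 1 - ln (r p) \<partial>?P)" using gap_nonneg by simp
  ultimately have "(\<integral>p. r p - 1 - ln (r p) \<partial>?P) = 0"
    using \<open>0 \<le> (\<integral>p. ln (r p) \<partial>?P)\<close> by linarith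
  then have "AE p in ?P. r p - 1 - ln (r p) = 0"
    using integral_nonneg_eq_0_iff_AE[OF int_gap] gap_nonneg by simp
  then have "AE p in ?P. l * f (l * snd p + u \<bullet> fst p) = f (snd p)"
  proof eventually_elim
    case (elim p)
    then have "r p = 1" using ln_eq_minus_one_iff[OF r_pos[of p]] by simp
    then show ?case using f_pos[of "snd p"] by (simp add: r_def)
  qed
  then have "AE x in P\<^sub>X. AE e in F. l * f (l * snd (x, e) + u \<bullet> fst (x, e)) = f (snd (x, e))"
    by (rule XF.AE_pair)
  then have triv: "AE x in P\<^sub>X. l = 1 \<and> u \<bullet> x = 0"
  proof eventually_elim
    case (elim x)
    then have "AE e in lborel. l * f (l * e + u \<bullet> x) - f e = 0" by (simp add: AE_F_iff)
    moreover have "continuous_on UNIV (\<lambda>e. l * f (l * e + u \<bullet> x) - f e)"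
      by (intro continuous_at_imp_continuous_on ballI continuous_intros isCont_f isCont_o2[OF _ isCont_f])
    ultimately have "l * f (l * e + u \<bullet> x) - f e = 0" for e
      by (rule continuous_AE_eq_0_imp_eq_0[rotated])
    then show ?case by (intro affine_eq_imp_trivial[OF l]) simp
  qed
  then have "AE x in P\<^sub>X. u \<bullet> x = 0" by eventually_elim simp
  then have "u = 0" by (rule AE_PX_inner_eq_0_imp)
  moreover have "l = 1"
  proof -
    have "AE x in P\<^sub>X. l = 1" using triv by eventually_elim simp
    then show ?thesis using PX.AE_const by simp
  qed
  ultimately have "snd \<theta> = 1 / s\<^sub>0" "fst \<theta> = - (1 / s\<^sub>0) *\<^sub>R \<beta>\<^sub>0"
    using s0_pos by (auto simp: l_def u_def field_simps add_eq_0_iff2)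
  then have "\<theta> = \<theta>\<^sub>0" by (simp add: theta_def prod_eq_iff)
  with ne show False ..
qed

text \<open>No direction degenerates: the covariate part and the error part are orthogonal because
  the error is independent with mean 0, and \<open>v \<noteq> 0\<close> leaves one of them
  nonzero.\<close>

lemma inner_obs_second_moment_pos:
  assumes "v \<noteq> 0"
  shows "0 < (\<integral>z. (v \<bullet> z)\<^sup>2 \<partial>D)"
proof -
  define u where "u = fst v + snd v *\<^sub>R \<beta>\<^sub>0"
  define b where "b = snd v * s\<^sub>0"
  have inner: "v \<bullet> obs p = u \<bullet> fst p + b * snd p" for p
    by (cases v) (simp add: u_def b_def inner_add_left algebra_simps)
  have eq: "(v \<bullet> obs p)\<^sup>2 = (u \<bullet> fst p)\<^sup>2 * 1 + 2 * b * ((u \<bullet> fst p) * snd p) + b\<^sup>2 * (1 * (snd p)\<^sup>2)" for p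
    unfolding inner by (simp add: power2_sum power_mult_distrib algebra_simps)
  note prod = XF.integral_prod_mult
  have one: "integrable F (\<lambda>_. 1::real)" "integrable P\<^sub>X (\<lambda>_. 1::real)" by simp_all
  have "(\<integral>z. (v \<bullet> z)\<^sup>2 \<partial>D) = (\<integral>p. (v \<bullet> obs p)\<^sup>2 \<partial>(P\<^sub>X \<Otimes>\<^sub>M F))"
    by (rule integral_D) measurable
  also have "\<dots> = u \<bullet> (Q *v u) + 2 * b * 0 + b\<^sup>2 * m\<^sub>2"
    unfolding eq
    using prod[OF inner_PX(1)[of u] one(1)] prod[OF inner_PX(3)[of u] int_F_id] prod[OF one(2) int_F_sq]
    by (simp add: inner_PX(2) F.prob_space[unfolded space_F] PX.prob_space integral_F_odd[of "\<lambda>e. e"] m\<^sub>2_def)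
  finally have E: "(\<integral>z. (v \<bullet> z)\<^sup>2 \<partial>D) = u \<bullet> (Q *v u) + b\<^sup>2 * m\<^sub>2" by simp
  show ?thesis
  proof (cases "u = 0")
    case True
    then have "snd v \<noteq> 0" using assms by (auto simp: u_def prod_eq_iff)
    then have "0 < b\<^sup>2 * m\<^sub>2" using s0_pos m2_pos by (simp add: b_def)
    then show ?thesis using True E by simp
  next
    case False
    then have "0 < u \<bullet> (Q *v u)" using Q_pos_def by (simp add: pos_def_matrix_def)
    moreover have "0 \<le> b\<^sup>2 * m\<^sub>2" using m2_pos by simp
    ultimately show ?thesis using E by linarith
  qed
qed

lemma truncated_inner_pos:
  assumes "v \<noteq> 0"
  shows "0 < (\<integral>z. min 1 \<bar>v \<bullet> z\<bar> \<partial>D)"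
proof (rule ccontr)
  assume neg: "\<not> 0 < (\<integral>z. min 1 \<bar>v \<bullet> z\<bar> \<partial>D)"
  have int: "integrable D (\<lambda>z. min 1 \<bar>v \<bullet> z\<bar>)"
    by (intro D.integrable_const_bound[of _ 1]) auto
  have "0 \<le> (\<integral>z. min 1 \<bar>v \<bullet> z\<bar> \<partial>D)" by simp
  with neg have "(\<integral>z. min 1 \<bar>v \<bullet> z\<bar> \<partial>D) = 0" by linarith
  then have "AE z in D. min 1 \<bar>v \<bullet> z\<bar> = 0"
    using integral_nonneg_eq_0_iff_AE[OF int] by simp
  then have "AE z in D. (v \<bullet> z)\<^sup>2 = 0" by eventually_elim (auto simp: min_def split: if_splits)
  then have "(\<integral>z. (v \<bullet> z)\<^sup>2 \<partial>D) = (\<integral>z. 0 \<partial>D)" by (intro integral_cong_AE) auto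
  with inner_obs_second_moment_pos[OF assms] show False by simp
qed

lemma C_pos: "0 < C"
  using f_tail[of 0] f_pos[of 0] by (smt (verit) exp_gt_zero mult_nonneg_nonneg zero_less_mult_iff)

text \<open>With \<open>v\<close> the direction of \<theta>, the tail bound gives a penalty
  \<open>norm \<theta> powr \<alpha> * \<bar>v \<bullet> z\<bar> powr \<alpha>\<close>. The power
  need not be Lipschitz in \<open>v\<close>, so it is bounded below by
  \<open>b powr \<alpha> * (min 1 \<bar>v \<bullet> z\<bar> - b)\<close>, affine in a truncated
  product whose average is bounded below uniformly on the sphere.\<close>

lemma loglik_coercive:
  "\<exists>\<kappa>>0. \<forall>\<^sub>F x in whp M. \<forall>\<theta>. \<theta> \<noteq> 0 \<longrightarrow>
     avg (loglik1 \<theta>) (fst x) (snd x) \<le> ln (snd \<theta>) + ln C - \<kappa> * norm \<theta> powr \<alpha>"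
proof -
  have lip: "\<bar>min 1 \<bar>v \<bullet> z\<bar> - min 1 \<bar>v' \<bullet> z\<bar>\<bar> \<le> dist v v' * norm z" for v v' z :: "(real ^ 'n) \<times> real"
  proof -
    have "\<bar>v \<bullet> z - v' \<bullet> z\<bar> \<le> dist v v' * norm z"
      unfolding dist_norm inner_diff_left[symmetric] by (rule Cauchy_Schwarz_ineq2)
    then show ?thesis by linarith
  qed
  have ne: "sphere 0 1 \<noteq> ({} :: ((real ^ 'n) \<times> real) set)" by simp
  have "\<exists>c>0. \<forall>\<^sub>F x in whp M. \<forall>v\<in>sphere 0 1. c < avg (\<lambda>z. min 1 \<bar>v \<bullet> z\<bar>) (fst x) (snd x)"
  proof (rule uniform_avg_pos[where L=norm])
    show "integrable D (\<lambda>z. min 1 \<bar>v \<bullet> z\<bar>)" for v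
      by (intro D.integrable_const_bound[of _ 1]) auto
    show "integrable D norm"
      by (rule D.square_integrable_imp_integrable[OF _ int_obs_sq]) simp
    show "0 < (\<integral>z. min 1 \<bar>v \<bullet> z\<bar> \<partial>D)" if "v \<in> sphere 0 1" for v
      using that by (intro truncated_inner_pos) auto
  qed (use lip ne in simp_all)
  then obtain c where c: "c > 0"
    and ev: "\<forall>\<^sub>F x in whp M. \<forall>v\<in>sphere 0 1. c < avg (\<lambda>z. min 1 \<bar>v \<bullet> z\<bar>) (fst x) (snd x)" by blast
  \<comment> \<open>A positive threshold below \<open>c\<close>, so that the rate
    \<open>c - b\<close> stays positive.\<close>
  define b where "b = min 1 (c / 2)"
  have b: "0 < b" "b \<le> 1" "b \<le> c / 2" using c by (auto simp: b_def)
  define \<kappa> where "\<kappa> = b powr \<alpha> * (c - b)"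
  have \<kappa>: "\<kappa> > 0" using b c by (simp add: \<kappa>_def)
  have pos_n: "\<forall>\<^sub>F x in whp M. 0 < fst x"
    using filterlim_fst_whp eventually_gt_at_top[of 0] by (auto simp: filterlim_iff)
  have "\<forall>\<^sub>F x in whp M. \<forall>\<theta>. \<theta> \<noteq> 0 \<longrightarrow>
     avg (loglik1 \<theta>) (fst x) (snd x) \<le> ln (snd \<theta>) + ln C - \<kappa> * norm \<theta> powr \<alpha>"
    using ev pos_n
  proof eventually_elim
    case (elim x)
    show ?case
    proof (intro allI impI)
      fix \<theta> :: "(real ^ 'n) \<times> real" assume \<theta>: "\<theta> \<noteq> 0"
      define v where "v = (1 / norm \<theta>) *\<^sub>R \<theta>"
      have v: "v \<in> sphere 0 1" and \<theta>v: "\<theta> = norm \<theta> *\<^sub>R v" using \<theta> by (auto simp: v_def)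
      have pt: "loglik1 \<theta> z \<le> (ln (snd \<theta>) + ln C) + (norm \<theta> powr \<alpha> * b powr \<alpha>) * (b - min 1 \<bar>v \<bullet> z\<bar>)" for z
      proof -
        have "f (\<theta> \<bullet> z) \<le> C * exp (- (\<bar>\<theta> \<bullet> z\<bar> powr \<alpha>))" by (rule f_tail)
        then have "ln (f (\<theta> \<bullet> z)) \<le> ln (C * exp (- (\<bar>\<theta> \<bullet> z\<bar> powr \<alpha>)))"
          using f_pos C_pos by (simp add: ln_le_cancel_iff)
        also have "\<dots> = ln C - \<bar>\<theta> \<bullet> z\<bar> powr \<alpha>" using C_pos by (simp add: ln_mult)
        also have "\<bar>\<theta> \<bullet> z\<bar> powr \<alpha> = norm \<theta> powr \<alpha> * \<bar>v \<bullet> z\<bar> powr \<alpha>"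
          by (subst \<theta>v) (simp add: abs_mult powr_mult)
        also have "ln C - norm \<theta> powr \<alpha> * \<bar>v \<bullet> z\<bar> powr \<alpha> \<le> ln C + norm \<theta> powr \<alpha> * (b powr \<alpha> * (b - min 1 \<bar>v \<bullet> z\<bar>))"
        proof -
          have "- (\<bar>v \<bullet> z\<bar> powr \<alpha>) \<le> b powr \<alpha> * (b - min 1 \<bar>v \<bullet> z\<bar>)"
          proof (cases "b \<le> \<bar>v \<bullet> z\<bar>")
            case True
            then have "b powr \<alpha> \<le> \<bar>v \<bullet> z\<bar> powr \<alpha>"
              using b tail_exponent by (intro powr_mono2) auto
            moreover have "b powr \<alpha> * (- 1) \<le> b powr \<alpha> * (b - min 1 \<bar>v \<bullet> z\<bar>)"
              using b by (intro mult_left_mono) auto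
            ultimately show ?thesis by linarith
          next
            case False
            then have "0 \<le> b powr \<alpha> * (b - min 1 \<bar>v \<bullet> z\<bar>)" by (intro mult_nonneg_nonneg) auto
            moreover have "0 \<le> \<bar>v \<bullet> z\<bar> powr \<alpha>" by simp
            ultimately show ?thesis by linarith
          qed
          then have "norm \<theta> powr \<alpha> * - (\<bar>v \<bullet> z\<bar> powr \<alpha>) \<le> norm \<theta> powr \<alpha> * (b powr \<alpha> * (b - min 1 \<bar>v \<bullet> z\<bar>))"
            by (intro mult_left_mono) auto
          then show ?thesis by simp
        qed
        finally show ?thesis by (simp add: loglik1_def mult.assoc)
      qed
      let ?n = "fst x" and ?\<omega> = "snd x"
      have "avg (loglik1 \<theta>) ?n ?\<omega> \<le>
          avg (\<lambda>z. (ln (snd \<theta>) + ln C) + (norm \<theta> powr \<alpha> * b powr \<alpha>) * (b - min 1 \<bar>v \<bullet> z\<bar>)) ?n ?\<omega>"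
        by (rule avg_mono) (rule pt)
      also have "\<dots> = (ln (snd \<theta>) + ln C) + (norm \<theta> powr \<alpha> * b powr \<alpha>) * (b - avg (\<lambda>z. min 1 \<bar>v \<bullet> z\<bar>) ?n ?\<omega>)"
        using elim by (simp add: avg_add avg_cmult avg_diff avg_const)
      also have "\<dots> \<le> (ln (snd \<theta>) + ln C) + (norm \<theta> powr \<alpha> * b powr \<alpha>) * (b - c)"
        using elim v by (intro add_left_mono mult_left_mono) (auto intro: less_imp_le)
      finally show "avg (loglik1 \<theta>) ?n ?\<omega> \<le> ln (snd \<theta>) + ln C - \<kappa> * norm \<theta> powr \<alpha>"
        by (simp add: \<kappa>_def algebra_simps)
    qed
  qed
  with \<kappa> show ?thesis by blast
qed

text \<open>Speaks of every \<theta> that does at least as well as the truth. The power beats the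
  logarithm and so bounds the norm; the logarithm in turn keeps the inverse scale
  \<open>snd \<theta>\<close> away from 0.\<close>

lemma maximisers_in_compact:
  "\<exists>R a. 0 < a \<and> (\<forall>\<^sub>F x in whp M. \<forall>\<theta>. 0 < snd \<theta> \<longrightarrow>
     avg (loglik1 \<theta>\<^sub>0) (fst x) (snd x) \<le> avg (loglik1 \<theta>) (fst x) (snd x) \<longrightarrow> norm \<theta> \<le> R \<and> a \<le> snd \<theta>)"
proof -
  obtain \<kappa> where \<kappa>: "\<kappa> > 0" and co: "\<forall>\<^sub>F x in whp M. \<forall>\<theta>. \<theta> \<noteq> 0 \<longrightarrow>
     avg (loglik1 \<theta>) (fst x) (snd x) \<le> ln (snd \<theta>) + ln C - \<kappa> * norm \<theta> powr \<alpha>"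
    using loglik_coercive by blast
  \<comment> \<open>The mean at the truth less a margin of 1; \<open>ln C\<close> is moved over from
    the coercivity bound.\<close>
  define H where "H = (\<integral>z. loglik1 \<theta>\<^sub>0 z \<partial>D) - 1 - ln C"
  have lim: "\<forall>\<^sub>F x in whp M. H + ln C < avg (loglik1 \<theta>\<^sub>0) (fst x) (snd x)"
    by (rule order_tendstoD(1)[OF weak_law[OF int_loglik1]]) (simp add: H_def)
  have a: "0 < \<alpha>" by (rule tail_exponent)
  have "filterlim (\<lambda>t::real. ln t - \<kappa> * t powr \<alpha>) at_bot at_top"
    using \<kappa> a by real_asymp
  then have "\<forall>\<^sub>F t in at_top. ln t - \<kappa> * t powr \<alpha> < H"
    by (simp add: filterlim_at_bot_dense)
  then obtain R where R: "\<And>t. t \<ge> R \<Longrightarrow> ln t - \<kappa> * t powr \<alpha> < H"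
    by (auto simp: eventually_at_top_linorder)
  have "\<forall>\<^sub>F x in whp M. \<forall>\<theta>. 0 < snd \<theta> \<longrightarrow>
     avg (loglik1 \<theta>\<^sub>0) (fst x) (snd x) \<le> avg (loglik1 \<theta>) (fst x) (snd x) \<longrightarrow> norm \<theta> \<le> R \<and> exp H \<le> snd \<theta>"
    using co lim
  proof eventually_elim
    case (elim x)
    show ?case
    proof (intro allI impI)
      fix \<theta> :: "(real ^ 'n) \<times> real"
      assume w: "0 < snd \<theta>" and le: "avg (loglik1 \<theta>\<^sub>0) (fst x) (snd x) \<le> avg (loglik1 \<theta>) (fst x) (snd x)"
      have "\<theta> \<noteq> 0" using w by auto
      then have "avg (loglik1 \<theta>) (fst x) (snd x) \<le> ln (snd \<theta>) + ln C - \<kappa> * norm \<theta> powr \<alpha>"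
        using elim(1) by blast
      then have 1: "H < ln (snd \<theta>) - \<kappa> * norm \<theta> powr \<alpha>" using elim(2) le by linarith
      have "snd \<theta> \<le> norm \<theta>" using norm_snd_le[of "snd \<theta>" "fst \<theta>"] w by simp
      then have "ln (snd \<theta>) \<le> ln (norm \<theta>)" using w \<open>\<theta> \<noteq> 0\<close> by (subst ln_le_cancel_iff) auto
      with 1 have "H < ln (norm \<theta>) - \<kappa> * norm \<theta> powr \<alpha>" by linarith
      then have "norm \<theta> \<le> R" using R[of "norm \<theta>"] by linarith
      moreover have "0 \<le> \<kappa> * norm \<theta> powr \<alpha>" using \<kappa> by simp
      then have "H \<le> ln (snd \<theta>)" using 1 by linarith
      then have "exp H \<le> snd \<theta>" using w by (metis exp_le_cancel_iff exp_ln)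
      ultimately show "norm \<theta> \<le> R \<and> exp H \<le> snd \<theta>" ..
    qed
  qed
  then show ?thesis by (intro exI[of _ R] exI[of _ "exp H"]) simp
qed

text \<open>On the compact region left by \<open>maximisers_in_compact\<close>, with a ball around
  the truth removed, the expected loss is positive, and compactness makes the average loss positive
  for all parameters at once. Hence any choice of maximisers is covered.\<close>

theorem maximisers_consistent:
  assumes "0 < e"
  shows "\<forall>\<^sub>F x in whp M. \<forall>\<theta>. 0 < snd \<theta> \<longrightarrow>
    avg (loglik1 \<theta>\<^sub>0) (fst x) (snd x) \<le> avg (loglik1 \<theta>) (fst x) (snd x) \<longrightarrow> dist \<theta> \<theta>\<^sub>0 < e"
proof -
  obtain R a where a: "0 < a" and ev: "\<forall>\<^sub>F x in whp M. \<forall>\<theta>. 0 < snd \<theta> \<longrightarrow>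
     avg (loglik1 \<theta>\<^sub>0) (fst x) (snd x) \<le> avg (loglik1 \<theta>) (fst x) (snd x) \<longrightarrow> norm \<theta> \<le> R \<and> a \<le> snd \<theta>"
    using maximisers_in_compact by blast
  define T where "T = cball 0 R \<inter> {\<theta>. a \<le> snd \<theta>} \<inter> {\<theta>. e \<le> dist \<theta> \<theta>\<^sub>0}"
  have T: "compact T"
    unfolding T_def by (intro compact_Int_closed compact_cball closed_Collect_le continuous_intros)
  have "\<forall>\<^sub>F x in whp M. \<forall>\<theta>\<in>T. 0 < avg (\<lambda>z. loglik1 \<theta>\<^sub>0 z - loglik1 \<theta> z) (fst x) (snd x)"
  proof (cases "T = {}")
    case False
    have R: "0 \<le> R" using False norm_ge_zero order_trans unfolding T_def by fastforce
    \<comment> \<open>\<open>1 / a\<close> is a Lipschitz constant of \<open>ln\<close> on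
      \<open>{a..}\<close>; the other term is one for \<open>ln (f (\<theta> \<bullet> z))\<close>
      in \<theta> on the ball of radius \<open>R\<close>.\<close>
    define L where "L z = 1 / a + K * R * (norm z)\<^sup>2" for z :: "(real ^ 'n) \<times> real"
    have lip: "\<bar>(loglik1 \<theta>\<^sub>0 z - loglik1 \<theta> z) - (loglik1 \<theta>\<^sub>0 z - loglik1 \<theta>' z)\<bar> \<le> dist \<theta> \<theta>' * L z"
      if "\<theta> \<in> T" "\<theta>' \<in> T" for \<theta> \<theta>' z
    proof -
      have n: "norm \<theta> \<le> R" "norm \<theta>' \<le> R" "a \<le> snd \<theta>" "a \<le> snd \<theta>'"
        using that by (auto simp: T_def)
      have "norm (ln (snd \<theta>) - ln (snd \<theta>')) \<le> 1 / a * norm (snd \<theta> - snd \<theta>')"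
      proof (rule field_differentiable_bound[of "{a..}" ln "\<lambda>t. 1 / t"])
        fix t assume "t \<in> {a..}"
        then have t: "a \<le> t" "0 < t" using a by auto
        show "(ln has_real_derivative 1 / t) (at t within {a..})"
          by (rule has_field_derivative_at_within[OF DERIV_ln_divide[OF t(2)]])
        show "norm (1 / t) \<le> 1 / a" using t a by (simp add: frac_le)
      qed (use n in auto)
      moreover have "norm (snd (\<theta> - \<theta>')) \<le> norm (\<theta> - \<theta>')"
        using norm_snd_le[of "snd (\<theta> - \<theta>')" "fst (\<theta> - \<theta>')"] by (simp only: prod.collapse)
      then have "norm (snd \<theta> - snd \<theta>') \<le> dist \<theta> \<theta>'" by (simp only: dist_norm snd_diff)
      then have "1 / a * norm (snd \<theta> - snd \<theta>') \<le> 1 / a * dist \<theta> \<theta>'"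
        using a by (intro mult_left_mono) auto
      ultimately have 1: "\<bar>ln (snd \<theta>) - ln (snd \<theta>')\<bar> \<le> 1 / a * dist \<theta> \<theta>'"
        by simp
      have bound: "\<bar>t \<bullet> z\<bar> \<le> R * norm z" if "norm t \<le> R" for t :: "(real ^ 'n) \<times> real"
        using Cauchy_Schwarz_ineq2[of t z] mult_right_mono[OF that, of "norm z"] by simp
      have "\<bar>ln (f (\<theta> \<bullet> z)) - ln (f (\<theta>' \<bullet> z))\<bar> \<le> K * (R * norm z) * \<bar>\<theta> \<bullet> z - \<theta>' \<bullet> z\<bar>"
        by (intro ln_f_lipschitz bound n)
      also have "\<dots> \<le> K * (R * norm z) * (dist \<theta> \<theta>' * norm z)"
      proof (rule mult_left_mono)
        show "\<bar>\<theta> \<bullet> z - \<theta>' \<bullet> z\<bar> \<le> dist \<theta> \<theta>' * norm z"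
          unfolding dist_norm inner_diff_left[symmetric] by (rule Cauchy_Schwarz_ineq2)
      qed (use K_nonneg R in simp)
      also have "\<dots> = dist \<theta> \<theta>' * (K * R * (norm z)\<^sup>2)" by (simp add: power2_eq_square)
      finally have 2: "\<bar>ln (f (\<theta> \<bullet> z)) - ln (f (\<theta>' \<bullet> z))\<bar> \<le> dist \<theta> \<theta>' * (K * R * (norm z)\<^sup>2)" .
      have "dist \<theta> \<theta>' * L z = 1 / a * dist \<theta> \<theta>' + dist \<theta> \<theta>' * (K * R * (norm z)\<^sup>2)"
        by (simp add: L_def algebra_simps)
      then show ?thesis using 1 2 unfolding loglik1_def by linarith
    qed
    have "\<exists>c>0. \<forall>\<^sub>F x in whp M. \<forall>\<theta>\<in>T. c < avg (\<lambda>z. loglik1 \<theta>\<^sub>0 z - loglik1 \<theta> z) (fst x) (snd x)"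
    proof (rule uniform_avg_pos[OF T False])
      show "integrable D (\<lambda>z. loglik1 \<theta>\<^sub>0 z - loglik1 \<theta> z)" for \<theta> using int_loglik1 by simp
      show "integrable D L" unfolding L_def using int_obs_sq by simp
      show "0 \<le> L z" for z using a K_nonneg R by (simp add: L_def)
      show "0 < (\<integral>z. loglik1 \<theta>\<^sub>0 z - loglik1 \<theta> z \<partial>D)" if "\<theta> \<in> T" for \<theta>
        using that a \<open>0 < e\<close> by (intro loglik1_identifies) (auto simp: T_def)
    qed (rule lip)
    then obtain c where "c > 0"
      "\<forall>\<^sub>F x in whp M. \<forall>\<theta>\<in>T. c < avg (\<lambda>z. loglik1 \<theta>\<^sub>0 z - loglik1 \<theta> z) (fst x) (snd x)" by blast
    then show ?thesis by (auto elim!: eventually_mono intro: less_trans)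
  qed simp
  with ev show ?thesis
  proof eventually_elim
    case (elim x)
    show ?case
    proof (intro allI impI)
      fix \<theta> :: "(real ^ 'n) \<times> real"
      assume w: "0 < snd \<theta>" and le: "avg (loglik1 \<theta>\<^sub>0) (fst x) (snd x) \<le> avg (loglik1 \<theta>) (fst x) (snd x)"
      then have "norm \<theta> \<le> R" "a \<le> snd \<theta>" using elim(1) by blast+
      moreover have "\<theta> \<notin> T"
      proof
        assume "\<theta> \<in> T"
        then have "0 < avg (\<lambda>z. loglik1 \<theta>\<^sub>0 z - loglik1 \<theta> z) (fst x) (snd x)" using elim(2) by blast
        with le show False by (simp add: avg_diff)
      qed
      ultimately show "dist \<theta> \<theta>\<^sub>0 < e" by (auto simp: T_def)
    qed
  qed
qed

end

section \<open>Perturbed linear systems\<close>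

text \<open>\<open>norm A\<close> is the Euclidean norm of all entries, so this is Cauchy-Schwarz
  row by row.\<close>

lemma norm_matrix_vector_mult_le: "norm (A *v x) \<le> norm A * norm x"
  for A :: "real ^ 'n ^ 'm"
proof (rule power2_le_imp_le)
  have "(norm (A *v x))\<^sup>2 = (\<Sum>i\<in>UNIV. (A $ i \<bullet> x)\<^sup>2)"
    unfolding power2_norm_eq_inner inner_vec_def[of "A *v x"]
    by (simp add: matrix_vector_mul_component power2_eq_square)
  also have "\<dots> \<le> (\<Sum>i\<in>UNIV. (norm (A $ i))\<^sup>2 * (norm x)\<^sup>2)"
    using Cauchy_Schwarz_ineq[of _ x] by (intro sum_mono) (simp add: power2_norm_eq_inner)
  also have "\<dots> = (norm A * norm x)\<^sup>2"
    unfolding power_mult_distrib power2_norm_eq_inner[of A] inner_vec_def[of A]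
    by (simp add: power2_norm_eq_inner sum_distrib_right)
  finally show "(norm (A *v x))\<^sup>2 \<le> (norm A * norm x)\<^sup>2" .
qed simp

lemma borel_measurable_matrix_vector_mult [measurable]:
  fixes A :: "real ^ 'n ^ 'm"
  assumes "g \<in> borel_measurable M"
  shows "(\<lambda>x. A *v g x) \<in> borel_measurable M"
  by (rule borel_measurable_continuous_on[OF _ assms])
    (intro linear_continuous_on matrix_vector_mul_bounded_linear)

lemma matrix_inv_mult:
  fixes A :: "real ^ 'n ^ 'n"
  assumes "invertible A"
  shows "matrix_inv A ** A = mat 1" "A ** matrix_inv A = mat 1"
  using someI_ex[OF assms[unfolded invertible_def]] by (simp_all add: matrix_inv_def)

text \<open>A kernel vector of \<open>A\<close> would be reproduced, up to sign, by
  \<open>N ** (A - B)\<close>, which strictly shortens nonzero vectors.\<close>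

lemma invertible_if_close:
  fixes A B N :: "real ^ 'n ^ 'n"
  assumes N: "N ** B = mat 1" and close: "norm N * norm (A - B) < 1"
  shows "invertible A"
proof -
  have "x = 0" if "A *v x = 0" for x
  proof (rule ccontr)
    assume "x \<noteq> 0"
    have "(A - B) *v x = - (B *v x)"
      using that by (simp add: matrix_vector_mult_diff_rdistrib)
    then have "N *v ((A - B) *v x) = - x"
      by (simp add: linear_neg[OF matrix_vector_mul_linear] matrix_vector_mul_assoc N)
    then have "norm x = norm (N *v ((A - B) *v x))" by (metis norm_minus_cancel)
    also have "\<dots> \<le> norm N * (norm (A - B) * norm x)"
      by (rule order_trans[OF norm_matrix_vector_mult_le])
        (intro mult_left_mono norm_matrix_vector_mult_le norm_ge_zero)
    also have "\<dots> < 1 * norm x"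
      unfolding mult.assoc[symmetric] using close \<open>x \<noteq> 0\<close> by (intro mult_strict_right_mono) auto
    finally show False by simp
  qed
  then have "inj ((*v) A)"
    by (simp add: linear_injective_0[OF matrix_vector_mul_linear])
  then show ?thesis by (simp add: invertible_left_inverse matrix_left_invertible_injective)
qed

text \<open>Solving for \<open>t\<close> through \<open>N\<close> leaves \<open>t\<close> on the
  right with a factor at most one half, which is absorbed; \<open>A\<close> itself is never
  inverted.\<close>

lemma linear_system_perturbation:
  fixes A B N :: "real ^ 'n ^ 'n"
  assumes N: "N ** B = mat 1" and sys: "A *v t = v + r" and close: "norm N * norm (A - B) \<le> 1 / 2"
  shows "norm (t - N *v v) \<le> norm N * norm r + 2 * (norm N)\<^sup>2 * norm (A - B) * (norm v + norm r)"
proof -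
  have t: "t = N *v (B *v t)" by (simp add: matrix_vector_mul_assoc N)
  have "B *v t = v + r - (A - B) *v t"
    by (simp add: sys[symmetric] matrix_vector_mult_diff_rdistrib)
  then have eq: "t = N *v v + (N *v r - N *v ((A - B) *v t))"
    by (subst t) (simp add: matrix_vector_mult_diff_distrib matrix_vector_right_distrib)
  have small: "norm (N *v ((A - B) *v t)) \<le> norm N * norm (A - B) * norm t"
    unfolding mult.assoc by (rule order_trans[OF norm_matrix_vector_mult_le])
      (intro mult_left_mono norm_matrix_vector_mult_le norm_ge_zero)
  also have "\<dots> \<le> 1 / 2 * norm t" using close by (intro mult_right_mono) auto
  finally have half: "norm (N *v ((A - B) *v t)) \<le> norm t / 2" by simp
  have Nv: "norm (N *v v) \<le> norm N * norm v" "norm (N *v r) \<le> norm N * norm r"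
    by (rule norm_matrix_vector_mult_le)+
  have "norm t \<le> norm (N *v v) + (norm (N *v r) + norm (N *v ((A - B) *v t)))"
    by (subst (1) eq) (rule order_trans[OF norm_triangle_ineq add_left_mono[OF norm_triangle_ineq4]])
  then have nt: "norm t \<le> 2 * norm N * (norm v + norm r)"
    using half Nv by (simp add: algebra_simps)
  have "t - N *v v = N *v r - N *v ((A - B) *v t)" by (subst eq) simp
  then have "norm (t - N *v v) \<le> norm (N *v r) + norm (N *v ((A - B) *v t))"
    by (metis norm_triangle_ineq4)
  also have "\<dots> \<le> norm N * norm r + norm N * norm (A - B) * (2 * norm N * (norm v + norm r))"
    by (rule add_mono[OF Nv(2) order_trans[OF small mult_left_mono[OF nt]]]) simp
  finally show ?thesis by (simp add: power2_eq_square algebra_simps)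
qed

section \<open>Random linear systems\<close>

context prob_space
begin

text \<open>Bridges tightness and convergence in probability: a bound that holds only on events of
  probability above \<open>1 - \<delta>\<close> is enough if every \<delta> is allowed.\<close>

lemma eventually_whp_if_tight:
  assumes meas: "\<And>n. {\<omega>\<in>space M. P (n, \<omega>)} \<in> events"
    and tight: "\<And>\<delta>. 0 < \<delta> \<Longrightarrow> \<exists>W. (\<forall>n. W n \<in> events) \<and> (\<forall>\<^sub>F n in sequentially. 1 - \<delta> < prob (W n)) \<and>
      (\<forall>\<^sub>F x in whp M. snd x \<in> W (fst x) \<longrightarrow> P x)"
  shows "eventually P (whp M)"
  unfolding eventually_whp_prob[OF meas]
proof (rule order_tendstoI)
  fix a :: real assume "a < 1"
  define \<delta> where "\<delta> = (1 - a) / 2"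
  have \<delta>: "0 < \<delta>" using \<open>a < 1\<close> by (simp add: \<delta>_def)
  obtain W where W: "\<And>n. W n \<in> events" "\<forall>\<^sub>F n in sequentially. 1 - \<delta> < prob (W n)"
    and imp: "\<forall>\<^sub>F x in whp M. snd x \<in> W (fst x) \<longrightarrow> P x"
    using tight[OF \<delta>] by blast
  obtain G where G: "\<And>n. G n \<in> events" "(\<lambda>n. prob (G n)) \<longlonglongrightarrow> 1"
      "\<And>n \<omega>. \<omega> \<in> G n \<Longrightarrow> \<omega> \<in> W n \<Longrightarrow> P (n, \<omega>)"
    using imp unfolding eventually_whp by auto
  have "\<forall>\<^sub>F n in sequentially. 1 - \<delta> < prob (G n)"
    using \<delta> by (intro order_tendstoD(1)[OF G(2)]) simp
  with W(2) show "\<forall>\<^sub>F n in sequentially. a < prob {\<omega>\<in>space M. P (n, \<omega>)}"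
  proof eventually_elim
    case (elim n)
    have "prob (G n \<union> W n) = prob (G n) + prob (W n) - prob (G n \<inter> W n)"
      using G(1) W(1) by (intro measure_Un3) (simp_all add: fmeasurable_eq_sets)
    moreover have "prob (G n \<union> W n) \<le> 1" by simp
    ultimately have "prob (G n) + prob (W n) - 1 \<le> prob (G n \<inter> W n)" by linarith
    moreover have "prob (G n \<inter> W n) \<le> prob {\<omega>\<in>space M. P (n, \<omega>)}"
    proof (rule finite_measure_mono[OF _ meas])
      show "G n \<inter> W n \<subseteq> {\<omega>\<in>space M. P (n, \<omega>)}"
        using G(3) sets.sets_into_space[OF G(1)] by auto
    qed
    ultimately show ?case using elim unfolding \<delta>_def by (simp add: field_simps)
  qed
next
  fix a :: real assume "1 < a"
  then show "\<forall>\<^sub>F n in sequentially. prob {\<omega>\<in>space M. P (n, \<omega>)} < a"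
    by (intro always_eventually allI) (meson le_less_trans prob_le_1)
qed

text \<open>\<open>V n\<close> is bounded only in probability, so the perturbation bound is used on
  the event \<open>norm (V n \<omega>) \<le> R\<close>, where it tends to 0.\<close>

lemma linear_system_asymptotics:
  fixes A :: "nat \<Rightarrow> 'a \<Rightarrow> real ^ 'n ^ 'n" and T V :: "nat \<Rightarrow> 'a \<Rightarrow> real ^ 'n"
  assumes T [measurable]: "\<And>n. T n \<in> borel_measurable M"
    and V [measurable]: "\<And>n. V n \<in> borel_measurable M"
    and A: "((\<lambda>x. A (fst x) (snd x)) \<longlongrightarrow> B) (whp M)" and N: "N ** B = mat 1"
    and \<rho>: "((\<lambda>x. \<rho> (fst x) (snd x)) \<longlongrightarrow> 0) (whp M)"
    and sys: "\<forall>\<^sub>F x in whp M. A (fst x) (snd x) *v T (fst x) (snd x) = V (fst x) (snd x) + \<rho> (fst x) (snd x)"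
    and tight: "\<And>\<delta>. 0 < \<delta> \<Longrightarrow>
      \<exists>R. \<forall>\<^sub>F n in sequentially. 1 - \<delta> < prob {\<omega>\<in>space M. norm (V n \<omega>) \<le> R}"
  shows "((\<lambda>x. T (fst x) (snd x) - N *v V (fst x) (snd x)) \<longlongrightarrow> 0) (whp M)"
proof (rule tendstoI)
  fix e :: real assume e: "0 < e"
  show "\<forall>\<^sub>F x in whp M. dist (T (fst x) (snd x) - N *v V (fst x) (snd x)) 0 < e"
  proof (rule eventually_whp_if_tight)
    fix \<delta> :: real assume "0 < \<delta>"
    then obtain R where R: "\<forall>\<^sub>F n in sequentially. 1 - \<delta> < prob {\<omega>\<in>space M. norm (V n \<omega>) \<le> R}"
      using tight by blast
    \<comment> \<open>Bounds \<open>norm V + norm \<rho>\<close>, as \<open>norm \<rho> < 1\<close>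
      with high probability.\<close>
    define S where "S = \<bar>R\<bar> + 1"
    define W where "W n = {\<omega>\<in>space M. norm (V n \<omega>) \<le> R}" for n
    have A0: "((\<lambda>x. norm (A (fst x) (snd x) - B)) \<longlongrightarrow> 0) (whp M)"
      using tendsto_norm[OF tendsto_diff[OF A tendsto_const[of B]]] by simp
    have \<rho>0: "((\<lambda>x. norm (\<rho> (fst x) (snd x))) \<longlongrightarrow> 0) (whp M)"
      using tendsto_norm[OF \<rho>] by simp
    have "((\<lambda>x. norm N * norm (A (fst x) (snd x) - B)) \<longlongrightarrow> 0) (whp M)"
      by (rule tendsto_mult_right_zero[OF A0])
    then have close: "\<forall>\<^sub>F x in whp M. norm N * norm (A (fst x) (snd x) - B) < 1 / 2"
      by (rule order_tendstoD) simp
    have "((\<lambda>x. norm N * norm (\<rho> (fst x) (snd x)) + 2 * (norm N)\<^sup>2 * norm (A (fst x) (snd x) - B) * S)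
        \<longlongrightarrow> norm N * 0 + 2 * (norm N)\<^sup>2 * 0 * S) (whp M)"
      by (intro tendsto_intros A0 \<rho>0)
    then have bound: "\<forall>\<^sub>F x in whp M.
        norm N * norm (\<rho> (fst x) (snd x)) + 2 * (norm N)\<^sup>2 * norm (A (fst x) (snd x) - B) * S < e"
      using e by (intro order_tendstoD(2)) auto
    have \<rho>1: "\<forall>\<^sub>F x in whp M. norm (\<rho> (fst x) (snd x)) < 1" by (rule order_tendstoD(2)[OF \<rho>0]) simp
    have "\<forall>\<^sub>F x in whp M. snd x \<in> W (fst x) \<longrightarrow> dist (T (fst x) (snd x) - N *v V (fst x) (snd x)) 0 < e"
      using close bound \<rho>1 sys
    proof eventually_elim
      case (elim x)
      let ?A = "A (fst x) (snd x)" and ?V = "V (fst x) (snd x)" and ?\<rho> = "\<rho> (fst x) (snd x)"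
      show ?case
      proof
        assume "snd x \<in> W (fst x)"
        then have "norm ?V \<le> R" by (simp add: W_def)
        then have "norm ?V + norm ?\<rho> \<le> S" using elim(3) unfolding S_def by linarith
        then have "2 * (norm N)\<^sup>2 * norm (?A - B) * (norm ?V + norm ?\<rho>) \<le> 2 * (norm N)\<^sup>2 * norm (?A - B) * S"
          by (intro mult_left_mono) auto
        moreover have "norm (T (fst x) (snd x) - N *v ?V)
            \<le> norm N * norm ?\<rho> + 2 * (norm N)\<^sup>2 * norm (?A - B) * (norm ?V + norm ?\<rho>)"
          using elim by (intro linear_system_perturbation[OF N]) auto
        ultimately show "dist (T (fst x) (snd x) - N *v ?V) 0 < e" using elim(2) by simp
      qed
    qed
    moreover have "\<forall>n. W n \<in> events" unfolding W_def by measurable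
    ultimately show "\<exists>W. (\<forall>n. W n \<in> events) \<and> (\<forall>\<^sub>F n in sequentially. 1 - \<delta> < prob (W n)) \<and>
        (\<forall>\<^sub>F x in whp M. snd x \<in> W (fst x) \<longrightarrow> dist (T (fst x) (snd x) - N *v V (fst x) (snd x)) 0 < e)"
      using R by (intro exI[of _ W]) (auto simp: W_def)
  next
    fix n
    show "{\<omega> \<in> space M. dist (T (fst (n, \<omega>)) (snd (n, \<omega>)) - N *v V (fst (n, \<omega>)) (snd (n, \<omega>))) 0 < e} \<in> events"
      unfolding fst_conv snd_conv by measurable
  qed
qed

text \<open>The limit law is tight; the test function \<open>outside_ball R\<close> carries this
  over to the sequence and dominates the indicator of norms above \<open>R + 1\<close>.\<close>

lemma tight_if_conv_in_distr:
  fixes V :: "nat \<Rightarrow> 'a \<Rightarrow> real ^ 'n"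
  assumes conv: "conv_in_distr M V \<mu>" and mu: "prob_space \<mu>" "sets \<mu> = sets borel" and \<delta>: "0 < \<delta>"
  shows "\<exists>R. \<forall>\<^sub>F n in sequentially. 1 - \<delta> < prob {\<omega>\<in>space M. norm (V n \<omega>) \<le> R}"
proof -
  have [measurable]: "V n \<in> borel_measurable M" for n using conv by (simp add: conv_in_distr_def)
  obtain R where R: "(\<integral>x. outside_ball R x \<partial>\<mu>) < \<delta>" using prob_tight[OF mu \<delta>] by blast
  have "(\<lambda>n. expectation (\<lambda>\<omega>. outside_ball R (V n \<omega>))) \<longlonglongrightarrow> (\<integral>x. outside_ball R x \<partial>\<mu>)"
  proof -
    have "bounded (range (outside_ball R :: real ^ 'n \<Rightarrow> real))"
      unfolding bounded_iff by (intro exI[of _ 1]) (auto simp: outside_ball_def)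
    moreover have "(\<lambda>n. expectation (\<lambda>\<omega>. g (V n \<omega>))) \<longlonglongrightarrow> (\<integral>x. g x \<partial>\<mu>)"
      if "continuous_on UNIV g" "bounded (range g)" for g :: "real ^ 'n \<Rightarrow> real"
      using conv that by (simp add: conv_in_distr_def)
    ultimately show ?thesis using continuous_on_outside_ball by blast
  qed
  then have "\<forall>\<^sub>F n in sequentially. expectation (\<lambda>\<omega>. outside_ball R (V n \<omega>)) < \<delta>"
    using R by (rule order_tendstoD(2))
  then have "\<forall>\<^sub>F n in sequentially. 1 - \<delta> < prob {\<omega>\<in>space M. norm (V n \<omega>) \<le> R + 1}"
  proof eventually_elim
    case (elim n)
    let ?A = "{\<omega>\<in>space M. norm (V n \<omega>) \<le> R + 1}"
    have A: "?A \<in> events" by measurable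
    have "prob (space M - ?A) = expectation (\<lambda>\<omega>. indicator (space M - ?A) \<omega>)"
      using A by (subst Bochner_Integration.integral_indicator) auto
    also have "\<dots> \<le> expectation (\<lambda>\<omega>. outside_ball R (V n \<omega>))"
    proof (rule integral_mono)
      show "integrable M (indicator (space M - ?A) :: _ \<Rightarrow> real)"
        using A by (intro integrable_real_indicator) (auto simp: less_top[symmetric])
      show "integrable M (\<lambda>\<omega>. outside_ball R (V n \<omega>))"
        by (intro integrable_const_bound[of _ 1]) (auto simp: outside_ball_def)
      show "indicator (space M - ?A) \<omega> \<le> outside_ball R (V n \<omega>)" if "\<omega> \<in> space M" for \<omega>
        using that by (auto simp: indicator_def outside_ball_eq_1 outside_ball_bounds)
    qed
    finally show ?case using elim prob_compl[OF A] by simp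
  qed
  then show ?thesis by blast
qed

end

lemma det_scaleR: "det (c *\<^sub>R A) = c ^ CARD('n) * det A" for A :: "real ^ 'n ^ 'n"
proof -
  have "c *\<^sub>R A = (\<chi> i. c *s A $ i)" by (simp add: vec_eq_iff)
  then show ?thesis using det_rows_mul[of "\<lambda>_. c" "\<lambda>i. A $ i"] by simp
qed

section \<open>Central limit theorem for estimating equations\<close>

context regression
begin

lemma fst_measurable_borel [measurable]: "fst \<in> borel_measurable (borel :: ((real ^ 'n) \<times> real) measure)"
  and snd_measurable_borel [measurable]: "snd \<in> borel_measurable (borel :: ((real ^ 'n) \<times> real) measure)"
  by (intro borel_measurable_continuous_onI continuous_intros)+

lemma fst_Z_measurable [measurable]: "(\<lambda>\<omega>. fst (Z i \<omega>)) \<in> borel_measurable M"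
  and snd_Z_measurable [measurable]: "(\<lambda>\<omega>. snd (Z i \<omega>)) \<in> borel_measurable M"
  by (rule measurable_compose[OF Z_measurable fst_measurable_borel] measurable_compose[OF Z_measurable snd_measurable_borel])+

lemma Q_invertible: "invertible Q"
proof -
  have "inj ((*v) Q)"
    unfolding linear_injective_0[OF matrix_vector_mul_linear]
    using Q_pos_def by (auto simp: pos_def_matrix_def)
  then show ?thesis by (simp add: invertible_left_inverse matrix_left_invertible_injective)
qed

abbreviation "Q\<^sub>i\<^sub>n\<^sub>v \<equiv> matrix_inv Q"

lemma Qinv_mult: "Q\<^sub>i\<^sub>n\<^sub>v ** Q = mat 1" "Q ** Q\<^sub>i\<^sub>n\<^sub>v = mat 1"
  using matrix_inv_mult[OF Q_invertible] .

lemma Qinv_sym: "transpose Q\<^sub>i\<^sub>n\<^sub>v = Q\<^sub>i\<^sub>n\<^sub>v"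
proof -
  have "transpose Q = Q" using Q_pos_def by (simp add: pos_def_matrix_def)
  then have "transpose Q\<^sub>i\<^sub>n\<^sub>v ** Q = transpose (Q ** Q\<^sub>i\<^sub>n\<^sub>v)" by (simp add: matrix_transpose_mul)
  then have "transpose Q\<^sub>i\<^sub>n\<^sub>v ** Q = mat 1" by (simp add: Qinv_mult transpose_mat)
  then have "transpose Q\<^sub>i\<^sub>n\<^sub>v ** (Q ** Q\<^sub>i\<^sub>n\<^sub>v) = Q\<^sub>i\<^sub>n\<^sub>v" by (simp add: matrix_mul_assoc)
  then show ?thesis by (simp add: Qinv_mult)
qed

lemma Qinv_pos_def: "pos_def_matrix Q\<^sub>i\<^sub>n\<^sub>v"
  unfolding pos_def_matrix_def
proof (intro conjI allI impI Qinv_sym)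
  fix v :: "real ^ 'n" assume "v \<noteq> 0"
  have v: "v = Q *v (Q\<^sub>i\<^sub>n\<^sub>v *v v)" by (simp add: matrix_vector_mul_assoc Qinv_mult)
  then have "Q\<^sub>i\<^sub>n\<^sub>v *v v \<noteq> 0" using \<open>v \<noteq> 0\<close> by (metis matrix_vector_mult_0_right)
  then have "0 < (Q\<^sub>i\<^sub>n\<^sub>v *v v) \<bullet> (Q *v (Q\<^sub>i\<^sub>n\<^sub>v *v v))" using Q_pos_def by (simp add: pos_def_matrix_def)
  then show "0 < v \<bullet> (Q\<^sub>i\<^sub>n\<^sub>v *v v)" using v by (simp add: inner_commute)
qed

lemma det_Qinv: "det Q\<^sub>i\<^sub>n\<^sub>v \<noteq> 0"
  using Qinv_mult by (metis invertible_def invertible_det_nz)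

abbreviation res :: "(real ^ 'n) \<times> real \<Rightarrow> real" where
  "res z \<equiv> \<theta>\<^sub>0 \<bullet> z"

text \<open>At an observation \<open>res\<close> returns the standardised error, which is
  independent of the covariate, so integrals factorise.\<close>

lemma product_D:
  fixes a :: "real ^ 'n \<Rightarrow> real" and b :: "real \<Rightarrow> real"
  assumes a: "integrable P\<^sub>X a" and b: "integrable F b"
  shows "integrable D (\<lambda>z. a (fst z) * b (res z))"
    and "(\<integral>z. a (fst z) * b (res z) \<partial>D) = (\<integral>x. a x \<partial>P\<^sub>X) * (\<integral>e. b e \<partial>F)"
proof -
  have [measurable]: "a \<in> borel_measurable borel" "b \<in> borel_measurable borel"
    using borel_measurable_integrable[OF a] borel_measurable_integrable[OF b]
    by (simp_all cong: measurable_cong_sets)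
  have m: "(\<lambda>z. a (fst z) * b (res z)) \<in> borel_measurable borel" by measurable
  show "integrable D (\<lambda>z. a (fst z) * b (res z))"
    unfolding integrable_D_iff[OF m] inner_theta0_obs fst_conv by (rule XF.integral_prod_mult(1)[OF a b])
  show "(\<integral>z. a (fst z) * b (res z) \<partial>D) = (\<integral>x. a x \<partial>P\<^sub>X) * (\<integral>e. b e \<partial>F)"
    unfolding integral_D[OF m] inner_theta0_obs fst_conv by (rule XF.integral_prod_mult(2)[OF a b])
qed

text \<open>Maximum likelihood is the case \<open>b = \<psi>'\<close>, \<open>c = - I / s\<^sub>0\<close>; least squares is the case
  \<open>b e = s\<^sub>0 e\<close>, \<open>c = 1\<close>.\<close>

lemma asymp_normal_if_linear_system:
  fixes T :: "nat \<Rightarrow> 'a \<Rightarrow> real ^ 'n" and b :: "real \<Rightarrow> real"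
  assumes T [measurable]: "\<And>n. T n \<in> borel_measurable M"
    and b [measurable]: "b \<in> borel_measurable borel"
    and b_sq: "integrable F (\<lambda>e. (b e)\<^sup>2)" and b_mean: "(\<integral>e. b e \<partial>F) = 0"
    and \<kappa>: "\<kappa> = (\<integral>e. (b e)\<^sup>2 \<partial>F)" "0 < \<kappa>" and c: "c \<noteq> 0"
    and A: "\<And>i j. ((\<lambda>x. A (fst x) (snd x) $ i $ j) \<longlongrightarrow> c * Q $ i $ j) (whp M)"
    and \<rho>: "((\<lambda>x. \<rho> (fst x) (snd x)) \<longlongrightarrow> 0) (whp M)"
    and sys: "\<forall>\<^sub>F x in whp M. A (fst x) (snd x) *v (sqrt (real (fst x)) *\<^sub>R (T (fst x) (snd x) - \<beta>\<^sub>0)) =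
      (1 / sqrt (real (fst x))) *\<^sub>R (\<Sum>i<fst x. b (res (Z i (snd x))) *\<^sub>R fst (Z i (snd x))) + \<rho> (fst x) (snd x)"
  shows "asymp_normal M T \<beta>\<^sub>0 ((\<kappa> / c\<^sup>2) *\<^sub>R Q\<^sub>i\<^sub>n\<^sub>v)"
proof -
  define N where "N = (1 / c) *\<^sub>R Q\<^sub>i\<^sub>n\<^sub>v"
  define V where "V n \<omega> = (1 / sqrt (real n)) *\<^sub>R (\<Sum>i<n. b (res (Z i \<omega>)) *\<^sub>R fst (Z i \<omega>))" for n \<omega>
  define S where "S n \<omega> = sqrt (real n) *\<^sub>R (T n \<omega> - \<beta>\<^sub>0)" for n \<omega>
  have int_b: "integrable F b" by (rule F.square_integrable_imp_integrable[OF _ b_sq]) simp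
  have N: "N ** (c *\<^sub>R Q) = mat 1"
    using c Qinv_mult(1) by (simp add: N_def scalar_matrix_assoc matrix_scalar_ac)
  have A': "((\<lambda>x. A (fst x) (snd x)) \<longlongrightarrow> c *\<^sub>R Q) (whp M)"
    by (intro vec_tendstoI) (use A in simp)
  have V [measurable]: "V n \<in> borel_measurable M" for n unfolding V_def by measurable
  have S [measurable]: "S n \<in> borel_measurable M" for n unfolding S_def by measurable
  \<comment> \<open>One statement serves twice: \<open>L = mat 1\<close> gives tightness of
    \<open>V\<close>, and \<open>L = N\<close> gives the limit law of its image under
    \<open>N\<close>.\<close>
  have clt: "\<exists>\<mu>. centered_gaussian_law \<mu> (\<kappa> *\<^sub>R (L ** Q ** transpose L)) \<and>
      conv_in_distr M (\<lambda>n \<omega>. (1 / sqrt (real n)) *\<^sub>R (\<Sum>i<n. b (res (Z i \<omega>)) *\<^sub>R (L *v fst (Z i \<omega>)))) \<mu>"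
    if pd: "pos_def_matrix (\<kappa> *\<^sub>R (L ** Q ** transpose L))" for L
  proof (rule multivariate_clt)
    have comp: "(b (res z) *\<^sub>R (L *v fst z)) $ i = (L $ i \<bullet> fst z) * b (res z)" for z i
      by (simp add: matrix_vector_mul_component)
    show "integrable D (\<lambda>z. ((b (res z) *\<^sub>R (L *v fst z)) $ i)\<^sup>2)" for i
      unfolding comp power_mult_distrib by (rule product_D(1)[OF inner_PX(1) b_sq])
    show "(\<integral>z. (b (res z) *\<^sub>R (L *v fst z)) $ i \<partial>D) = 0" for i
      unfolding comp by (subst product_D(2)[OF inner_PX(3) int_b]) (simp add: b_mean)
    have entry: "(\<integral>x. (L $ i \<bullet> x) * (L $ j \<bullet> x) \<partial>P\<^sub>X) = (L ** Q ** transpose L) $ i $ j"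
      "integrable P\<^sub>X (\<lambda>x. (L $ i \<bullet> x) * (L $ j \<bullet> x))" for i j
    proof -
      have ex: "(L $ i \<bullet> x) * (L $ j \<bullet> x) = (\<Sum>k\<in>UNIV. \<Sum>l\<in>UNIV. L $ i $ k * L $ j $ l * (x $ k * x $ l))" for x
        by (simp add: inner_vec_def sum_product mult_ac)
      show "integrable P\<^sub>X (\<lambda>x. (L $ i \<bullet> x) * (L $ j \<bullet> x))" unfolding ex using int_PX_prod by simp
      have "(\<integral>x. (L $ i \<bullet> x) * (L $ j \<bullet> x) \<partial>P\<^sub>X) = (\<Sum>k\<in>UNIV. \<Sum>l\<in>UNIV. L $ i $ k * L $ j $ l * Q $ k $ l)"
        unfolding ex Q_def using int_PX_prod by simp
      also have "\<dots> = (\<Sum>l\<in>UNIV. \<Sum>k\<in>UNIV. L $ i $ k * L $ j $ l * Q $ k $ l)" by (rule sum.swap)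
      also have "\<dots> = (L ** Q ** transpose L) $ i $ j"
        by (simp add: matrix_matrix_mult_def transpose_def sum_distrib_right sum_distrib_left mult_ac)
      finally show "(\<integral>x. (L $ i \<bullet> x) * (L $ j \<bullet> x) \<partial>P\<^sub>X) = (L ** Q ** transpose L) $ i $ j" .
    qed
    show "(\<integral>z. (b (res z) *\<^sub>R (L *v fst z)) $ i * (b (res z) *\<^sub>R (L *v fst z)) $ j \<partial>D)
        = (\<kappa> *\<^sub>R (L ** Q ** transpose L)) $ i $ j" for i j
    proof -
      have "(\<integral>z. (b (res z) *\<^sub>R (L *v fst z)) $ i * (b (res z) *\<^sub>R (L *v fst z)) $ j \<partial>D)
          = (\<integral>z. ((L $ i \<bullet> fst z) * (L $ j \<bullet> fst z)) * (b (res z))\<^sup>2 \<partial>D)"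
        unfolding comp by (intro Bochner_Integration.integral_cong) (auto simp: power2_eq_square)
      also have "\<dots> = (L ** Q ** transpose L) $ i $ j * \<kappa>"
        by (subst product_D(2)[OF entry(2) b_sq]) (simp add: entry(1) \<kappa>(1))
      finally show ?thesis by simp
    qed
    show "pos_def_matrix (\<kappa> *\<^sub>R (L ** Q ** transpose L))" by fact
  qed measurable
  have pd_scale: "pos_def_matrix (a *\<^sub>R P)" if "0 < a" "pos_def_matrix P" for a and P :: "real ^ 'n ^ 'n"
    using that unfolding pos_def_matrix_def
    by (auto simp: scaleR_matrix_vector_assoc[symmetric] transpose_scalar)
  obtain \<mu>\<^sub>V where muV: "centered_gaussian_law \<mu>\<^sub>V (\<kappa> *\<^sub>R Q)" and convV: "conv_in_distr M V \<mu>\<^sub>V"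
    using clt[of "mat 1"] pd_scale[OF \<kappa>(2) Q_pos_def] unfolding V_def[abs_def] by (auto simp: transpose_mat)
  have null: "((\<lambda>x. S (fst x) (snd x) - N *v V (fst x) (snd x)) \<longlongrightarrow> 0) (whp M)"
  proof (rule linear_system_asymptotics[OF S V A' N \<rho>])
    show "\<forall>\<^sub>F x in whp M. A (fst x) (snd x) *v S (fst x) (snd x) = V (fst x) (snd x) + \<rho> (fst x) (snd x)"
      using sys by (simp add: S_def V_def)
    show "\<exists>R. \<forall>\<^sub>F n in sequentially. 1 - \<delta> < prob {\<omega>\<in>space M. norm (V n \<omega>) \<le> R}" if "0 < \<delta>" for \<delta>
      using muV by (intro tight_if_conv_in_distr[OF convV] that)
        (auto simp: centered_gaussian_law_def gaussian_law_def)
  qed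
  \<comment> \<open>\<open>N\<close> is \<open>1 / c\<close> times the inverse of \<open>Q\<close>,
    so one factor \<open>Q\<close> of the sandwich cancels.\<close>
  have cov: "\<kappa> *\<^sub>R (N ** Q ** transpose N) = (\<kappa> / c\<^sup>2) *\<^sub>R Q\<^sub>i\<^sub>n\<^sub>v"
  proof -
    have "N ** Q = (1 / c) *\<^sub>R mat 1" by (simp add: N_def scalar_matrix_assoc[symmetric] Qinv_mult)
    moreover have "transpose N = N" by (simp add: N_def transpose_scalar Qinv_sym)
    ultimately show ?thesis
      by (simp add: scalar_matrix_assoc[symmetric] power2_eq_square) (simp add: N_def)
  qed
  have "pos_def_matrix ((\<kappa> / c\<^sup>2) *\<^sub>R Q\<^sub>i\<^sub>n\<^sub>v)"
    using \<kappa>(2) c by (intro pd_scale Qinv_pos_def) simp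
  then obtain \<mu> where mu: "centered_gaussian_law \<mu> ((\<kappa> / c\<^sup>2) *\<^sub>R Q\<^sub>i\<^sub>n\<^sub>v)"
    and conv: "conv_in_distr M (\<lambda>n \<omega>. (1 / sqrt (real n)) *\<^sub>R (\<Sum>i<n. b (res (Z i \<omega>)) *\<^sub>R (N *v fst (Z i \<omega>)))) \<mu>"
    using clt[of N] unfolding cov by blast
  have NV: "(1 / sqrt (real n)) *\<^sub>R (\<Sum>i<n. b (res (Z i \<omega>)) *\<^sub>R (N *v fst (Z i \<omega>))) = N *v V n \<omega>" for n \<omega>
    by (simp add: V_def linear_sum[OF matrix_vector_mul_linear] linear_scale[OF matrix_vector_mul_linear])
  have "conv_in_distr M S \<mu>"
  proof (rule slutsky[OF conv[unfolded NV]])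
    show "prob_space \<mu>" "sets \<mu> = sets borel"
      using mu by (auto simp: centered_gaussian_law_def gaussian_law_def)
  qed (use S null in auto)
  then show ?thesis
    using mu unfolding asymp_normal_def S_def[abs_def] by blast
qed

end

section \<open>Least squares and the score equation\<close>

lemma borel_measurable_vec_lambda [measurable]:
  fixes f :: "'n::finite \<Rightarrow> 'a \<Rightarrow> real"
  assumes [measurable]: "\<And>k. f k \<in> borel_measurable M"
  shows "(\<lambda>x. \<chi> k. f k x) \<in> borel_measurable M"
proof -
  have "(\<chi> k. f k x) = (\<Sum>k\<in>UNIV. f k x *\<^sub>R axis k 1)" for x
    using basis_expansion[of "\<chi> k. f k x"] by (simp add: scalar_mult_eq_scaleR)
  then show ?thesis by simp
qed

lemma borel_measurable_det:
  fixes A :: "'a \<Rightarrow> real ^ 'n ^ 'n"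
  assumes [measurable]: "\<And>i j. (\<lambda>x. A x $ i $ j) \<in> borel_measurable M"
  shows "(\<lambda>x. det (A x)) \<in> borel_measurable M"
  unfolding det_def by measurable

text \<open>On the regular matrices, a measurable set, Cramer's rule writes the product through
  determinants, which are polynomials in the entries.\<close>

lemma borel_measurable_matrix_inv_mult:
  fixes A :: "'a \<Rightarrow> real ^ 'n ^ 'n"
  assumes A [measurable]: "\<And>i j. (\<lambda>x. A x $ i $ j) \<in> borel_measurable M"
    and b [measurable]: "b \<in> borel_measurable M"
  shows "(\<lambda>x. matrix_inv (A x) *v b x) \<in> borel_measurable M"
proof -
  have eq: "matrix_inv (A x) *v b x =
      (if det (A x) = 0 then matrix_inv 0 *v b x
       else \<chi> k. det (\<chi> i j. if j = k then b x $ i else A x $ i $ j) / det (A x))" for x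
  proof (cases "det (A x) = 0")
    case True
    \<comment> \<open>\<open>matrix_inv\<close> is the same junk value for all singular matrices.\<close>
    have "\<not> invertible (A x)" "\<not> invertible (0 :: real ^ 'n ^ 'n)"
      using True det_scaleR[of 0 "mat 1 :: real ^ 'n ^ 'n"] by (simp_all add: invertible_det_nz power_0_left)
    then have "matrix_inv (A x) = matrix_inv 0"
      unfolding matrix_inv_def invertible_def by (metis (no_types, lifting))
    then show ?thesis using True by simp
  next
    case False
    then have "invertible (A x)" by (simp add: invertible_det_nz)
    then have "A x *v (matrix_inv (A x) *v b x) = b x"
      by (simp add: matrix_vector_mul_assoc matrix_inv_mult)
    then show ?thesis using False cramer[OF False] by simp
  qed
  have [measurable]: "(\<lambda>x. det (A x)) \<in> borel_measurable M"
    by (rule borel_measurable_det) (rule A)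
  have [measurable]: "(\<lambda>x. det (\<chi> i j. if j = k then b x $ i else A x $ i $ j)) \<in> borel_measurable M" for k
  proof (rule borel_measurable_det)
    fix i j
    show "(\<lambda>x. (\<chi> i j. if j = k then b x $ i else A x $ i $ j) $ i $ j) \<in> borel_measurable M"
      by (cases "j = k") simp_all
  qed
  show ?thesis unfolding eq by measurable
qed

context regression
begin

lemma ols_measurable:
  "(\<lambda>\<omega>. ols n (\<lambda>i. fst (Z i \<omega>)) (\<lambda>i. snd (Z i \<omega>))) \<in> borel_measurable M"
  unfolding ols_def
proof (rule borel_measurable_matrix_inv_mult)
  show "(\<lambda>\<omega>. (\<Sum>i<n. outer_prod (fst (Z i \<omega>))) $ j $ k) \<in> borel_measurable M" for j k
    by (simp add: outer_prod_def)
qed measurable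

lemma avg_outer_tendsto:
  assumes "integrable F b"
  shows "((\<lambda>x. avg (\<lambda>z. (fst z $ j * fst z $ k) * b (res z)) (fst x) (snd x)) \<longlongrightarrow> Q $ j $ k * (\<integral>e. b e \<partial>F)) (whp M)"
  using weak_law[OF product_D(1)[OF int_PX_prod[of j k] assms]]
  by (simp add: product_D(2)[OF int_PX_prod assms] Q_def)

lemma eventually_whp_pos_nat: "\<forall>\<^sub>F x in whp M. 0 < fst x"
  using filterlim_fst_whp eventually_gt_at_top[of 0] by (auto simp: filterlim_iff)

lemma outer_prod_mult: "outer_prod x *v v = (x \<bullet> v) *\<^sub>R x"
  by (simp add: vec_eq_iff outer_prod_def matrix_vector_mult_def inner_vec_def sum_distrib_right
    sum_distrib_left mult_ac)

lemma sum_matrix_vector_mult: "(\<Sum>i\<in>I. L i) *v v = (\<Sum>i\<in>I. L i *v v)"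
  for L :: "'i \<Rightarrow> real ^ 'k ^ 'm"
  by (induction I rule: infinite_finite_induct) (auto simp: matrix_vector_mult_add_rdistrib)

text \<open>With high probability the Gram matrix is invertible and least squares solves the normal
  equations; subtracting the Gram matrix applied to \<open>\<beta>\<^sub>0\<close> turns responses
  into errors and leaves no remainder.\<close>

theorem asymp_normal_ols:
  "asymp_normal M (\<lambda>n \<omega>. ols n (\<lambda>i. fst (Z i \<omega>)) (\<lambda>i. snd (Z i \<omega>))) \<beta>\<^sub>0 ((s\<^sub>0\<^sup>2 * m\<^sub>2) *\<^sub>R Q\<^sub>i\<^sub>n\<^sub>v)"
proof -
  define S where "S n \<omega> = (\<Sum>i<n. outer_prod (fst (Z i \<omega>)))" for n \<omega>
  define A where "A n \<omega> = (1 / real n) *\<^sub>R S n \<omega>" for n \<omega>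
  define T where "T n \<omega> = ols n (\<lambda>i. fst (Z i \<omega>)) (\<lambda>i. snd (Z i \<omega>))" for n \<omega>
  have A: "((\<lambda>x. A (fst x) (snd x) $ i $ j) \<longlongrightarrow> 1 * Q $ i $ j) (whp M)" for i j
    using avg_outer_tendsto[of "\<lambda>_. 1" i j]
    by (simp add: A_def S_def avg_def outer_prod_def F.prob_space[unfolded space_F])
  have "asymp_normal M T \<beta>\<^sub>0 ((s\<^sub>0\<^sup>2 * m\<^sub>2 / 1\<^sup>2) *\<^sub>R Q\<^sub>i\<^sub>n\<^sub>v)"
  proof (rule asymp_normal_if_linear_system[where A=A and b="\<lambda>e. s\<^sub>0 * e" and \<rho>="\<lambda>_ _. 0"])
    show "T n \<in> borel_measurable M" for n unfolding T_def by (rule ols_measurable)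
    show "integrable F (\<lambda>e. (s\<^sub>0 * e)\<^sup>2)" using int_F_sq by (simp add: power_mult_distrib)
    show "(\<integral>e. s\<^sub>0 * e \<partial>F) = 0" using integral_F_odd[of "\<lambda>e. e"] by simp
    show "s\<^sub>0\<^sup>2 * m\<^sub>2 = (\<integral>e. (s\<^sub>0 * e)\<^sup>2 \<partial>F)" by (simp add: power_mult_distrib m\<^sub>2_def)
    show "0 < s\<^sub>0\<^sup>2 * m\<^sub>2" using s0_pos m2_pos by simp
    show "((\<lambda>x. A (fst x) (snd x) $ i $ j) \<longlongrightarrow> 1 * Q $ i $ j) (whp M)" for i j by (rule A)
    have "((\<lambda>x. A (fst x) (snd x)) \<longlongrightarrow> Q) (whp M)"
      by (intro vec_tendstoI) (use A in simp)
    then have "((\<lambda>x. norm Q\<^sub>i\<^sub>n\<^sub>v * norm (A (fst x) (snd x) - Q)) \<longlongrightarrow> norm Q\<^sub>i\<^sub>n\<^sub>v * norm (Q - Q)) (whp M)"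
      by (intro tendsto_intros)
    then have close: "\<forall>\<^sub>F x in whp M. norm Q\<^sub>i\<^sub>n\<^sub>v * norm (A (fst x) (snd x) - Q) < 1"
      by (rule order_tendstoD) simp
    show "\<forall>\<^sub>F x in whp M. A (fst x) (snd x) *v (sqrt (real (fst x)) *\<^sub>R (T (fst x) (snd x) - \<beta>\<^sub>0)) =
      (1 / sqrt (real (fst x))) *\<^sub>R (\<Sum>i<fst x. (s\<^sub>0 * res (Z i (snd x))) *\<^sub>R fst (Z i (snd x))) + 0"
      using close eventually_whp_pos_nat
    proof eventually_elim
      case (elim x)
      let ?n = "fst x" and ?\<omega> = "snd x"
      have "invertible (A ?n ?\<omega>)" by (rule invertible_if_close[OF Qinv_mult(1) elim(1)])
      then have "invertible (S ?n ?\<omega>)"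
        by (simp add: A_def invertible_det_nz det_scaleR)
      then have "S ?n ?\<omega> *v T ?n ?\<omega> = (\<Sum>i<?n. snd (Z i ?\<omega>) *\<^sub>R fst (Z i ?\<omega>))"
        by (simp add: T_def ols_def S_def[symmetric] matrix_vector_mul_assoc matrix_inv_mult)
      moreover have "S ?n ?\<omega> *v \<beta>\<^sub>0 = (\<Sum>i<?n. (\<beta>\<^sub>0 \<bullet> fst (Z i ?\<omega>)) *\<^sub>R fst (Z i ?\<omega>))"
        by (simp add: S_def sum_matrix_vector_mult outer_prod_mult inner_commute)
      ultimately have "S ?n ?\<omega> *v (T ?n ?\<omega> - \<beta>\<^sub>0) = (\<Sum>i<?n. (s\<^sub>0 * res (Z i ?\<omega>)) *\<^sub>R fst (Z i ?\<omega>))"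
        using s0_pos
        by (simp add: matrix_vector_mult_diff_distrib inner_theta sum_subtractf[symmetric] scaleR_diff_left[symmetric])
      moreover have "A ?n ?\<omega> *v (sqrt (real ?n) *\<^sub>R v) = (sqrt (real ?n) / real ?n) *\<^sub>R (S ?n ?\<omega> *v v)" for v
        by (simp add: A_def scaleR_matrix_vector_assoc[symmetric] linear_scale[OF matrix_vector_mul_linear])
      moreover have "sqrt (real ?n) / real ?n = 1 / sqrt (real ?n)"
        using elim(2) by (simp add: field_simps)
      ultimately show ?case by simp
    qed
  qed simp_all
  then show ?thesis by (simp add: T_def[abs_def])
qed

section \<open>The score equation\<close>

lemma log_lik_eq:
  "log_lik f n xs ys \<beta> s = ereal (- real n * ln s + (\<Sum>i<n. ln (f ((ys i - \<beta> \<bullet> xs i) / s))))"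
  unfolding log_lik_def log_ext_def using f_pos by (simp add: sum_ereal)

lemma is_mle_iff:
  "is_mle f n xs ys \<beta> s \<longleftrightarrow> 0 < s \<and> (\<forall>\<beta>' s'. 0 < s' \<longrightarrow>
     - real n * ln s' + (\<Sum>i<n. ln (f ((ys i - \<beta>' \<bullet> xs i) / s')))
     \<le> - real n * ln s + (\<Sum>i<n. ln (f ((ys i - \<beta> \<bullet> xs i) / s))))"
  unfolding is_mle_def log_lik_eq by simp

lemma avg_loglik1_theta:
  assumes "0 < s" "0 < n"
  shows "avg (loglik1 (theta \<beta> s)) n \<omega> =
    (- real n * ln s + (\<Sum>i<n. ln (f ((snd (Z i \<omega>) - \<beta> \<bullet> fst (Z i \<omega>)) / s)))) / real n"
proof -
  have "ln (snd (theta \<beta> s)) = - ln s" using assms by (simp add: theta_def ln_div)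
  then show ?thesis by (simp add: avg_def loglik1_def inner_theta sum_subtractf)
qed

lemma is_mle_imp_maximiser:
  assumes "is_mle f n (\<lambda>i. fst (Z i \<omega>)) (\<lambda>i. snd (Z i \<omega>)) \<beta> s" "0 < n"
  shows "0 < s" "avg (loglik1 \<theta>\<^sub>0) n \<omega> \<le> avg (loglik1 (theta \<beta> s)) n \<omega>"
proof -
  show s: "0 < s" using assms(1) by (simp add: is_mle_def)
  show "avg (loglik1 \<theta>\<^sub>0) n \<omega> \<le> avg (loglik1 (theta \<beta> s)) n \<omega>"
    unfolding avg_loglik1_theta[OF s assms(2)] avg_loglik1_theta[OF s0_pos assms(2)]
    using assms(1) s0_pos unfolding is_mle_iff by (intro divide_right_mono) auto
qed

text \<open>A single direction replaces the gradient: moving \<beta> along the score sum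
  \<open>u\<close> itself has derivative \<open>- (u \<bullet> u) / s\<close>, which must vanish at
  a maximum.\<close>

lemma is_mle_imp_score_eq_0:
  assumes mle: "is_mle f n (\<lambda>i. fst (Z i \<omega>)) (\<lambda>i. snd (Z i \<omega>)) \<beta> s"
  shows "(\<Sum>i<n. \<psi>' (theta \<beta> s \<bullet> Z i \<omega>) *\<^sub>R fst (Z i \<omega>)) = 0"
proof -
  have s: "0 < s" using mle by (simp add: is_mle_def)
  define u where "u = (\<Sum>i<n. \<psi>' (theta \<beta> s \<bullet> Z i \<omega>) *\<^sub>R fst (Z i \<omega>))"
  define r where "r i t = (snd (Z i \<omega>) - (\<beta> + t *\<^sub>R u) \<bullet> fst (Z i \<omega>)) / s" for i t
  define g where "g t = (\<Sum>i<n. ln (f (r i t)))" for t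
  have r0: "r i 0 = theta \<beta> s \<bullet> Z i \<omega>" for i by (simp add: r_def inner_theta)
  have "(g has_real_derivative (\<Sum>i<n. \<psi>' (r i 0) * (- (u \<bullet> fst (Z i \<omega>)) / s))) (at 0)"
    unfolding g_def
  proof (rule DERIV_sum)
    fix i
    have "(r i has_real_derivative - (u \<bullet> fst (Z i \<omega>)) / s) (at 0)"
      unfolding r_def inner_add_left inner_scaleR_left using s
      by (auto intro!: derivative_eq_intros)
    then show "((\<lambda>t. ln (f (r i t))) has_real_derivative \<psi>' (r i 0) * (- (u \<bullet> fst (Z i \<omega>)) / s)) (at 0)"
      by (rule DERIV_chain2[OF deriv_ln_f])
  qed
  moreover have "g t \<le> g 0" for t
  proof -
    have "- real n * ln s + g t \<le> - real n * ln s + g 0"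
      using mle s unfolding is_mle_iff g_def r_def by simp
    then show ?thesis by simp
  qed
  ultimately have "(\<Sum>i<n. \<psi>' (r i 0) * (- (u \<bullet> fst (Z i \<omega>)) / s)) = 0"
    by (intro DERIV_local_max[of g _ 0 1]) auto
  moreover have "(\<Sum>i<n. \<psi>' (r i 0) * (- (u \<bullet> fst (Z i \<omega>)) / s)) = - (u \<bullet> u) / s"
    unfolding r0 by (subst (3) u_def) (simp add: inner_sum_right sum_divide_distrib sum_negf)
  ultimately show ?thesis using s by (simp add: u_def[symmetric])
qed

text \<open>The increment of the process in \<open>u\<close> is controlled by the integral of its derivative, whose
  terms are centred because \<open>e \<mapsto> e \<psi>''(u e)\<close> is odd; hence no rate for the scale estimator is needed.\<close>

lemma score_process_equicontinuous:
  fixes u :: "nat \<Rightarrow> 'a \<Rightarrow> real"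
  assumes u [measurable]: "\<And>n. u n \<in> borel_measurable M"
    and lim: "((\<lambda>x. u (fst x) (snd x)) \<longlongrightarrow> 1) (whp M)"
  shows "((\<lambda>x. (1 / sqrt (real (fst x))) *\<^sub>R
      (\<Sum>i<fst x. \<psi>' (u (fst x) (snd x) * res (Z i (snd x))) *\<^sub>R fst (Z i (snd x)))
    - (1 / sqrt (real (fst x))) *\<^sub>R (\<Sum>i<fst x. \<psi>' (res (Z i (snd x))) *\<^sub>R fst (Z i (snd x)))) \<longlongrightarrow> 0) (whp M)"
proof (rule vec_tendstoI)
  fix k
  define W where "W n v \<omega> = (\<Sum>i<n. fst (Z i \<omega>) $ k * \<psi>' (v * res (Z i \<omega>))) / sqrt (real n)" for n v \<omega>
  define g where "g v z = fst z $ k * (res z * \<psi>'' (v * res z))" for v and z :: "(real ^ 'n) \<times> real"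
  define W' where "W' n v \<omega> = (\<Sum>i<n. g v (Z i \<omega>)) / sqrt (real n)" for n v \<omega>
  have W_meas [measurable]: "(\<lambda>\<omega>. W n (v \<omega>) \<omega>) \<in> borel_measurable M"
    if [measurable]: "v \<in> borel_measurable M" for n v unfolding W_def by measurable
  have g_meas [measurable]: "g v \<in> borel_measurable borel" for v unfolding g_def by measurable
  have deriv: "((\<lambda>v. W n v \<omega>) has_real_derivative W' n v \<omega>) (at v)" for n v \<omega>
  proof -
    have "((\<lambda>v. \<psi>' (v * r)) has_real_derivative r * \<psi>'' (v * r)) (at v)" for r
    proof -
      have "((\<lambda>v. v * r) has_real_derivative r) (at v)" by (auto intro!: derivative_eq_intros)
      from DERIV_chain2[OF deriv_score this] show ?thesis by (simp add: mult.commute)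
    qed
    then show ?thesis unfolding W_def W'_def g_def by (intro DERIV_cdivide DERIV_sum DERIV_cmult)
  qed
  have cont: "isCont (\<lambda>v. W' n v \<omega>) v" for n v \<omega>
    unfolding W'_def g_def divide_inverse by (intro continuous_intros isCont_o2[OF _ isCont_score_deriv])
  \<comment> \<open>Bounds the mean of \<open>\<bar>W' n v \<omega>\<bar>\<close> uniformly in
    \<open>n\<close> and \<open>v\<close>: the second moment is at most \<open>c - 1\<close>, and
    \<open>\<bar>x\<bar> \<le> 1 + x\<^sup>2\<close>.\<close>
  define c where "c = 1 + Q $ k $ k * (K\<^sup>2 * m\<^sub>2)"
  have Qkk: "0 \<le> Q $ k $ k" unfolding Q_def by simp
  have c: "1 \<le> c" using Qkk m2_pos by (simp add: c_def)
  have second_moment: "integrable M (\<lambda>\<omega>. (W' n v \<omega>)\<^sup>2)" "expectation (\<lambda>\<omega>. (W' n v \<omega>)\<^sup>2) \<le> c - 1" for n v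
  proof -
    have b: "integrable F (\<lambda>e. (e * \<psi>'' (v * e))\<^sup>2)" "(\<integral>e. (e * \<psi>'' (v * e))\<^sup>2 \<partial>F) \<le> K\<^sup>2 * m\<^sub>2"
    proof -
      have bd: "(e * \<psi>'' (v * e))\<^sup>2 \<le> K\<^sup>2 * e\<^sup>2" for e
      proof -
        have "(\<psi>'' (v * e))\<^sup>2 \<le> K\<^sup>2"
          using power_mono[OF score_deriv_bound[of "v * e"], of 2] by simp
        from mult_right_mono[OF this, of "e\<^sup>2"] show ?thesis
          by (simp add: power_mult_distrib mult.commute)
      qed
      show i: "integrable F (\<lambda>e. (e * \<psi>'' (v * e))\<^sup>2)"
      proof (rule int_F_quadratic_growth)
        show "\<bar>(e * \<psi>'' (v * e))\<^sup>2\<bar> \<le> 0 + K\<^sup>2 * e\<^sup>2" for e using bd[of e] by simp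
      qed measurable
      have "(\<integral>e. (e * \<psi>'' (v * e))\<^sup>2 \<partial>F) \<le> (\<integral>e. K\<^sup>2 * e\<^sup>2 \<partial>F)"
        using int_F_sq by (intro integral_mono i bd) simp
      then show "(\<integral>e. (e * \<psi>'' (v * e))\<^sup>2 \<partial>F) \<le> K\<^sup>2 * m\<^sub>2" by (simp add: m\<^sub>2_def)
    qed
    have int_b: "integrable F (\<lambda>e. e * \<psi>'' (v * e))"
      by (rule F.square_integrable_imp_integrable[OF _ b(1)]) measurable
    have a: "integrable P\<^sub>X (\<lambda>x. (x $ k)\<^sup>2)" using int_PX_prod[of k k] by (simp add: power2_eq_square)
    have sq: "(g v z)\<^sup>2 = (fst z $ k)\<^sup>2 * (res z * \<psi>'' (v * res z))\<^sup>2" for z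
      by (simp add: g_def power_mult_distrib)
    have g_sq: "integrable D (\<lambda>z. (g v z)\<^sup>2)"
      unfolding sq by (rule product_D(1)[OF a b(1)])
    have g_mean: "(\<integral>z. g v z \<partial>D) = 0"
      unfolding g_def
      by (subst product_D(2)[OF int_PX_component int_b], subst integral_F_odd)
        (simp_all add: score_deriv_even)
    have W'_sq: "(W' n v \<omega>)\<^sup>2 = (\<Sum>i<n. g v (Z i \<omega>))\<^sup>2 / real n" for \<omega>
      by (simp add: W'_def power_divide)
    show "integrable M (\<lambda>\<omega>. (W' n v \<omega>)\<^sup>2)"
      unfolding W'_sq using sum_square_expectation(1)[OF g_meas g_sq g_mean] by simp
    have "expectation (\<lambda>\<omega>. (W' n v \<omega>)\<^sup>2) \<le> (\<integral>z. (g v z)\<^sup>2 \<partial>D)"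
      unfolding W'_sq using sum_square_expectation(2)[OF g_meas g_sq g_mean, of n] by simp
    also have "\<dots> = Q $ k $ k * (\<integral>e. (e * \<psi>'' (v * e))\<^sup>2 \<partial>F)"
      unfolding sq by (subst product_D(2)[OF a b(1)]) (simp add: Q_def power2_eq_square)
    also have "\<dots> \<le> Q $ k $ k * (K\<^sup>2 * m\<^sub>2)" by (rule mult_left_mono[OF b(2) Qkk])
    finally show "expectation (\<lambda>\<omega>. (W' n v \<omega>)\<^sup>2) \<le> c - 1" by (simp add: c_def)
  qed
  have W'_meas [measurable]: "W' n v \<in> borel_measurable M" for n v unfolding W'_def by measurable
  have joint [measurable]: "(\<lambda>p. W' n (snd p) (fst p)) \<in> borel_measurable (M \<Otimes>\<^sub>M lborel)" for n
    unfolding W'_def g_def by measurable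
  have abs_moment: "(\<integral>\<^sup>+\<omega>. ennreal \<bar>W' n v \<omega>\<bar> \<partial>M) \<le> ennreal c" for n v
  proof -
    have "(\<integral>\<^sup>+\<omega>. ennreal \<bar>W' n v \<omega>\<bar> \<partial>M) \<le> (\<integral>\<^sup>+\<omega>. ennreal (1 + (W' n v \<omega>)\<^sup>2) \<partial>M)"
    proof (intro nn_integral_mono ennreal_leI)
      fix \<omega>
      have "0 \<le> (\<bar>W' n v \<omega>\<bar> - 1)\<^sup>2" by simp
      then have "2 * \<bar>W' n v \<omega>\<bar> \<le> 1 + (W' n v \<omega>)\<^sup>2" by (simp add: power2_diff)
      then show "\<bar>W' n v \<omega>\<bar> \<le> 1 + (W' n v \<omega>)\<^sup>2" using abs_ge_zero[of "W' n v \<omega>"] by linarith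
    qed
    also have "\<dots> = ennreal (expectation (\<lambda>\<omega>. 1 + (W' n v \<omega>)\<^sup>2))"
      using second_moment(1) by (intro nn_integral_eq_integral) auto
    also have "expectation (\<lambda>\<omega>. 1 + (W' n v \<omega>)\<^sup>2) = 1 + expectation (\<lambda>\<omega>. (W' n v \<omega>)\<^sup>2)"
      using second_moment(1) by (simp add: prob_space)
    also have "ennreal \<dots> \<le> ennreal c" using second_moment(2)[of n v] by (intro ennreal_leI) simp
    finally show ?thesis .
  qed
  interpret pairM: pair_sigma_finite M "lborel :: real measure" by standard
  \<comment> \<open>Dominates the increments between all pairs of points of the interval at once,
    hence also at the random point \<open>u n \<omega>\<close>, while its mean needs moments only at
    fixed \<open>v\<close>.\<close>
  define J where "J n \<gamma> \<omega> = (\<integral>\<^sup>+v. ennreal \<bar>W' n v \<omega>\<bar> * indicator {1 - \<gamma>..1 + \<gamma>} v \<partial>lborel)" for n \<gamma> \<omega>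
  have J_meas [measurable]: "J n \<gamma> \<in> borel_measurable M" for n \<gamma>
    unfolding J_def
    by (rule lborel.borel_measurable_nn_integral)
      (use joint[of n] in \<open>simp add: split_beta'\<close>)
  have J_int: "(\<integral>\<^sup>+\<omega>. J n \<gamma> \<omega> \<partial>M) \<le> ennreal (c * (2 * \<gamma>))" if "0 \<le> \<gamma>" for n \<gamma>
  proof -
    have "(\<integral>\<^sup>+\<omega>. J n \<gamma> \<omega> \<partial>M) = (\<integral>\<^sup>+v. \<integral>\<^sup>+\<omega>. ennreal \<bar>W' n v \<omega>\<bar> * indicator {1 - \<gamma>..1 + \<gamma>} v \<partial>M \<partial>lborel)"
      unfolding J_def using pairM.Fubini[of "\<lambda>p. ennreal \<bar>W' n (snd p) (fst p)\<bar> * indicator {1 - \<gamma>..1 + \<gamma>} (snd p)"]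
      by simp
    also have "\<dots> = (\<integral>\<^sup>+v. (\<integral>\<^sup>+\<omega>. ennreal \<bar>W' n v \<omega>\<bar> \<partial>M) * indicator {1 - \<gamma>..1 + \<gamma>} v \<partial>lborel)"
      by (intro nn_integral_cong nn_integral_multc) measurable
    also have "\<dots> \<le> (\<integral>\<^sup>+v. ennreal c * indicator {1 - \<gamma>..1 + \<gamma>} v \<partial>lborel)"
      by (intro nn_integral_mono mult_right_mono abs_moment) simp
    also have "\<dots> = ennreal (c * (2 * \<gamma>))"
      using that c by (simp add: nn_integral_cmult_indicator ennreal_mult')
    finally show ?thesis .
  qed
  have increment: "ennreal \<bar>W n b \<omega> - W n a \<omega>\<bar> \<le> J n \<gamma> \<omega>"
    if "a \<le> b" "1 - \<gamma> \<le> a" "b \<le> 1 + \<gamma>" for n a b \<gamma> \<omega>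
  proof -
    have "(\<integral>v. W' n v \<omega> * indicator {a..b} v \<partial>lborel) = W n b \<omega> - W n a \<omega>"
      by (rule integral_FTC_Icc_real[OF that(1) deriv cont])
    then have "ennreal \<bar>W n b \<omega> - W n a \<omega>\<bar> = ennreal (norm (\<integral>v. W' n v \<omega> * indicator {a..b} v \<partial>lborel))"
      by simp
    also have "\<dots> \<le> (\<integral>\<^sup>+v. ennreal (norm (W' n v \<omega> * indicator {a..b} v)) \<partial>lborel)"
    proof (cases "integrable lborel (\<lambda>v. W' n v \<omega> * indicator {a..b} v)")
      case True then show ?thesis by (rule integral_norm_bound_ennreal)
    next
      \<comment> \<open>The integral is then 0 by convention and the bound is trivial.\<close>
      case False then show ?thesis by (simp add: not_integrable_integral_eq)
    qed
    also have "\<dots> \<le> J n \<gamma> \<omega>"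
      unfolding J_def using that by (intro nn_integral_mono) (auto simp: indicator_def)
    finally show ?thesis .
  qed
  have "((\<lambda>x. W (fst x) (u (fst x) (snd x)) (snd x) - W (fst x) 1 (snd x)) \<longlongrightarrow> 0) (whp M)"
  proof (rule tendstoI)
    fix e :: real assume e: "0 < e"
    show "\<forall>\<^sub>F x in whp M. dist (W (fst x) (u (fst x) (snd x)) (snd x) - W (fst x) 1 (snd x)) 0 < e"
    proof (rule eventually_whp_if_tight)
      fix n
      show "{\<omega>\<in>space M. dist (W (fst (n, \<omega>)) (u (fst (n, \<omega>)) (snd (n, \<omega>))) (snd (n, \<omega>)) - W (fst (n, \<omega>)) 1 (snd (n, \<omega>))) 0 < e} \<in> events"
        unfolding fst_conv snd_conv by measurable
    next
      fix \<delta> :: real assume \<delta>: "0 < \<delta>"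
      \<comment> \<open>Markov's inequality gives failure probability at most
        \<open>c * (2 * \<gamma>) / e\<close>, which is \<open>\<delta> / 2\<close>.\<close>
      define \<gamma> where "\<gamma> = \<delta> * e / (4 * c)"
      have \<gamma>: "0 < \<gamma>" using \<delta> e c by (simp add: \<gamma>_def)
      define G where "G n = {\<omega>\<in>space M. J n \<gamma> \<omega> < ennreal e}" for n
      have G: "G n \<in> events" for n unfolding G_def by measurable
      have probG: "1 - \<delta> < prob (G n)" for n
      proof -
        have "emeasure M (space M - G n) \<le> emeasure M {\<omega>\<in>space M. 1 \<le> ennreal (1 / e) * J n \<gamma> \<omega>}"
        proof (rule emeasure_mono)
          show "space M - G n \<subseteq> {\<omega>\<in>space M. 1 \<le> ennreal (1 / e) * J n \<gamma> \<omega>}"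
          proof
            fix \<omega> assume "\<omega> \<in> space M - G n"
            then have "\<omega> \<in> space M" "ennreal e \<le> J n \<gamma> \<omega>" by (auto simp: G_def not_less)
            then have "ennreal (1 / e) * ennreal e \<le> ennreal (1 / e) * J n \<gamma> \<omega>"
              by (intro mult_left_mono) auto
            then show "\<omega> \<in> {\<omega>\<in>space M. 1 \<le> ennreal (1 / e) * J n \<gamma> \<omega>}"
              using e \<open>\<omega> \<in> space M\<close> by (simp add: ennreal_mult[symmetric])
          qed
        qed measurable
        also have "\<dots> \<le> ennreal (1 / e) * (\<integral>\<^sup>+\<omega>. J n \<gamma> \<omega> * indicator (space M) \<omega> \<partial>M)"
          by (rule nn_integral_Markov_inequality) simp_all
        also have "(\<integral>\<^sup>+\<omega>. J n \<gamma> \<omega> * indicator (space M) \<omega> \<partial>M) = (\<integral>\<^sup>+\<omega>. J n \<gamma> \<omega> \<partial>M)"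
          by (intro nn_integral_cong) simp
        also have "ennreal (1 / e) * \<dots> \<le> ennreal (1 / e) * ennreal (c * (2 * \<gamma>))"
          using \<gamma> by (intro mult_left_mono J_int) auto
        also have "\<dots> = ennreal (\<delta> / 2)"
          using e c \<delta> by (simp add: ennreal_mult[symmetric] \<gamma>_def)
        finally have "prob (space M - G n) \<le> \<delta> / 2"
          using \<delta> by (simp add: emeasure_eq_measure)
        then show ?thesis using \<delta> prob_compl[OF G[of n]] by simp
      qed
      have "\<forall>\<^sub>F x in whp M. dist (u (fst x) (snd x)) 1 < \<gamma>" by (rule tendstoD[OF lim \<gamma>])
      then have "\<forall>\<^sub>F x in whp M. snd x \<in> G (fst x) \<longrightarrow>
          dist (W (fst x) (u (fst x) (snd x)) (snd x) - W (fst x) 1 (snd x)) 0 < e"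
      proof eventually_elim
        case (elim x)
        let ?u = "u (fst x) (snd x)"
        have "ennreal \<bar>W (fst x) ?u (snd x) - W (fst x) 1 (snd x)\<bar> \<le> J (fst x) \<gamma> (snd x)"
        proof (cases "1 \<le> ?u")
          case True
          then show ?thesis using elim \<gamma> by (intro increment) (auto simp: dist_real_def)
        next
          case False
          then have "ennreal \<bar>W (fst x) 1 (snd x) - W (fst x) ?u (snd x)\<bar> \<le> J (fst x) \<gamma> (snd x)"
            using elim \<gamma> by (intro increment) (auto simp: dist_real_def)
          then show ?thesis by (simp add: abs_minus_commute)
        qed
        then have "snd x \<in> G (fst x) \<Longrightarrow> ennreal \<bar>W (fst x) ?u (snd x) - W (fst x) 1 (snd x)\<bar> < ennreal e"
          by (auto simp: G_def)
        then show ?case using e by (simp add: ennreal_less_iff)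
      qed
      then show "\<exists>G. (\<forall>n. G n \<in> events) \<and> (\<forall>\<^sub>F n in sequentially. 1 - \<delta> < prob (G n)) \<and>
          (\<forall>\<^sub>F x in whp M. snd x \<in> G (fst x) \<longrightarrow>
            dist (W (fst x) (u (fst x) (snd x)) (snd x) - W (fst x) 1 (snd x)) 0 < e)"
        using G probG by (intro exI[of _ G]) simp
    qed
  qed
  then show "((\<lambda>x. ((1 / sqrt (real (fst x))) *\<^sub>R
      (\<Sum>i<fst x. \<psi>' (u (fst x) (snd x) * res (Z i (snd x))) *\<^sub>R fst (Z i (snd x)))
    - (1 / sqrt (real (fst x))) *\<^sub>R (\<Sum>i<fst x. \<psi>' (res (Z i (snd x))) *\<^sub>R fst (Z i (snd x)))) $ k) \<longlongrightarrow> 0 $ k) (whp M)"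
    by (simp add: W_def mult.commute)
qed

end

section \<open>The maximum likelihood estimator\<close>

context regression
begin

text \<open>Divided difference of the score. It makes the expansion exact without selecting an
  intermediate point for each observation, and the value on the diagonal keeps
  \<open>slope_mean_value\<close> true there.\<close>

definition slope :: "real \<Rightarrow> real \<Rightarrow> real" where
  "slope a b = (if a = b then \<psi>'' b else (\<psi>' a - \<psi>' b) / (a - b))"

lemma slope_mult: "slope a b * (a - b) = \<psi>' a - \<psi>' b"
  by (simp add: slope_def)

lemma slope_mean_value: "\<exists>t. 0 \<le> t \<and> t \<le> 1 \<and> slope a b = \<psi>'' (b + t * (a - b))"
proof (cases "a = b")
  case True
  then show ?thesis by (intro exI[of _ 0]) (simp add: slope_def)
next
  case False
  have "((\<lambda>t. \<psi>' (b + t * (a - b))) has_real_derivative \<psi>'' (b + t * (a - b)) * (a - b)) (at t)" for t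
    by (rule DERIV_chain2[OF deriv_score]) (auto intro!: derivative_eq_intros)
  then obtain t where "0 < t" "t < 1"
      "\<psi>' (b + 1 * (a - b)) - \<psi>' (b + 0 * (a - b)) = (1 - 0) * (\<psi>'' (b + t * (a - b)) * (a - b))"
    using MVT2[of 0 1 "\<lambda>t. \<psi>' (b + t * (a - b))" "\<lambda>t. \<psi>'' (b + t * (a - b)) * (a - b)"] by auto
  then show ?thesis using False by (intro exI[of _ t]) (simp add: slope_def)
qed

text \<open>Measurability of the chosen sequences makes the closeness event measurable, as needed to
  exploit maximality that holds only almost surely from some index on.\<close>

lemma theta_tendsto:
  fixes \<beta>h :: "nat \<Rightarrow> 'a \<Rightarrow> real ^ 'n" and sh :: "nat \<Rightarrow> 'a \<Rightarrow> real"
  assumes [measurable]: "\<And>n. \<beta>h n \<in> borel_measurable M" "\<And>n. sh n \<in> borel_measurable M"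
    and mle: "AE \<omega> in M. \<forall>\<^sub>F n in sequentially.
      is_mle f n (\<lambda>i. fst (Z i \<omega>)) (\<lambda>i. snd (Z i \<omega>)) (\<beta>h n \<omega>) (sh n \<omega>)"
  shows "((\<lambda>x. theta (\<beta>h (fst x) (snd x)) (sh (fst x) (snd x))) \<longlongrightarrow> \<theta>\<^sub>0) (whp M)"
proof (rule tendstoI)
  fix e :: real assume "0 < e"
  show "\<forall>\<^sub>F x in whp M. dist (theta (\<beta>h (fst x) (snd x)) (sh (fst x) (snd x))) \<theta>\<^sub>0 < e"
  proof (rule eventually_whp_if_AE_eventually[OF mle])
    show "\<forall>\<^sub>F x in whp M. is_mle f (fst x) (\<lambda>i. fst (Z i (snd x))) (\<lambda>i. snd (Z i (snd x)))
        (\<beta>h (fst x) (snd x)) (sh (fst x) (snd x)) \<longrightarrow>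
      dist (theta (\<beta>h (fst x) (snd x)) (sh (fst x) (snd x))) \<theta>\<^sub>0 < e"
      using maximisers_consistent[OF \<open>0 < e\<close>] eventually_whp_pos_nat
    proof eventually_elim
      case (elim x)
      show ?case
      proof
        assume m: "is_mle f (fst x) (\<lambda>i. fst (Z i (snd x))) (\<lambda>i. snd (Z i (snd x)))
            (\<beta>h (fst x) (snd x)) (sh (fst x) (snd x))"
        note max = is_mle_imp_maximiser[OF m elim(2)]
        have "0 < snd (theta (\<beta>h (fst x) (snd x)) (sh (fst x) (snd x)))"
          using max(1) by (simp add: theta_def)
        then show "dist (theta (\<beta>h (fst x) (snd x)) (sh (fst x) (snd x))) \<theta>\<^sub>0 < e"
          using elim(1) max(2) by blast
      qed
    qed
  next
    fix n
    have "{\<omega>\<in>space M. dist (theta (\<beta>h n \<omega>) (sh n \<omega>)) \<theta>\<^sub>0 < e} \<in> events"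
      unfolding theta_def by measurable
    then show "{\<omega>\<in>space M. dist (theta (\<beta>h (fst (n, \<omega>)) (snd (n, \<omega>))) (sh (fst (n, \<omega>)) (snd (n, \<omega>)))) \<theta>\<^sub>0 < e} \<in> events"
      by simp
  qed
qed

text \<open>Divided differences expand the score from \<open>\<beta>\<^sub>0\<close> to the estimate
  at the estimated scale; (A10), in the form \<open>hess\<close>, makes their weighted averages
  converge, and \<open>\<rho>\<close> collects the effect of the scale on the score at
  \<open>\<beta>\<^sub>0\<close>. The covariance factor is \<open>info\<close> over the square of
  \<open>info / s\<^sub>0\<close>.\<close>

theorem asymp_normal_mle:
  fixes \<beta>h :: "nat \<Rightarrow> 'a \<Rightarrow> real ^ 'n" and sh :: "nat \<Rightarrow> 'a \<Rightarrow> real"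
  assumes \<beta>h [measurable]: "\<And>n. \<beta>h n \<in> borel_measurable M"
    and sh [measurable]: "\<And>n. sh n \<in> borel_measurable M"
    and mle: "AE \<omega> in M. \<forall>\<^sub>F n in sequentially.
      is_mle f n (\<lambda>i. fst (Z i \<omega>)) (\<lambda>i. snd (Z i \<omega>)) (\<beta>h n \<omega>) (sh n \<omega>)"
    and S: "AE z in D. z \<in> S"
    and hess: "\<And>\<delta>. 0 < \<delta> \<Longrightarrow> \<exists>\<eta>>0. \<forall>\<beta> s. 0 < s \<longrightarrow> norm (\<beta> - \<beta>\<^sub>0) + \<bar>s - s\<^sub>0\<bar> \<le> \<eta> \<longrightarrow>
      (\<forall>z\<in>S. \<forall>j k. \<bar>fst z $ j * fst z $ k * (\<psi>'' (res z) / s\<^sub>0\<^sup>2 - \<psi>'' (theta \<beta> s \<bullet> z) / s\<^sup>2)\<bar> \<le> \<delta>)"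
  shows "asymp_normal M \<beta>h \<beta>\<^sub>0 ((s\<^sub>0\<^sup>2 / info) *\<^sub>R Q\<^sub>i\<^sub>n\<^sub>v)"
proof -
  define b where "b x = \<beta>h (fst x) (snd x)" for x
  define s where "s x = sh (fst x) (snd x)" for x
  have th: "((\<lambda>x. theta (b x) (s x)) \<longlongrightarrow> \<theta>\<^sub>0) (whp M)"
    unfolding b_def s_def by (rule theta_tendsto[OF \<beta>h sh mle])
  have inv_s: "((\<lambda>x. 1 / s x) \<longlongrightarrow> 1 / s\<^sub>0) (whp M)"
    using tendsto_snd[OF th] by (simp add: theta_def)
  have s_lim: "(s \<longlongrightarrow> s\<^sub>0) (whp M)"
    using tendsto_inverse[OF inv_s] s0_pos by simp
  have s_pos: "\<forall>\<^sub>F x in whp M. 0 < s x" by (rule order_tendstoD(1)[OF s_lim s0_pos])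
  have b_lim: "(b \<longlongrightarrow> \<beta>\<^sub>0) (whp M)"
  proof -
    have "((\<lambda>x. - (1 / s x) *\<^sub>R b x) \<longlongrightarrow> - (1 / s\<^sub>0) *\<^sub>R \<beta>\<^sub>0) (whp M)"
      using tendsto_fst[OF th] by (simp add: theta_def)
    from tendsto_scaleR[OF tendsto_minus[OF s_lim] this]
    have "((\<lambda>x. (- s x) *\<^sub>R (- (1 / s x) *\<^sub>R b x)) \<longlongrightarrow> (- s\<^sub>0) *\<^sub>R (- (1 / s\<^sub>0) *\<^sub>R \<beta>\<^sub>0)) (whp M)" .
    moreover have "(- s\<^sub>0) *\<^sub>R (- (1 / s\<^sub>0) *\<^sub>R \<beta>\<^sub>0) = \<beta>\<^sub>0" using s0_pos by simp
    ultimately have "((\<lambda>x. (- s x) *\<^sub>R (- (1 / s x) *\<^sub>R b x)) \<longlongrightarrow> \<beta>\<^sub>0) (whp M)" by simp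
    then show ?thesis
      by (rule Lim_transform_eventually) (use s_pos in \<open>auto elim!: eventually_mono\<close>)
  qed
  \<comment> \<open>Multiplying the true standardised residual by \<open>u\<close> standardises it
    with the estimated scale instead.\<close>
  define u where "u n \<omega> = s\<^sub>0 / sh n \<omega>" for n \<omega>
  have u_meas: "u n \<in> borel_measurable M" for n unfolding u_def by measurable
  have u_lim: "((\<lambda>x. u (fst x) (snd x)) \<longlongrightarrow> 1) (whp M)"
    using tendsto_mult[OF tendsto_const[of s\<^sub>0] inv_s] s0_pos by (simp add: u_def s_def)
  define \<rho> where "\<rho> n \<omega> = (1 / sqrt (real n)) *\<^sub>R (\<Sum>i<n. \<psi>' (u n \<omega> * res (Z i \<omega>)) *\<^sub>R fst (Z i \<omega>))
    - (1 / sqrt (real n)) *\<^sub>R (\<Sum>i<n. \<psi>' (res (Z i \<omega>)) *\<^sub>R fst (Z i \<omega>))" for n \<omega>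
  have \<rho>: "((\<lambda>x. \<rho> (fst x) (snd x)) \<longlongrightarrow> 0) (whp M)"
    unfolding \<rho>_def by (rule score_process_equicontinuous[OF u_meas u_lim])
  define q where "q x z = slope (theta (b x) (s x) \<bullet> z) (u (fst x) (snd x) * res z)" for x and z :: "(real ^ 'n) \<times> real"
  define A where "A n \<omega> = (1 / (real n * sh n \<omega>)) *\<^sub>R (\<Sum>i<n. q (n, \<omega>) (Z i \<omega>) *\<^sub>R outer_prod (fst (Z i \<omega>)))" for n \<omega>
  have res_u: "u (fst x) (snd x) * res z = theta \<beta>\<^sub>0 (s x) \<bullet> z" for x z
    using s0_pos by (simp add: u_def s_def inner_theta)
  have close: "\<forall>\<^sub>F x in whp M. \<forall>z\<in>S. \<forall>j k.
      \<bar>fst z $ j * fst z $ k * (\<psi>'' (res z) / s\<^sub>0\<^sup>2 - q x z / (s x)\<^sup>2)\<bar> \<le> \<delta>" if \<delta>: "0 < \<delta>" for \<delta>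
  proof -
    obtain \<eta> where \<eta>: "0 < \<eta>" and h: "\<And>\<beta> s z j k. 0 < s \<Longrightarrow> norm (\<beta> - \<beta>\<^sub>0) + \<bar>s - s\<^sub>0\<bar> \<le> \<eta> \<Longrightarrow> z \<in> S \<Longrightarrow>
      \<bar>fst z $ j * fst z $ k * (\<psi>'' (res z) / s\<^sub>0\<^sup>2 - \<psi>'' (theta \<beta> s \<bullet> z) / s\<^sup>2)\<bar> \<le> \<delta>"
      using hess[OF \<delta>] by blast
    have "((\<lambda>x. norm (b x - \<beta>\<^sub>0) + \<bar>s x - s\<^sub>0\<bar>) \<longlongrightarrow> norm (\<beta>\<^sub>0 - \<beta>\<^sub>0) + \<bar>s\<^sub>0 - s\<^sub>0\<bar>) (whp M)"
      by (intro tendsto_intros b_lim s_lim)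
    then have "\<forall>\<^sub>F x in whp M. norm (b x - \<beta>\<^sub>0) + \<bar>s x - s\<^sub>0\<bar> < \<eta>"
      by (rule order_tendstoD) (simp add: \<eta>)
    with s_pos show ?thesis
    proof eventually_elim
      case (elim x)
      show ?case
      proof (intro ballI allI)
        fix z j k assume z: "z \<in> S"
        \<comment> \<open>The intermediate point depends on the observation, but it is the residual
          for a vector on the segment from \<open>\<beta>\<^sub>0\<close> to the estimate, at the
          same scale; uniformity of \<open>hess\<close> absorbs the dependence.\<close>
        obtain t where t: "0 \<le> t" "t \<le> 1"
          and q: "q x z = \<psi>'' (theta \<beta>\<^sub>0 (s x) \<bullet> z + t * (theta (b x) (s x) \<bullet> z - theta \<beta>\<^sub>0 (s x) \<bullet> z))"
          using slope_mean_value unfolding q_def res_u by blast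
        have "theta \<beta>\<^sub>0 (s x) \<bullet> z + t * (theta (b x) (s x) \<bullet> z - theta \<beta>\<^sub>0 (s x) \<bullet> z)
            = theta (\<beta>\<^sub>0 + t *\<^sub>R (b x - \<beta>\<^sub>0)) (s x) \<bullet> z"
          using elim(1) by (simp add: inner_theta inner_add_left inner_diff_left field_simps)
        moreover have "norm (\<beta>\<^sub>0 + t *\<^sub>R (b x - \<beta>\<^sub>0) - \<beta>\<^sub>0) \<le> norm (b x - \<beta>\<^sub>0)"
          using t mult_right_mono[of t 1 "norm (b x - \<beta>\<^sub>0)"] by simp
        ultimately show "\<bar>fst z $ j * fst z $ k * (\<psi>'' (res z) / s\<^sub>0\<^sup>2 - q x z / (s x)\<^sup>2)\<bar> \<le> \<delta>"
          unfolding q using elim z h[of "s x" "\<beta>\<^sub>0 + t *\<^sub>R (b x - \<beta>\<^sub>0)" z j k] by simp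
      qed
    qed
  qed
  have in_S: "\<forall>\<^sub>F x in whp M. \<forall>i. Z i (snd x) \<in> S"
    by (rule AE_imp_eventually_whp) (use AE_Z[OF S] in simp)
  have A: "((\<lambda>x. A (fst x) (snd x) $ j $ k) \<longlongrightarrow> (- info / s\<^sub>0) * Q $ j $ k) (whp M)" for j k
  proof -
    define a where "a x = avg (\<lambda>z. (fst z $ j * fst z $ k) * (\<psi>'' (res z) / s\<^sub>0\<^sup>2)) (fst x) (snd x)" for x
    define a' where "a' x = avg (\<lambda>z. (fst z $ j * fst z $ k) * (q x z / (s x)\<^sup>2)) (fst x) (snd x)" for x
    have a: "(a \<longlongrightarrow> Q $ j $ k * (- info / s\<^sub>0\<^sup>2)) (whp M)"
      unfolding a_def using avg_outer_tendsto[of "\<lambda>e. \<psi>'' e / s\<^sub>0\<^sup>2" j k] int_score_deriv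
      by (simp add: integral_score_deriv)
    have "((\<lambda>x. a' x - a x) \<longlongrightarrow> 0) (whp M)"
    proof (rule tendstoI)
      fix e :: real assume "0 < e"
      then have "0 < e / 2" by simp
      show "\<forall>\<^sub>F x in whp M. dist (a' x - a x) 0 < e"
        using close[OF \<open>0 < e / 2\<close>] in_S eventually_whp_pos_nat
      proof eventually_elim
        case (elim x)
        have "\<bar>a' x - a x\<bar> \<le> (\<Sum>i<fst x. e / 2) / real (fst x)"
          unfolding a'_def a_def avg_def diff_divide_distrib[symmetric] sum_subtractf[symmetric]
            abs_divide abs_of_nat
        proof (rule divide_right_mono)
          show "\<bar>\<Sum>i<fst x. fst (Z i (snd x)) $ j * fst (Z i (snd x)) $ k * (q x (Z i (snd x)) / (s x)\<^sup>2)
              - fst (Z i (snd x)) $ j * fst (Z i (snd x)) $ k * (\<psi>'' (res (Z i (snd x))) / s\<^sub>0\<^sup>2)\<bar> \<le> (\<Sum>i<fst x. e / 2)"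
          proof (rule order_trans[OF sum_abs sum_mono])
            fix i
            have "\<bar>fst (Z i (snd x)) $ j * fst (Z i (snd x)) $ k *
                (\<psi>'' (res (Z i (snd x))) / s\<^sub>0\<^sup>2 - q x (Z i (snd x)) / (s x)\<^sup>2)\<bar> \<le> e / 2"
              using elim(1,2) by blast
            then show "\<bar>fst (Z i (snd x)) $ j * fst (Z i (snd x)) $ k * (q x (Z i (snd x)) / (s x)\<^sup>2)
              - fst (Z i (snd x)) $ j * fst (Z i (snd x)) $ k * (\<psi>'' (res (Z i (snd x))) / s\<^sub>0\<^sup>2)\<bar> \<le> e / 2"
              unfolding right_diff_distrib[symmetric] abs_mult by (simp only: abs_minus_commute)
          qed
        qed simp
        also have "\<dots> < e" using elim(3) \<open>0 < e\<close> by simp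
        finally show ?case by simp
      qed
    qed
    from tendsto_add[OF this a] have "(a' \<longlongrightarrow> Q $ j $ k * (- info / s\<^sub>0\<^sup>2)) (whp M)" by simp
    \<comment> \<open>\<open>A\<close> carries \<open>1 / s x\<close> where second derivatives carry
      \<open>1 / (s x)\<^sup>2\<close>; the factor \<open>s x\<close> makes up the
      difference.\<close>
    from tendsto_mult[OF s_lim this]
    have "((\<lambda>x. s x * a' x) \<longlongrightarrow> s\<^sub>0 * (Q $ j $ k * (- info / s\<^sub>0\<^sup>2))) (whp M)" .
    moreover have "s\<^sub>0 * (Q $ j $ k * (- info / s\<^sub>0\<^sup>2)) = (- info / s\<^sub>0) * Q $ j $ k"
      using s0_pos by (simp add: power2_eq_square)
    ultimately have lim: "((\<lambda>x. s x * a' x) \<longlongrightarrow> (- info / s\<^sub>0) * Q $ j $ k) (whp M)" by simp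
    have eq: "\<forall>\<^sub>F x in whp M. s x * a' x = A (fst x) (snd x) $ j $ k"
      using s_pos
    proof eventually_elim
      case (elim x)
      have "A (fst x) (snd x) $ j $ k = (\<Sum>i<fst x. fst (Z i (snd x)) $ j * fst (Z i (snd x)) $ k * q x (Z i (snd x))) / (real (fst x) * s x)"
        by (simp add: A_def s_def outer_prod_def mult_ac)
      then show ?case
        using elim by (simp add: a'_def avg_def sum_divide_distrib[symmetric] power2_eq_square)
    qed
    from lim eq show ?thesis by (rule Lim_transform_eventually)
  qed
  have score: "\<forall>\<^sub>F x in whp M. (\<Sum>i<fst x. \<psi>' (theta (b x) (s x) \<bullet> Z i (snd x)) *\<^sub>R fst (Z i (snd x))) = 0"
  proof (rule eventually_whp_if_AE_eventually[OF mle])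
    show "\<forall>\<^sub>F x in whp M. is_mle f (fst x) (\<lambda>i. fst (Z i (snd x))) (\<lambda>i. snd (Z i (snd x)))
        (\<beta>h (fst x) (snd x)) (sh (fst x) (snd x)) \<longrightarrow>
        (\<Sum>i<fst x. \<psi>' (theta (b x) (s x) \<bullet> Z i (snd x)) *\<^sub>R fst (Z i (snd x))) = 0"
      unfolding b_def s_def using is_mle_imp_score_eq_0 by (intro always_eventually) blast
    show "{\<omega>\<in>space M. (\<Sum>i<fst (n, \<omega>). \<psi>' (theta (b (n, \<omega>)) (s (n, \<omega>)) \<bullet> Z i (snd (n, \<omega>))) *\<^sub>R fst (Z i (snd (n, \<omega>)))) = 0} \<in> events" for n
      unfolding b_def s_def fst_conv snd_conv theta_def by measurable
  qed
  have "asymp_normal M \<beta>h \<beta>\<^sub>0 ((info / (- info / s\<^sub>0)\<^sup>2) *\<^sub>R Q\<^sub>i\<^sub>n\<^sub>v)"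
  proof (rule asymp_normal_if_linear_system[OF \<beta>h score_measurable int_score_sq _ info_def info_pos _ A \<rho>])
    show "(\<integral>e. \<psi>' e \<partial>F) = 0" by (rule integral_F_odd[OF score_measurable score_odd])
    show "- info / s\<^sub>0 \<noteq> 0" using info_pos s0_pos by simp
    show "\<forall>\<^sub>F x in whp M. A (fst x) (snd x) *v (sqrt (real (fst x)) *\<^sub>R (\<beta>h (fst x) (snd x) - \<beta>\<^sub>0)) =
      (1 / sqrt (real (fst x))) *\<^sub>R (\<Sum>i<fst x. \<psi>' (res (Z i (snd x))) *\<^sub>R fst (Z i (snd x))) + \<rho> (fst x) (snd x)"
      using score s_pos eventually_whp_pos_nat
    proof eventually_elim
      case (elim x)
      let ?n = "fst x" and ?\<omega> = "snd x"
      have sx: "s x = sh ?n ?\<omega>" "b x = \<beta>h ?n ?\<omega>" by (simp_all add: s_def b_def)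
      \<comment> \<open>The shift of the regression vector, paired with the covariate, is a
        difference of residuals times \<open>- s x\<close>, so \<open>slope_mult\<close> produces a
        difference of scores; the score equation later removes one of the two.\<close>
      have summand: "q x z * (fst z \<bullet> (b x - \<beta>\<^sub>0)) = s x * (\<psi>' (u ?n ?\<omega> * res z) - \<psi>' (theta (b x) (s x) \<bullet> z))" for z
      proof -
        have "fst z \<bullet> (b x - \<beta>\<^sub>0) = - s x * (theta (b x) (s x) \<bullet> z - u ?n ?\<omega> * res z)"
          using elim(2) unfolding res_u unfolding inner_theta
          by (simp add: inner_diff_right inner_commute field_simps)
        then have "q x z * (fst z \<bullet> (b x - \<beta>\<^sub>0))
            = - s x * (q x z * (theta (b x) (s x) \<bullet> z - u ?n ?\<omega> * res z))" by simp
        then show ?thesis unfolding q_def slope_mult by (simp add: algebra_simps)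
      qed
      have "(\<Sum>i<?n. q x (Z i ?\<omega>) *\<^sub>R outer_prod (fst (Z i ?\<omega>))) *v (b x - \<beta>\<^sub>0)
          = (\<Sum>i<?n. (q x (Z i ?\<omega>) * (fst (Z i ?\<omega>) \<bullet> (b x - \<beta>\<^sub>0))) *\<^sub>R fst (Z i ?\<omega>))"
        by (simp add: sum_matrix_vector_mult scaleR_matrix_vector_assoc[symmetric] outer_prod_mult)
      also have "\<dots> = s x *\<^sub>R ((\<Sum>i<?n. \<psi>' (u ?n ?\<omega> * res (Z i ?\<omega>)) *\<^sub>R fst (Z i ?\<omega>))
          - (\<Sum>i<?n. \<psi>' (theta (b x) (s x) \<bullet> Z i ?\<omega>) *\<^sub>R fst (Z i ?\<omega>)))"
        unfolding summand by (simp add: scaleR_sum_right sum_subtractf[symmetric] scaleR_diff_left scaleR_diff_right right_diff_distrib)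
      also have "\<dots> = s x *\<^sub>R (\<Sum>i<?n. \<psi>' (u ?n ?\<omega> * res (Z i ?\<omega>)) *\<^sub>R fst (Z i ?\<omega>))"
        using elim(1) by simp
      finally have "A ?n ?\<omega> *v (sqrt (real ?n) *\<^sub>R (b x - \<beta>\<^sub>0)) =
          (sqrt (real ?n) / real ?n) *\<^sub>R (\<Sum>i<?n. \<psi>' (u ?n ?\<omega> * res (Z i ?\<omega>)) *\<^sub>R fst (Z i ?\<omega>))"
        using elim(2) by (simp add: A_def scaleR_matrix_vector_assoc[symmetric]
          linear_scale[OF matrix_vector_mul_linear] sx)
      also have "sqrt (real ?n) / real ?n = 1 / sqrt (real ?n)"
        using elim(3) by (simp add: field_simps)
      finally show ?case by (simp add: \<rho>_def sx)
    qed
  qed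
  then show ?thesis using info_pos s0_pos by (simp add: power2_eq_square)
qed

end

section \<open>The asymptotic relative efficiency\<close>

text \<open>The complement of the support is the union of all open null sets, and Lindelof's
  property reduces it to a countable union.\<close>

lemma AE_measure_support:
  fixes D :: "'a::second_countable_topology measure"
  assumes [measurable_cong, simp]: "sets D = sets borel"
  shows "AE z in D. z \<in> measure_support D"
proof -
  define \<U> where "\<U> = {U. open U \<and> emeasure D U = 0}"
  obtain \<U>' where \<U>': "\<U>' \<subseteq> \<U>" "countable \<U>'" "\<Union>\<U>' = \<Union>\<U>"
    using Lindelof[of \<U>] by (auto simp: \<U>_def)
  have "\<Union>\<U>' \<in> null_sets D"
  proof (rule null_sets_UN'[of \<U>' "\<lambda>U. U" D, simplified])
    show "countable \<U>'" by fact
    show "U \<in> null_sets D" if "U \<in> \<U>'" for U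
      using that \<U>'(1) by (auto simp: \<U>_def null_sets_def borel_open)
  qed
  then have "AE z in D. z \<notin> \<Union>\<U>" unfolding \<U>'(3) by (rule AE_not_in)
  then show ?thesis
    by eventually_elim (auto simp: \<U>_def measure_support_def zero_less_iff_neq_zero)
qed

text \<open>Translates (A10) into a condition on \<open>\<psi>''\<close>: the term
  \<open>- ln s\<close> disappears on differentiation in \<beta>, and the signs of the two inner
  derivatives cancel.\<close>

lemma second_partial_deriv_ln_scaled_density:
  fixes f \<psi>' \<psi>'' :: "real \<Rightarrow> real" and x :: "real ^ 'n"
  assumes f: "\<And>t. 0 < f t" and d1: "\<And>t. ((\<lambda>t. ln (f t)) has_real_derivative \<psi>' t) (at t)"
    and d2: "\<And>t. (\<psi>' has_real_derivative \<psi>'' t) (at t)" and s: "0 < s"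
  shows "partial_deriv i (partial_deriv j (\<lambda>\<beta>. ln (scaled_density f s (y - \<beta> \<bullet> x)))) \<beta> =
    x $ i * x $ j * (\<psi>'' ((y - \<beta> \<bullet> x) / s) / s\<^sup>2)"
proof -
  have arg: "((\<lambda>t. (y - (\<beta> + t *\<^sub>R axis k 1) \<bullet> x) / s) has_real_derivative - (x $ k) / s) (at 0)" for k \<beta>
    unfolding inner_add_left inner_scaleR_left inner_axis' using s
    by (auto intro!: derivative_eq_intros)
  have ln_eq: "ln (scaled_density f s t) = ln (f (t / s)) - ln s" for t
    using f s by (simp add: scaled_density_def ln_div less_imp_neq[OF f, symmetric])
  have first: "partial_deriv j (\<lambda>\<beta>. ln (scaled_density f s (y - \<beta> \<bullet> x))) =
      (\<lambda>\<beta>. \<psi>' ((y - \<beta> \<bullet> x) / s) * (- (x $ j) / s))"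
  proof
    fix \<beta>
    have "((\<lambda>t. ln (f ((y - (\<beta> + t *\<^sub>R axis j 1) \<bullet> x) / s)) - ln s) has_real_derivative
        \<psi>' ((y - (\<beta> + 0 *\<^sub>R axis j 1) \<bullet> x) / s) * (- (x $ j) / s) - 0) (at 0)"
      by (intro DERIV_diff DERIV_const DERIV_chain2[OF d1 arg])
    then show "partial_deriv j (\<lambda>\<beta>. ln (scaled_density f s (y - \<beta> \<bullet> x))) \<beta> =
        \<psi>' ((y - \<beta> \<bullet> x) / s) * (- (x $ j) / s)"
      unfolding partial_deriv_def ln_eq by (intro DERIV_imp_deriv) simp
  qed
  have "((\<lambda>t. \<psi>' ((y - (\<beta> + t *\<^sub>R axis i 1) \<bullet> x) / s) * (- (x $ j) / s)) has_real_derivative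
      \<psi>'' ((y - (\<beta> + 0 *\<^sub>R axis i 1) \<bullet> x) / s) * (- (x $ i) / s) * (- (x $ j) / s)) (at 0)"
    by (intro DERIV_cmult_right DERIV_chain2[OF d2 arg])
  then have "partial_deriv i (\<lambda>\<beta>. \<psi>' ((y - \<beta> \<bullet> x) / s) * (- (x $ j) / s)) \<beta> =
      \<psi>'' ((y - \<beta> \<bullet> x) / s) * (- (x $ i) / s) * (- (x $ j) / s)"
    unfolding partial_deriv_def by (intro DERIV_imp_deriv) simp
  then show ?thesis unfolding first by (simp add: power2_eq_square)
qed

text \<open>If \<open>f\<close> had compact support, then for small \<open>a\<close> the argument of \<open>f\<close> would leave the support
  with positive probability, where the logarithm is infinite.\<close>

lemma (in prob_space) density_pos_if_log_moments:
  fixes f :: "real \<Rightarrow> real" and V :: "'a \<Rightarrow> real"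
  assumes [measurable]: "V \<in> borel_measurable M" and V: "\<And>\<omega>. \<omega> \<in> space M \<Longrightarrow> 0 \<le> V \<omega>"
    and nonzero: "\<not> (AE \<omega> in M. V \<omega> = 0)"
    and f_nonneg: "\<And>t. 0 \<le> f t" and even: "\<And>t. f (- t) = f t" and anti: "antimono_on {0..} f"
    and finite: "\<And>a. 0 < a \<Longrightarrow> (\<integral>\<^sup>+ \<omega>. e2ennreal ((log_ext (f (V \<omega> / a)))\<^sup>2) \<partial>M) < \<infinity>"
  shows "0 < f t"
proof (rule ccontr)
  assume "\<not> 0 < f t"
  then have "f \<bar>t\<bar> = 0" using f_nonneg[of t] even[of t] by (cases "0 \<le> t") auto
  then have zero: "f x = 0" if "\<bar>t\<bar> \<le> x" for x
    using anti f_nonneg[of x] that by (force simp: monotone_on_def)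
  have small: "AE \<omega> in M. V \<omega> / a < \<bar>t\<bar>" if a: "0 < a" for a
  proof -
    define E where "E = {\<omega>\<in>space M. \<bar>t\<bar> \<le> V \<omega> / a}"
    have E: "E \<in> events" unfolding E_def by measurable
    \<comment> \<open>On \<open>E\<close> the density vanishes and the squared logarithm is
      infinite, so a finite integral forces \<open>E\<close> to be null.\<close>
    have "top * emeasure M E = (\<integral>\<^sup>+\<omega>. top * indicator E \<omega> \<partial>M)"
      using E by (rule nn_integral_cmult_indicator[symmetric])
    also have "\<dots> \<le> (\<integral>\<^sup>+ \<omega>. e2ennreal ((log_ext (f (V \<omega> / a)))\<^sup>2) \<partial>M)"
    proof (rule nn_integral_mono)
      fix \<omega>
      show "top * indicator E \<omega> \<le> e2ennreal ((log_ext (f (V \<omega> / a)))\<^sup>2)"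
        by (cases "\<omega> \<in> E") (auto simp: E_def zero log_ext_def power2_eq_square)
    qed
    also have "\<dots> < \<infinity>" by (rule finite[OF a])
    finally have "emeasure M E = 0"
      by (cases "emeasure M E = 0") (auto simp: ennreal_top_mult)
    then have "E \<in> null_sets M" using E by (simp add: null_sets_def)
    then have "AE \<omega> in M. \<omega> \<notin> E" by (rule AE_not_in)
    with AE_space show ?thesis by eventually_elim (auto simp: E_def)
  qed
  \<comment> \<open>Countably many scales suffice, and by the Archimedean property only
    \<open>V \<omega> = 0\<close> passes them all.\<close>
  have "AE \<omega> in M. V \<omega> / (1 / real (Suc n)) < \<bar>t\<bar>" for n by (rule small) simp
  then have "AE \<omega> in M. \<forall>n. V \<omega> / (1 / real (Suc n)) < \<bar>t\<bar>" by (simp add: AE_all_countable)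
  then have "AE \<omega> in M. V \<omega> = 0"
  proof (rule AE_mp[OF _ AE_I2], intro impI)
    fix \<omega> assume \<omega>: "\<omega> \<in> space M" and *: "\<forall>n. V \<omega> / (1 / real (Suc n)) < \<bar>t\<bar>"
    show "V \<omega> = 0"
    proof (rule ccontr)
      assume "V \<omega> \<noteq> 0"
      then have "0 < V \<omega>" using V[OF \<omega>] by simp
      then obtain n where "\<bar>t\<bar> < real n * V \<omega>" using reals_Archimedean3 by blast
      moreover have "V \<omega> * real (Suc n) < \<bar>t\<bar>" using * by simp
      ultimately show False using \<open>0 < V \<omega>\<close> by (simp add: algebra_simps)
    qed
  qed
  with nonzero show False ..
qed

lemma (in prob_space) joint_distr_if_indep_rvs:
  fixes X :: "'a \<Rightarrow> 'b::second_countable_topology" and E :: "'a \<Rightarrow> 'c::second_countable_topology"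
    and g :: "'c \<Rightarrow> 'd::second_countable_topology"
  assumes indep: "indep_rvs M X E" and g [measurable]: "g \<in> borel_measurable borel"
  shows "distr M (borel \<Otimes>\<^sub>M borel) (\<lambda>\<omega>. (X \<omega>, g (E \<omega>))) = distr M borel X \<Otimes>\<^sub>M distr M borel (\<lambda>\<omega>. g (E \<omega>))"
proof -
  have [measurable]: "X \<in> borel_measurable M" "E \<in> borel_measurable M"
    using indep by (simp_all add: indep_rvs_def)
  interpret X: prob_space "distr M borel X" by (rule prob_space_distr) simp
  interpret G: prob_space "distr M borel (\<lambda>\<omega>. g (E \<omega>))" by (rule prob_space_distr) simp
  have "distr M borel X \<Otimes>\<^sub>M distr M borel (\<lambda>\<omega>. g (E \<omega>)) = distr M (borel \<Otimes>\<^sub>M borel) (\<lambda>\<omega>. (X \<omega>, g (E \<omega>)))"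
  proof (rule pair_measure_eqI)
    fix A B assume "A \<in> sets (distr M borel X)" "B \<in> sets (distr M borel (\<lambda>\<omega>. g (E \<omega>)))"
    then have A: "A \<in> sets borel" and B: "B \<in> sets borel" by simp_all
    have gB: "g -` B \<in> sets borel" using measurable_sets[OF g B] by simp
    have "prob ((X -` A \<inter> space M) \<inter> (E -` (g -` B) \<inter> space M)) =
        prob (X -` A \<inter> space M) * prob (E -` (g -` B) \<inter> space M)"
      using indep A gB unfolding indep_rvs_def by (intro indep_setD) auto
    moreover have "(\<lambda>\<omega>. (X \<omega>, g (E \<omega>))) -` (A \<times> B) \<inter> space M = (X -` A \<inter> space M) \<inter> (E -` (g -` B) \<inter> space M)"
      "(\<lambda>\<omega>. g (E \<omega>)) -` B \<inter> space M = E -` (g -` B) \<inter> space M" by auto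
    ultimately show "emeasure (distr M borel X) A * emeasure (distr M borel (\<lambda>\<omega>. g (E \<omega>))) B =
        emeasure (distr M (borel \<Otimes>\<^sub>M borel) (\<lambda>\<omega>. (X \<omega>, g (E \<omega>)))) (A \<times> B)"
      using A B by (simp add: emeasure_distr emeasure_eq_measure ennreal_mult[symmetric])
  qed (auto intro: X.sigma_finite_measure_axioms G.sigma_finite_measure_axioms cong: sets_pair_measure_cong)
  then show ?thesis by simp
qed

text \<open>The root in the definition of the efficiency undoes the power that scaling a determinant
  produces, and the common matrix cancels; only the scalar factors of the two covariances
  remain.\<close>

lemma powr_CARD_ratio:
  fixes P :: "real ^ 'n ^ 'n"
  assumes "0 < a" "0 < b" "det P \<noteq> 0"
  shows "(det (a *\<^sub>R P) / det (b *\<^sub>R P)) powr (1 / real CARD('n)) = a / b"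
proof -
  have "det (a *\<^sub>R P) / det (b *\<^sub>R P) = (a / b) ^ CARD('n)"
    using assms by (simp add: det_scaleR power_divide)
  also have "\<dots> = (a / b) powr real CARD('n)" using assms by (simp add: powr_realpow)
  finally show ?thesis using assms by (simp add: powr_powr)
qed

text \<open>The estimators are arbitrary measurable sequences that are maximisers from a random
  index on, since a maximiser is only guaranteed for large samples and may fail to be
  unique.\<close>

theorem proposition2:
  fixes M :: "'a measure"
    and X :: "'a \<Rightarrow> real ^ 'n" and Y \<epsilon> :: "'a \<Rightarrow> real"
    and Xs :: "nat \<Rightarrow> 'a \<Rightarrow> real ^ 'n" and Ys :: "nat \<Rightarrow> 'a \<Rightarrow> real"
    and \<beta>\<^sub>0 :: "real ^ 'n" and s\<^sub>0 :: real
    and f :: "real \<Rightarrow> real" and \<alpha> C :: real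
    and \<beta>_hat :: "nat \<Rightarrow> 'a \<Rightarrow> real ^ 'n" and s_hat :: "nat \<Rightarrow> 'a \<Rightarrow> real"
  assumes M: "prob_space M"
    and s0: "0 < s\<^sub>0"
    and model: "\<And>\<omega>. \<omega> \<in> space M \<Longrightarrow> Y \<omega> = \<beta>\<^sub>0 \<bullet> X \<omega> + \<epsilon> \<omega>"
    and iid: "prob_space.indep_vars M (\<lambda>_. borel) (\<lambda>i \<omega>. (Xs i \<omega>, Ys i \<omega>)) UNIV"
      "\<And>i. distr M borel (\<lambda>\<omega>. (Xs i \<omega>, Ys i \<omega>)) = distr M borel (\<lambda>\<omega>. (X \<omega>, Y \<omega>))"
    and A1: "indep_rvs M X \<epsilon>"
    and A2: "\<exists>f\<^sub>X. distributed M lborel X f\<^sub>X"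
    and A3: "distributed M lborel \<epsilon> (scaled_density f s\<^sub>0)"
      "\<And>t. 0 \<le> f t" "(\<integral>\<^sup>+ t. f t \<partial>lborel) = 1"
      "\<And>t. f (- t) = f t" "bounded (range f)" "continuous_on UNIV f"
      "integrable lborel (\<lambda>t. t\<^sup>2 * f t)"
    and A4: "0 < \<alpha>" "0 < C" "\<And>t. f t \<le> C * exp (- (\<bar>t\<bar> powr \<alpha>))"
    and A5: "(\<integral>\<^sup>+ \<omega>. e2ennreal \<bar>log_ext (f ((Y \<omega> - \<beta>\<^sub>0 \<bullet> X \<omega>) / s\<^sub>0))\<bar> \<partial>M) < \<infinity>"
    and A6: "integrable M (\<lambda>\<omega>. norm (X \<omega>) powr max (2 * \<alpha>) 2)"
    and A7: "antimono_on {0..} f"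
    and A8: "\<And>R a. 0 < R \<Longrightarrow> 0 < a \<Longrightarrow>
      (\<integral>\<^sup>+ \<omega>. e2ennreal ((log_ext (f ((\<bar>Y \<omega>\<bar> + R * norm (X \<omega>)) / a)))\<^sup>2) \<partial>M) < \<infinity>"
    and A9: "C2_on (interior (fun_support f)) f"
    and A10: "\<And>\<delta>. 0 < \<delta> \<Longrightarrow> \<exists>\<eta>'>0. \<forall>\<beta>' s'. 0 < s' \<longrightarrow>
      norm (\<beta>' - \<beta>\<^sub>0) + \<bar>s' - s\<^sub>0\<bar> \<le> \<eta>' \<longrightarrow>
      (\<forall>i j. (SUP (x, y) \<in> measure_support (distr M borel (\<lambda>\<omega>. (X \<omega>, Y \<omega>))).
        ereal \<bar>partial_deriv i (partial_deriv j (\<lambda>\<beta>. ln (scaled_density f s\<^sub>0 (y - \<beta> \<bullet> x)))) \<beta>\<^sub>0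
             - partial_deriv i (partial_deriv j (\<lambda>\<beta>. ln (scaled_density f s' (y - \<beta> \<bullet> x)))) \<beta>'\<bar>)
        < ereal \<delta>)"
    and A11: "pos_def_matrix (\<chi> i j. LINT \<omega>|M. X \<omega> $ i * X \<omega> $ j)"
      "(\<integral>\<^sup>+ t. t\<^sup>2 * (deriv f t)\<^sup>2 / f t \<partial>lborel) \<in> {0<..<\<infinity>}"
    and mle_measurable: "\<And>n. \<beta>_hat n \<in> borel_measurable M" "\<And>n. s_hat n \<in> borel_measurable M"
    and mle: "AE \<omega> in M. \<forall>\<^sub>F n in sequentially.
      is_mle f n (\<lambda>i. Xs i \<omega>) (\<lambda>i. Ys i \<omega>) (\<beta>_hat n \<omega>) (s_hat n \<omega>)"
  shows "let \<eta> = inverse ((LINT t|lborel. t\<^sup>2 * f t) * (LINT t|lborel. (deriv f t)\<^sup>2 / f t)) in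
    has_are M \<beta>_hat (\<lambda>n \<omega>. ols n (\<lambda>i. Xs i \<omega>) (\<lambda>i. Ys i \<omega>)) \<beta>\<^sub>0 \<eta> \<and>
    \<eta> \<le> 1 \<and>
    (\<eta> = 1 \<longleftrightarrow> distributed M lborel \<epsilon> (normal_density 0 (sqrt (prob_space.variance M \<epsilon>))))"
proof -
  interpret prob_space M by (rule M)
  have X [measurable]: "X \<in> borel_measurable M" and \<epsilon> [measurable]: "\<epsilon> \<in> borel_measurable M"
    using A1 by (simp_all add: indep_rvs_def)
  have [measurable]: "f \<in> borel_measurable borel" by (rule borel_measurable_continuous_onI[OF A3(6)])
  have Y [measurable]: "Y \<in> borel_measurable M"
    using model by (subst measurable_cong[where g="\<lambda>\<omega>. \<beta>\<^sub>0 \<bullet> X \<omega> + \<epsilon> \<omega>"]) auto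
  define Q :: "real ^ 'n ^ 'n" where "Q = (\<chi> i j. LINT \<omega>|M. X \<omega> $ i * X \<omega> $ j)"
  have Q: "pos_def_matrix Q" using A11(1) by (simp add: Q_def)
  \<comment> \<open>Used twice: to apply (A8) to a variable that is not almost surely 0, and to find
    a covariate at which (A10) constrains \<open>\<psi>''\<close>.\<close>
  have X_nonzero: "\<not> (AE \<omega> in M. X \<omega> $ i = 0)" for i
  proof
    assume "AE \<omega> in M. X \<omega> $ i = 0"
    then have "(LINT \<omega>|M. X \<omega> $ i * X \<omega> $ i) = (LINT \<omega>|M. 0)"
      by (intro integral_cong_AE) auto
    then have "Q $ i $ i = 0" by (simp add: Q_def)
    moreover have "axis i (1::real) \<noteq> 0" by (simp add: axis_eq_0_iff)
    then have "0 < axis i 1 \<bullet> (Q *v axis i 1)" using Q by (simp add: pos_def_matrix_def)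
    ultimately show False by (simp add: inner_axis' matrix_vector_mul_component inner_axis)
  qed
  have f_pos: "0 < f t" for t
  proof (rule density_pos_if_log_moments[where f=f and V="\<lambda>\<omega>. \<bar>Y \<omega>\<bar> + 1 * norm (X \<omega>)"])
    show "\<not> (AE \<omega> in M. \<bar>Y \<omega>\<bar> + 1 * norm (X \<omega>) = 0)"
    proof
      assume "AE \<omega> in M. \<bar>Y \<omega>\<bar> + 1 * norm (X \<omega>) = 0"
      then have "AE \<omega> in M. X \<omega> $ i = 0" for i
        by eventually_elim (simp add: add_nonneg_eq_0_iff)
      with X_nonzero show False by blast
    qed
  qed (use A3 A7 A8[of 1] in simp_all)
  define \<psi>' where "\<psi>' t = deriv f t / f t" for t
  define \<psi>'' where "\<psi>'' t = deriv (deriv f) t / f t - (deriv f t / f t)\<^sup>2" for t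
  \<comment> \<open>Positivity makes the support the whole line, so (A9) holds everywhere.\<close>
  have "{t. f t \<noteq> 0} = UNIV" using f_pos by (auto simp: less_le)
  then have "interior (fun_support f) = UNIV" by (simp add: fun_support_def)
  then have C2: "C2_on UNIV f" using A9 by simp
  have df: "(f has_real_derivative deriv f t) (at t)" and ddf: "(deriv f has_real_derivative deriv (deriv f) t) (at t)" for t
    using C2 by (simp_all add: C2_on_def DERIV_deriv_iff_real_differentiable)
  have d1: "((\<lambda>t. ln (f t)) has_real_derivative \<psi>' t) (at t)" for t
    using f_pos by (auto intro!: derivative_eq_intros df simp: \<psi>'_def)
  have d2: "(\<psi>' has_real_derivative \<psi>'' t) (at t)" for t
    unfolding \<psi>'_def[abs_def] using f_pos[of t]
    by (auto intro!: derivative_eq_intros df ddf simp: \<psi>''_def power2_eq_square field_simps)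
  have cont_df: "continuous_on UNIV (deriv f)"
    using DERIV_isCont[OF ddf] by (simp add: continuous_on_eq_continuous_at)
  have cont: "continuous_on UNIV \<psi>''"
    unfolding \<psi>''_def[abs_def]
    using C2 A3(6) cont_df f_pos by (intro continuous_intros) (auto simp: C2_on_def less_le)

  define D where "D = distr M borel (\<lambda>\<omega>. (X \<omega>, Y \<omega>))"
  define S where "S = measure_support D"
  define P\<^sub>X where "P\<^sub>X = distr M borel X"
  define e where "e \<omega> = \<epsilon> \<omega> / s\<^sub>0" for \<omega>
  have [measurable]: "e \<in> borel_measurable M" unfolding e_def by measurable
  have e_law: "distr M borel e = density lborel f"
  proof -
    have "distributed M lborel (\<lambda>\<omega>. 0 + (1 / s\<^sub>0) * \<epsilon> \<omega>)
        (\<lambda>x. ennreal (scaled_density f s\<^sub>0 ((x - 0) / (1 / s\<^sub>0))) / ennreal \<bar>1 / s\<^sub>0\<bar>)"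
      using s0 by (intro distributed_affine A3(1)) simp
    moreover have "ennreal (scaled_density f s\<^sub>0 ((x - 0) / (1 / s\<^sub>0))) / ennreal \<bar>1 / s\<^sub>0\<bar> = ennreal (f x)" for x
      using s0 A3(2) by (simp add: scaled_density_def divide_ennreal)
    moreover have "(\<lambda>\<omega>. 0 + (1 / s\<^sub>0) * \<epsilon> \<omega>) = e" by (auto simp: e_def)
    ultimately have "distributed M lborel e f" by simp
    then show ?thesis unfolding distributed_def by (auto cong: distr_cong)
  qed
  have XF_law: "distr M (borel \<Otimes>\<^sub>M borel) (\<lambda>\<omega>. (X \<omega>, e \<omega>)) = P\<^sub>X \<Otimes>\<^sub>M density lborel f"
    using joint_distr_if_indep_rvs[OF A1, of "\<lambda>t. t / s\<^sub>0"]
    unfolding e_def[symmetric] P\<^sub>X_def by (simp add: e_law)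
  define obs where "obs p = (fst p, \<beta>\<^sub>0 \<bullet> fst p + s\<^sub>0 * snd p)" for p :: "(real ^ 'n) \<times> real"
  have obs [measurable]: "obs \<in> borel_measurable (borel \<Otimes>\<^sub>M borel)" unfolding obs_def by measurable
  have D_eq: "D = distr (P\<^sub>X \<Otimes>\<^sub>M density lborel f) borel obs"
  proof -
    have "distr (P\<^sub>X \<Otimes>\<^sub>M density lborel f) borel obs = distr M borel (obs \<circ> (\<lambda>\<omega>. (X \<omega>, e \<omega>)))"
      unfolding XF_law[symmetric] by (rule distr_distr) measurable
    also have "\<dots> = D"
      unfolding D_def using model s0 by (intro distr_cong) (auto simp: obs_def e_def)
    finally show ?thesis ..
  qed
  have AE_S: "AE z in D. z \<in> S" unfolding S_def by (rule AE_measure_support) (simp add: D_def)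
  have hess: "\<exists>\<eta>>0. \<forall>\<beta> s. 0 < s \<longrightarrow> norm (\<beta> - \<beta>\<^sub>0) + \<bar>s - s\<^sub>0\<bar> \<le> \<eta> \<longrightarrow>
      (\<forall>z\<in>S. \<forall>j k. \<bar>fst z $ j * fst z $ k * (\<psi>'' ((snd z - \<beta>\<^sub>0 \<bullet> fst z) / s\<^sub>0) / s\<^sub>0\<^sup>2
        - \<psi>'' ((snd z - \<beta> \<bullet> fst z) / s) / s\<^sup>2)\<bar> \<le> \<delta>)" if \<delta>: "0 < \<delta>" for \<delta>
  proof -
    note partial = second_partial_deriv_ln_scaled_density[OF f_pos d1 d2]
    obtain \<eta> where "0 < \<eta>" and \<eta>: "\<And>\<beta> s j k. 0 < s \<Longrightarrow> norm (\<beta> - \<beta>\<^sub>0) + \<bar>s - s\<^sub>0\<bar> \<le> \<eta> \<Longrightarrow>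
      (SUP (x, y) \<in> S. ereal \<bar>partial_deriv j (partial_deriv k (\<lambda>\<beta>. ln (scaled_density f s\<^sub>0 (y - \<beta> \<bullet> x)))) \<beta>\<^sub>0
             - partial_deriv j (partial_deriv k (\<lambda>\<beta>. ln (scaled_density f s (y - \<beta> \<bullet> x)))) \<beta>\<bar>) < ereal \<delta>"
      using A10[OF \<delta>] unfolding S_def D_def by blast
    have "\<bar>fst z $ j * fst z $ k * (\<psi>'' ((snd z - \<beta>\<^sub>0 \<bullet> fst z) / s\<^sub>0) / s\<^sub>0\<^sup>2
        - \<psi>'' ((snd z - \<beta> \<bullet> fst z) / s) / s\<^sup>2)\<bar> \<le> \<delta>"
      if s: "0 < s" and near: "norm (\<beta> - \<beta>\<^sub>0) + \<bar>s - s\<^sub>0\<bar> \<le> \<eta>" and z: "z \<in> S" for \<beta> s z j k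
    proof -
      let ?g = "\<lambda>(x, y). ereal \<bar>partial_deriv j (partial_deriv k (\<lambda>\<beta>. ln (scaled_density f s\<^sub>0 (y - \<beta> \<bullet> x)))) \<beta>\<^sub>0
             - partial_deriv j (partial_deriv k (\<lambda>\<beta>. ln (scaled_density f s (y - \<beta> \<bullet> x)))) \<beta>\<bar>"
      have "?g z \<le> (SUP p \<in> S. ?g p)" using z by (rule SUP_upper)
      also have "\<dots> < ereal \<delta>" by (rule \<eta>[OF s near])
      finally have "?g z < ereal \<delta>" .
      then show ?thesis
        unfolding partial[OF s] partial[OF s0] right_diff_distrib by (simp add: split_beta)
    qed
    then show ?thesis using \<open>0 < \<eta>\<close> by blast
  qed

  have prob_F: "prob_space (density lborel f)"
    unfolding e_law[symmetric] by (rule prob_space_distr) simp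
  have prob_PX: "prob_space P\<^sub>X" unfolding P\<^sub>X_def by (rule prob_space_distr) simp
  interpret joint: pair_prob_space P\<^sub>X "density lborel f"
    using prob_F prob_PX by (simp add: pair_prob_space_def pair_sigma_finite_def prob_space_imp_sigma_finite)
  \<comment> \<open>(A10) at \<open>\<beta>\<^sub>0\<close> and a scale
    \<open>s < s\<^sub>0\<close>: the residual at scale \<open>s\<close> is
    \<open>c = s\<^sub>0 / s\<close> times the one at \<open>s\<^sub>0\<close>, so
    \<open>\<psi>'' t - c\<^sup>2 * \<psi>'' (c * t)\<close> is bounded, as
    \<open>bounded_if_almost_homogeneous\<close> requires.\<close>
  have "\<exists>K. \<forall>t. \<bar>\<psi>'' t\<bar> \<le> K"
  proof -
    obtain i :: 'n where True by blast
    obtain \<eta> where \<eta>: "0 < \<eta>" and h: "\<And>\<beta> s z j k. 0 < s \<Longrightarrow> norm (\<beta> - \<beta>\<^sub>0) + \<bar>s - s\<^sub>0\<bar> \<le> \<eta> \<Longrightarrow> z \<in> S \<Longrightarrow>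
      \<bar>fst z $ j * fst z $ k * (\<psi>'' ((snd z - \<beta>\<^sub>0 \<bullet> fst z) / s\<^sub>0) / s\<^sub>0\<^sup>2
        - \<psi>'' ((snd z - \<beta> \<bullet> fst z) / s) / s\<^sup>2)\<bar> \<le> 1"
      using hess[OF zero_less_one] by blast
    \<comment> \<open>Within the distance allowed by (A10), at least half of
      \<open>s\<^sub>0\<close>, and strictly below it so that \<open>c > 1\<close>.\<close>
    define s where "s = s\<^sub>0 - min \<eta> (s\<^sub>0 / 2)"
    have s: "0 < s" "s < s\<^sub>0" "\<bar>s - s\<^sub>0\<bar> \<le> \<eta>" using \<eta> s0 by (auto simp: s_def min_def)
    define c where "c = s\<^sub>0 / s"
    have c: "1 < c" using s by (simp add: c_def)
    have "AE p in P\<^sub>X \<Otimes>\<^sub>M density lborel f. obs p \<in> S"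
      using AE_S unfolding D_eq by (rule AE_distrD[rotated]) (simp add: P\<^sub>X_def cong: measurable_cong_sets)
    then have "AE x in P\<^sub>X. AE t in density lborel f. obs (x, t) \<in> S" by (rule joint.AE_pair)
    moreover have "\<not> (AE x in P\<^sub>X. x $ i = 0)"
      using X_nonzero[of i] unfolding P\<^sub>X_def by (subst AE_distr_iff) auto
    \<comment> \<open>Fubini fixes one covariate with \<open>x $ i \<noteq> 0\<close> for which
      almost every error gives an observation in the support; its factor
      \<open>(x $ i)\<^sup>2\<close> can then be divided out.\<close>
    ultimately obtain x where x: "x $ i \<noteq> 0" and ae: "AE t in density lborel f. obs (x, t) \<in> S"
      by (smt (verit, del_insts) AE_mp AE_I2 eventually_mono)
    have "AE t in lborel. \<bar>\<psi>'' t - c\<^sup>2 * \<psi>'' (c * t)\<bar> \<le> s\<^sub>0\<^sup>2 / (x $ i)\<^sup>2"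
    proof -
      have "AE t in lborel. obs (x, t) \<in> S"
        using ae f_pos by (subst (asm) AE_density) auto
      then show ?thesis
      proof eventually_elim
        case (elim t)
        define r where "r = \<psi>'' t / s\<^sub>0\<^sup>2 - \<psi>'' (c * t) / s\<^sup>2"
        have "\<bar>(x $ i)\<^sup>2 * r\<bar> \<le> 1"
          using h[of s \<beta>\<^sub>0 "obs (x, t)" i i] elim s s0 by (simp add: obs_def c_def r_def power2_eq_square)
        then have "\<bar>r\<bar> * (x $ i)\<^sup>2 \<le> 1" by (simp add: abs_mult mult.commute)
        then have "\<bar>r\<bar> \<le> 1 / (x $ i)\<^sup>2" using x by (simp add: pos_le_divide_eq)
        then have "s\<^sub>0\<^sup>2 * \<bar>r\<bar> \<le> s\<^sub>0\<^sup>2 * (1 / (x $ i)\<^sup>2)" by (rule mult_left_mono) simp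
        moreover have "\<psi>'' t - c\<^sup>2 * \<psi>'' (c * t) = s\<^sub>0\<^sup>2 * r"
          using s0 by (simp add: c_def r_def power_divide right_diff_distrib)
        ultimately show ?case by (simp add: abs_mult)
      qed
    qed
    \<comment> \<open>A closed set of full Lebesgue measure is the whole line, so the bound holds at
      every \<open>t\<close>.\<close>
    moreover have "closed {t. \<bar>\<psi>'' t - c\<^sup>2 * \<psi>'' (c * t)\<bar> \<le> s\<^sub>0\<^sup>2 / (x $ i)\<^sup>2}"
      by (intro closed_Collect_le continuous_intros cont continuous_on_compose2[OF cont]) auto
    ultimately have "\<bar>\<psi>'' t - c\<^sup>2 * \<psi>'' (c * t)\<bar> \<le> s\<^sub>0\<^sup>2 / (x $ i)\<^sup>2" for t
      using mem_closed_if_AE_lebesgue[of "{t. \<bar>\<psi>'' t - c\<^sup>2 * \<psi>'' (c * t)\<bar> \<le> s\<^sub>0\<^sup>2 / (x $ i)\<^sup>2}" t] AE_completion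
      by auto
    then show ?thesis by (rule bounded_if_almost_homogeneous[OF cont c])
  qed
  then obtain K where K: "\<And>t. \<bar>\<psi>'' t\<bar> \<le> K" by blast

  interpret error_density f \<psi>' \<psi>'' K \<alpha> C
    by standard (use f_pos d1 d2 cont K A3 A4 A7 in auto)
  have F: "F = density lborel f" by (simp add: F_def)
  interpret regression f \<psi>' \<psi>'' K \<alpha> C M "\<lambda>i \<omega>. (Xs i \<omega>, Ys i \<omega>)" D P\<^sub>X \<beta>\<^sub>0 s\<^sub>0 Q
  proof
    show "indep_vars (\<lambda>_. borel) (\<lambda>i \<omega>. (Xs i \<omega>, Ys i \<omega>)) UNIV" by (rule iid(1))
    show "distr M borel (\<lambda>\<omega>. (Xs i \<omega>, Ys i \<omega>)) = D" for i by (simp add: iid(2) D_def)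
    show "sets P\<^sub>X = sets borel" by (simp add: P\<^sub>X_def)
    show "0 < s\<^sub>0" by (rule s0)
    show "D = distr (P\<^sub>X \<Otimes>\<^sub>M F) borel (\<lambda>p. (fst p, \<beta>\<^sub>0 \<bullet> fst p + s\<^sub>0 * snd p))"
      using D_eq by (simp add: F obs_def[abs_def])
    show "integrable P\<^sub>X (\<lambda>x. (norm x)\<^sup>2)"
      unfolding P\<^sub>X_def
    proof (subst integrable_distr_eq)
      show "integrable M (\<lambda>\<omega>. (norm (X \<omega>))\<^sup>2)"
      proof (rule Bochner_Integration.integrable_bound)
        show "integrable M (\<lambda>\<omega>. 1 + norm (X \<omega>) powr max (2 * \<alpha>) 2)" using A6 by simp
        show "AE \<omega> in M. norm ((norm (X \<omega>))\<^sup>2) \<le> norm (1 + norm (X \<omega>) powr max (2 * \<alpha>) 2)"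
        proof (rule AE_I2)
          fix \<omega>
          have "(norm (X \<omega>))\<^sup>2 \<le> 1 + norm (X \<omega>) powr max (2 * \<alpha>) 2"
          proof (cases "norm (X \<omega>) \<le> 1")
            case True
            then have "(norm (X \<omega>))\<^sup>2 \<le> 1" by (simp add: power_le_one)
            then show ?thesis by (simp add: add_increasing2)
          next
            case False
            then have "(norm (X \<omega>))\<^sup>2 = norm (X \<omega>) powr 2" by (simp add: powr_numeral)
            also have "\<dots> \<le> norm (X \<omega>) powr max (2 * \<alpha>) 2" using False by (intro powr_mono) auto
            finally show ?thesis by simp
          qed
          then show "norm ((norm (X \<omega>))\<^sup>2) \<le> norm (1 + norm (X \<omega>) powr max (2 * \<alpha>) 2)" by simp
        qed
      qed measurable
    qed simp_all
    show "Q $ i $ j = (\<integral>x. x $ i * x $ j \<partial>P\<^sub>X)" for i j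
      unfolding P\<^sub>X_def Q_def by (subst integral_distr) auto
    show "pos_def_matrix Q" by (rule Q)
  qed
  have m2: "m\<^sub>2 = (LINT t|lborel. t\<^sup>2 * f t)"
    unfolding m\<^sub>2_def by (subst integral_F) (simp_all add: mult.commute)
  have info: "info = (LINT t|lborel. (deriv f t)\<^sup>2 / f t)"
  proof -
    have "info = (LINT t|lborel. f t * (\<psi>' t)\<^sup>2)"
      unfolding info_def by (rule integral_F) measurable
    also have "\<dots> = (LINT t|lborel. (deriv f t)\<^sup>2 / f t)"
      by (intro Bochner_Integration.integral_cong)
        (auto simp: \<psi>'_def power2_eq_square less_imp_neq[OF f_pos, symmetric])
    finally show ?thesis .
  qed
  define \<eta> where "\<eta> = inverse (m\<^sub>2 * info)"
  have "asymp_normal M \<beta>_hat \<beta>\<^sub>0 ((s\<^sub>0\<^sup>2 / info) *\<^sub>R Q\<^sub>i\<^sub>n\<^sub>v)"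
    by (rule asymp_normal_mle[OF mle_measurable _ AE_S]) (use mle hess in \<open>simp_all add: inner_theta\<close>)
  moreover have "asymp_normal M (\<lambda>n \<omega>. ols n (\<lambda>i. Xs i \<omega>) (\<lambda>i. Ys i \<omega>)) \<beta>\<^sub>0 ((s\<^sub>0\<^sup>2 * m\<^sub>2) *\<^sub>R Q\<^sub>i\<^sub>n\<^sub>v)"
    using asymp_normal_ols by simp
  moreover have "det ((s\<^sub>0\<^sup>2 * m\<^sub>2) *\<^sub>R Q\<^sub>i\<^sub>n\<^sub>v) \<noteq> 0"
    using s0 m2_pos det_Qinv by (simp add: det_scaleR)
  moreover have "\<eta> = (det ((s\<^sub>0\<^sup>2 / info) *\<^sub>R Q\<^sub>i\<^sub>n\<^sub>v) / det ((s\<^sub>0\<^sup>2 * m\<^sub>2) *\<^sub>R Q\<^sub>i\<^sub>n\<^sub>v)) powr (1 / real CARD('n))"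
    using s0 m2_pos info_pos det_Qinv by (subst powr_CARD_ratio) (auto simp: \<eta>_def field_simps)
  ultimately have are: "has_are M \<beta>_hat (\<lambda>n \<omega>. ols n (\<lambda>i. Xs i \<omega>) (\<lambda>i. Ys i \<omega>)) \<beta>\<^sub>0 \<eta>"
    unfolding has_are_def by blast
  have le1: "\<eta> \<le> 1" unfolding \<eta>_def inverse_le_1_iff using info_bound by simp

  have e_int: "(LINT \<omega>|M. h (e \<omega>)) = (\<integral>t. h t \<partial>F)" if [measurable]: "h \<in> borel_measurable borel" for h :: "real \<Rightarrow> real"
    unfolding F e_law[symmetric] by (subst integral_distr) auto
  have \<epsilon>_e: "\<epsilon> \<omega> = s\<^sub>0 * e \<omega>" for \<omega> using s0 by (simp add: e_def)
  have mean: "expectation \<epsilon> = 0"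
    using e_int[of "\<lambda>t. s\<^sub>0 * t"] integral_F_odd[of "\<lambda>t. t"] by (simp add: \<epsilon>_e[abs_def])
  have var: "variance \<epsilon> = s\<^sub>0\<^sup>2 * m\<^sub>2"
  proof -
    have "variance \<epsilon> = expectation (\<lambda>\<omega>. (s\<^sub>0 * e \<omega>)\<^sup>2)"
      unfolding mean by (simp add: \<epsilon>_e)
    also have "\<dots> = (\<integral>t. (s\<^sub>0 * t)\<^sup>2 \<partial>F)" by (rule e_int) measurable
    also have "\<dots> = s\<^sub>0\<^sup>2 * m\<^sub>2" by (simp add: power_mult_distrib m\<^sub>2_def)
    finally show ?thesis .
  qed
  define \<sigma> where "\<sigma> = sqrt m\<^sub>2"
  have \<sigma>: "0 < \<sigma>" using m2_pos by (simp add: \<sigma>_def)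
  have sd: "sqrt (variance \<epsilon>) = s\<^sub>0 * \<sigma>" unfolding var \<sigma>_def using s0 by (simp add: real_sqrt_mult)
  have scale: "normal_density 0 (s\<^sub>0 * \<sigma>) t = normal_density 0 \<sigma> (t / s\<^sub>0) / s\<^sub>0" for t
    using s0 \<sigma> by (simp add: normal_density_def real_sqrt_mult power_mult_distrib field_simps)
  have "\<eta> = 1 \<longleftrightarrow> distributed M lborel \<epsilon> (normal_density 0 (sqrt (variance \<epsilon>)))"
  proof
    assume "\<eta> = 1"
    then have "m\<^sub>2 * info = 1" by (metis \<eta>_def inverse_inverse_eq inverse_1)
    then have "f t = normal_density 0 \<sigma> t" for t unfolding \<sigma>_def by (rule info_eq_imp_normal)
    then have "scaled_density f s\<^sub>0 = normal_density 0 (sqrt (variance \<epsilon>))"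
      unfolding sd by (auto simp: scaled_density_def scale)
    then show "distributed M lborel \<epsilon> (normal_density 0 (sqrt (variance \<epsilon>)))" using A3(1) by simp
  next
    assume "distributed M lborel \<epsilon> (normal_density 0 (sqrt (variance \<epsilon>)))"
    \<comment> \<open>A law determines its density only almost everywhere; continuity of both sides
      upgrades this to every point.\<close>
    then have "AE t in lborel. ennreal (normal_density 0 (s\<^sub>0 * \<sigma>) t) = ennreal (scaled_density f s\<^sub>0 t)"
      unfolding sd by (rule distributed_unique[OF _ A3(1)])
    then have "AE t in lborel. normal_density 0 (s\<^sub>0 * \<sigma>) t - scaled_density f s\<^sub>0 t = 0"
      by eventually_elim (use s0 A3(2) in \<open>simp add: scaled_density_def\<close>)
    moreover have "continuous_on UNIV (\<lambda>t. normal_density 0 (s\<^sub>0 * \<sigma>) t - scaled_density f s\<^sub>0 t)"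
      unfolding normal_density_def scaled_density_def using s0 \<sigma>
      by (intro continuous_intros continuous_on_compose2[OF A3(6)]) auto
    ultimately have eq: "normal_density 0 (s\<^sub>0 * \<sigma>) t - scaled_density f s\<^sub>0 t = 0" for t
      by (rule continuous_AE_eq_0_imp_eq_0[rotated])
    have "f t = normal_density 0 \<sigma> t" for t
      using eq[of "s\<^sub>0 * t"] s0 by (simp add: scale scaled_density_def)
    then have "m\<^sub>2 * info = 1" by (rule normal_imp_info_eq[OF \<sigma>])
    then show "\<eta> = 1" by (simp add: \<eta>_def)
  qed
  with are le1 show ?thesis
    unfolding Let_def m2[symmetric] info[symmetric] \<eta>_def[symmetric] by blast
qed

end
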